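(* Let $k$ be a positive integer. For every integer $n\ge 0$: \begin{align*} &N^{0}(k,2k;n)\equiv 0 \pmod{2},\\ &N^{0}(0,4;8n+r) \equiv 0 \pmod{4}\ (r\in\{5,7\}),\quad N^{0}(0,4;16n+13) \equiv 0 \pmod{8},\\ &N^{0}(1,4;8n+4) \equiv 0 \pmod{2},\quad N^{0}(1,4;8n+6)\equiv 0 \pmod{4},\quad N^{0}(1,4;40n+r)\equiv 0 \pmod{5}\ (r\in\{28,36\}),\\ &N^{0}(2,4;16n+13)\equiv 0 \pmod{4},\\ &N^{0}(0,8;8n+r)\equiv 0 \pmod{2}\ (r\in\{5,7\}),\quad N^{0}(0,8;16n+13) \equiv 0 \pmod{4},\quad N^{0}(0,8;16n+15)\equiv 0 \pmod{16},\\ &N^{0}(2,8;8n+1)\equiv 0 \pmod{4},\quad N^{0}(2,8;16n+11)\equiv 0 \pmod{8},\quad N^{0}(2,8;16n+13)\equiv 0 \pmod{2}. \end{align*}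
   Context: An odd Durfee symbol of a positive integer $n$ consists of a nonnegative integer $D$ together with two (possibly empty) non-increasing sequences of odd positive integers $a_1\ge\cdots\ge a_s$ (top row) and $b_1\ge\cdots\ge b_t$ (bottom row), all entries at most $2D+1$, such that $n=\sum a_i+\sum b_j+2D^2+2D+1$. Its odd rank is $s-t$. $N^{0}(a,M;n)$ is the number of odd Durfee symbols of $n$ whose odd rank is congruent to $a$ modulo $M$, with $N^0(a,M;0)=0$. *)

theory Defs
  imports "HOL-Number_Theory.Cong"
begin

text \<open>A symbol is a triple \<open>(D, as, bs)\<close> of the subscript, the top row and the bottom row.\<close>

type_synonym durfee_symbol = "nat \<times> nat list \<times> nat list"

definition odd_durfee_row :: "nat \<Rightarrow> nat list \<Rightarrow> bool" where
  "odd_durfee_row D xs \<longleftrightarrow>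
     sorted_wrt (\<ge>) xs \<and> (\<forall>x \<in> set xs. odd x \<and> x \<le> 2 * D + 1)"

definition odd_durfee_symbols :: "nat \<Rightarrow> durfee_symbol set" where
  "odd_durfee_symbols n =
     {(D, as, bs). odd_durfee_row D as \<and> odd_durfee_row D bs \<and>
        n = sum_list as + sum_list bs + 2 * D ^ 2 + 2 * D + 1}"

fun odd_rank :: "durfee_symbol \<Rightarrow> int" where
  "odd_rank (D, as, bs) = int (length as) - int (length bs)"

definition N0 :: "int \<Rightarrow> nat \<Rightarrow> nat \<Rightarrow> nat" where
  "N0 a M n = card {S \<in> odd_durfee_symbols n. [odd_rank S = a] (mod int M)}"

lemma length_le_sum_list_pos:
  fixes xs :: "nat list"
  assumes "\<forall>x \<in> set xs. odd x"
  shows "length xs \<le> sum_list xs"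
  using assms
proof (induction xs)
  case (Cons x xs)
  then have "1 \<le> x" by (auto intro: Suc_leI odd_pos)
  with Cons show ?case by simp
qed simp

text \<open>Finiteness ensures that \<^const>\<open>card\<close> is a genuine count in \<^const>\<open>N0\<close>.\<close>

lemma finite_odd_durfee_symbols: "finite (odd_durfee_symbols n)"
proof (rule finite_subset)
  let ?L = "{xs :: nat list. set xs \<subseteq> {..n} \<and> length xs \<le> n}"
  show "finite ({..n} \<times> ?L \<times> ?L)"
    by (intro finite_cartesian_product finite_lists_length_le) auto
  have row: "xs \<in> ?L" if "odd_durfee_row D xs" "sum_list xs \<le> n" for D xs
    using that length_le_sum_list_pos[of xs] member_le_sum_list[of _ xs]
    by (fastforce simp: odd_durfee_row_def)
  show "odd_durfee_symbols n \<subseteq> {..n} \<times> ?L \<times> ?L"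
  proof
    fix S assume "S \<in> odd_durfee_symbols n"
    then obtain D as bs where S: "S = (D, as, bs)"
      and "odd_durfee_row D as" "odd_durfee_row D bs"
      and "n = sum_list as + sum_list bs + 2 * D ^ 2 + 2 * D + 1"
      by (auto simp: odd_durfee_symbols_def)
    then show "S \<in> {..n} \<times> ?L \<times> ?L"
      using row[of D as] row[of D bs] by simp
  qed
qed

lemma N0_zero: "N0 a M 0 = 0"
  by (simp add: N0_def odd_durfee_symbols_def)

end

theory Submission
  imports Defs "HOL-Computational_Algebra.Formal_Laurent_Series"
begin

text \<open>
  The generating function of odd Durfee symbols with the rank marked by $z$ is
  $\sum_D q^{2D^2+2D+1} / \prod_{j\le D} (1 - zq^{2j+1})(1 - q^{2j+1}/z)$. Expanding each summand into
  partial fractions and summing over $D$ gives an Appell--Lerch sum, whose parts even and odd in $q$ depend,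
  up to a factor, only on $t = z^2 + z^{-2}$.

  The key identity is a second partial fraction expansion. With $q$ in place of $q^2$, $y = z^2$ and
  $(a)_m = \prod_{i\ge 0} (1 - a q^{mi})$, the product
  $(q^4)_4 (-q)_2^2 / ((yq)_2 (q/y)_2 (-yq^2)_4 (-q^2/y)_4)$ has poles of two kinds. The residues at
  $y = q^{-(2j+1)}$ reproduce the Appell--Lerch sum for odd $n$, and those at $y = -q^{-(4k+2)}$ form a mock theta
  function that only lives in odd powers of $q$ and changes in a controlled way under $t \mapsto -t$.
  In every residue class considered these mock parts vanish or cancel between $z = 1$ and $z = i$, so the
  counting functions become coefficients of theta quotients; for even $n$ the same works with $-q^{-4k}$.
  The congruences then follow from the dissections $\varphi(q) = \varphi(q^4) + 2q\psi(q^8)$ and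
  $\varphi(q)^2 = \varphi(q^2)^2 + 4q\psi(q^4)^2$, and modulo 5 from the pentagonal number theorem.
\<close>

section \<open>Truncated congruence and infinite sums and products of power series\<close>

unbundle fps_syntax

declare [[simproc del: poly_fps_eq]]

text \<open>Why the second family of poles has this shape: for fixed j the numbers |4k+2 - (2j+1)|
  and 4k+2 + (2j+1) run exactly once through all odd numbers. So the cofactor at q^(2j+1) depends on
  j only through a power of q, and this power q^(j(j+1)/2) turns the q^(j(j+1)) of a plain expansion
  into the q^(3j(j+1)/2) of the Appell-Lerch sum. Conversely the cofactor at -q^(4k+2) starts with
  q^((2k+1)^2), and odd squares are 1 modulo 8; this decides where the mock part lives. No analysis
  enters. Everything depends on y only through t = y + 1/y, each factor is linear in t, and residues
  become Lagrange interpolation at finitely many nodes. The number of nodes then tends to infinity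
  q-adically, so all infinite identities are proved as congruences modulo q^K for every K. Three
  values of t suffice: 2, -2 and 0, coming from z = 1, z = i and a primitive eighth root of unity.
  The last one separates the ranks 0 and 4 modulo 8.\<close>

definition fps_cong :: "nat \<Rightarrow> 'a::comm_ring_1 fps \<Rightarrow> 'a fps \<Rightarrow> bool" where
  "fps_cong K f g \<longleftrightarrow> (\<forall>n<K. f $ n = g $ n)"

lemma fps_cong_refl [simp]: "fps_cong K f f"
  by (simp add: fps_cong_def)

lemma fps_cong_sym: "fps_cong K f g \<Longrightarrow> fps_cong K g f"
  by (simp add: fps_cong_def)

lemma fps_cong_trans [trans]: "fps_cong K f g \<Longrightarrow> fps_cong K g h \<Longrightarrow> fps_cong K f h"
  by (simp add: fps_cong_def)

lemma fps_cong_eq_trans [trans]: "fps_cong K f g \<Longrightarrow> g = h \<Longrightarrow> fps_cong K f h"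
  by simp

lemma fps_eq_cong_trans [trans]: "f = g \<Longrightarrow> fps_cong K g h \<Longrightarrow> fps_cong K f h"
  by simp

lemma fps_cong_mono: "fps_cong K f g \<Longrightarrow> L \<le> K \<Longrightarrow> fps_cong L f g"
  by (simp add: fps_cong_def)

lemma fps_cong_eqI: "(\<And>K. fps_cong K f g) \<Longrightarrow> f = g"
  by (auto simp: fps_cong_def fps_eq_iff)

lemma fps_cong_add: "fps_cong K f f' \<Longrightarrow> fps_cong K g g' \<Longrightarrow> fps_cong K (f + g) (f' + g')"
  by (simp add: fps_cong_def)

lemma fps_cong_diff: "fps_cong K f f' \<Longrightarrow> fps_cong K g g' \<Longrightarrow> fps_cong K (f - g) (f' - g')"
  by (simp add: fps_cong_def)

lemma fps_cong_mult: "fps_cong K f f' \<Longrightarrow> fps_cong K g g' \<Longrightarrow> fps_cong K (f * g) (f' * g')"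
  by (auto simp: fps_cong_def fps_mult_nth intro!: sum.cong)

lemma fps_cong_sum: "(\<And>i. i \<in> A \<Longrightarrow> fps_cong K (f i) (g i)) \<Longrightarrow> fps_cong K (sum f A) (sum g A)"
  by (auto simp: fps_cong_def fps_sum_nth intro!: sum.cong)

lemma fps_cong_prod: "(\<And>i. i \<in> A \<Longrightarrow> fps_cong K (f i) (g i)) \<Longrightarrow> fps_cong K (prod f A) (prod g A)"
  by (induction A rule: infinite_finite_induct) (auto intro: fps_cong_mult)

lemma fps_cong_inverse:
  fixes f g :: "'a::field fps"
  assumes "fps_cong K f g" "f $ 0 \<noteq> 0" "g $ 0 \<noteq> 0"
  shows "fps_cong K (inverse f) (inverse g)"
proof -
  have "fps_cong K (inverse f * inverse g * g) (inverse f * inverse g * f)"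
    by (intro fps_cong_mult fps_cong_refl fps_cong_sym[OF assms(1)])
  moreover have "inverse f * inverse g * g = inverse f"
    using inverse_mult_eq_1[OF assms(3)] by (simp add: mult.assoc)
  moreover have "inverse f * inverse g * f = inverse g"
    using inverse_mult_eq_1[OF assms(2)] by (simp add: mult_ac)
  ultimately show ?thesis by simp
qed

lemma fps_cong_X_power_0: "K \<le> e \<Longrightarrow> fps_cong K (fps_X ^ e * f) 0"
  by (simp add: fps_cong_def fps_X_power_mult_nth)

lemma fps_cong_subset_sum:
  assumes "finite B" "A \<subseteq> B" "\<And>i. i \<in> B - A \<Longrightarrow> fps_cong K (f i) 0"
  shows "fps_cong K (sum f B) (sum f A)"
proof -
  have "sum f B = sum f (B - A) + sum f A"
    using assms by (simp add: sum.subset_diff)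
  moreover have "fps_cong K (sum f (B - A) + sum f A) (sum (\<lambda>_. 0) (B - A) + sum f A)"
    by (intro fps_cong_add fps_cong_sum assms) auto
  ultimately show ?thesis by simp
qed

lemma fps_cong_subset_prod:
  assumes "finite B" "A \<subseteq> B" "\<And>i. i \<in> B - A \<Longrightarrow> fps_cong K (f i) 1"
  shows "fps_cong K (prod f B) (prod f A)"
proof -
  have "prod f B = prod f (B - A) * prod f A"
    using assms by (simp add: prod.subset_diff)
  moreover have "fps_cong K (prod f (B - A) * prod f A) (prod (\<lambda>_. 1) (B - A) * prod f A)"
    by (intro fps_cong_mult fps_cong_prod assms) auto
  ultimately show ?thesis by simp
qed

text \<open>Coefficient n is read off the partial sum up to n, so the definition is total. It is the
  genuine infinite sum once f j = O(q^j), the condition carried by the lemmas below.\<close>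

definition fps_isum :: "(nat \<Rightarrow> 'a::comm_ring_1 fps) \<Rightarrow> 'a fps" where
  "fps_isum f = Abs_fps (\<lambda>n. (\<Sum>j\<le>n. f j) $ n)"

definition fps_iprod :: "(nat \<Rightarrow> 'a::comm_ring_1 fps) \<Rightarrow> 'a fps" where
  "fps_iprod f = Abs_fps (\<lambda>n. (\<Prod>j\<le>n. f j) $ n)"

lemma fps_isum_cong:
  assumes "\<And>j. fps_cong j (f j) 0" "K \<le> N"
  shows "fps_cong K (fps_isum f) (\<Sum>j<N. f j)"
  unfolding fps_cong_def
proof (intro allI impI)
  fix n assume n: "n < K"
  have "fps_cong (Suc n) (\<Sum>j<N. f j) (\<Sum>j\<le>n. f j)"
  proof (rule fps_cong_subset_sum)
    fix i assume "i \<in> {..<N} - {..n}"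
    then show "fps_cong (Suc n) (f i) 0"
      by (intro fps_cong_mono[OF assms(1)]) auto
  qed (use n assms in auto)
  then show "fps_isum f $ n = (\<Sum>j<N. f j) $ n"
    by (simp add: fps_isum_def fps_cong_def)
qed

lemma fps_iprod_cong:
  assumes "\<And>j. fps_cong (Suc j) (f j) 1" "K \<le> N"
  shows "fps_cong K (fps_iprod f) (\<Prod>j<N. f j)"
  unfolding fps_cong_def
proof (intro allI impI)
  fix n assume n: "n < K"
  have "fps_cong (Suc n) (\<Prod>j<N. f j) (\<Prod>j\<le>n. f j)"
  proof (rule fps_cong_subset_prod)
    fix i assume "i \<in> {..<N} - {..n}"
    then show "fps_cong (Suc n) (f i) 1"
      by (intro fps_cong_mono[OF assms(1)]) auto
  qed (use n assms in auto)
  then show "fps_iprod f $ n = (\<Prod>j<N. f j) $ n"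
    by (simp add: fps_iprod_def fps_cong_def)
qed

lemma fps_cong_one_plus_X_power: "K \<le> e \<Longrightarrow> fps_cong K (1 + c * fps_X ^ e) 1"
  using fps_cong_add[OF fps_cong_refl[of K 1] fps_cong_X_power_0[of K e c]] by (simp add: mult_ac)

lemma fps_cong_one_minus_X_power: "K \<le> e \<Longrightarrow> fps_cong K (1 - c * fps_X ^ e) 1"
  using fps_cong_diff[OF fps_cong_refl[of K 1] fps_cong_X_power_0[of K e c]] by (simp add: mult_ac)

section \<open>The substitution q -> q^k\<close>

definition fps_dil :: "nat \<Rightarrow> 'a::idom fps \<Rightarrow> 'a fps" where
  "fps_dil k f = f oo (fps_X ^ k)"

lemma fps_dil_nth:
  assumes "k > 0"
  shows "fps_dil k f $ n = (if k dvd n then f $ (n div k) else 0)"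
proof -
  have "fps_dil k f $ n = (\<Sum>i\<le>n. f $ i * (if n = k * i then 1 else 0))"
    by (simp add: fps_dil_def fps_compose_nth atMost_atLeast0 flip: power_mult)
  also have "\<dots> = (if k dvd n then f $ (n div k) else 0)"
  proof (cases "k dvd n")
    case True
    then obtain m where m: "n = k * m" by blast
    have "(\<Sum>i\<le>n. f $ i * (if n = k * i then 1 else 0)) = (\<Sum>i\<le>n. if i = m then f $ i else 0)"
      using assms m by (intro sum.cong) auto
    also have "\<dots> = f $ m" using assms m by simp
    finally show ?thesis using m assms by simp
  next
    case False
    then have "\<And>i. n \<noteq> k * i" by auto
    then show ?thesis using False by simp
  qed
  finally show ?thesis .
qed

lemma fps_dil_mult: "k > 0 \<Longrightarrow> fps_dil k (f * g) = fps_dil k f * fps_dil k g"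
  by (simp add: fps_dil_def fps_compose_mult_distrib)

lemma fps_dil_add: "fps_dil k (f + g) = fps_dil k f + fps_dil k g"
  by (simp add: fps_dil_def fps_compose_add_distrib)

lemma fps_dil_diff: "fps_dil k (f - g) = fps_dil k f - fps_dil k g"
  by (simp add: fps_dil_def fps_compose_sub_distrib)

lemma fps_dil_uminus: "fps_dil k (- f) = - fps_dil k f"
  by (simp add: fps_dil_def fps_compose_uminus)

lemma fps_dil_power: "k > 0 \<Longrightarrow> fps_dil k (f ^ n) = fps_dil k f ^ n"
  by (simp add: fps_dil_def fps_compose_power)

lemma fps_dil_prod: "k > 0 \<Longrightarrow> fps_dil k (prod f A) = (\<Prod>i\<in>A. fps_dil k (f i))"
  by (simp add: fps_dil_def fps_compose_prod_distrib)

lemma fps_dil_sum: "fps_dil k (sum f A) = (\<Sum>i\<in>A. fps_dil k (f i))"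
  by (simp add: fps_dil_def fps_compose_sum_distrib)

lemma fps_dil_inverse: "k > 0 \<Longrightarrow> fps_dil k (inverse f) = inverse (fps_dil k (f::'a::field fps))"
  by (cases "f $ 0 = 0") (simp_all add: fps_dil_def fps_inverse_compose fps_inverse_eq_0)

lemma fps_dil_const [simp]: "fps_dil k (fps_const c) = fps_const c"
  by (simp add: fps_dil_def)

lemma fps_dil_1 [simp]: "fps_dil k 1 = 1"
  by (simp add: fps_dil_def)

lemma fps_dil_0 [simp]: "fps_dil k 0 = 0"
  by (simp add: fps_dil_def)

lemma fps_dil_numeral [simp]: "fps_dil k (numeral m) = numeral m"
  by (simp add: fps_dil_def)

lemma fps_dil_X: "k > 0 \<Longrightarrow> fps_dil k fps_X = fps_X ^ k"
  by (simp add: fps_dil_def)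

lemma fps_dil_X_power: "k > 0 \<Longrightarrow> fps_dil k (fps_X ^ e) = fps_X ^ (k * e)"
  by (simp add: fps_dil_power fps_dil_X power_mult)

lemma fps_dil_nth_0 [simp]: "fps_dil k f $ 0 = f $ 0"
  by (simp add: fps_dil_def)

lemma fps_dil_dil: "k > 0 \<Longrightarrow> l > 0 \<Longrightarrow> fps_dil k (fps_dil l f) = fps_dil (k * l) f"
  by (auto simp: fps_eq_iff fps_dil_nth div_mult2_eq mult_dvd_mono
       dest: dvd_mult_left elim!: dvdE)

lemma fps_dil_one [simp]: "fps_dil (Suc 0) f = f"
  by (simp add: fps_dil_def)

lemma fps_cong_dil:
  assumes "k > 0" "fps_cong K f g"
  shows "fps_cong K (fps_dil k f) (fps_dil k g)"
  using assms unfolding fps_cong_def fps_dil_nth[OF assms(1)]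
  by (auto intro: le_less_trans[OF div_le_dividend])

lemma fps_dil_isum:
  assumes "k > 0" "\<And>j. fps_cong j (f j) 0"
  shows "fps_dil k (fps_isum f) = fps_isum (\<lambda>j. fps_dil k (f j))"
proof (rule fps_cong_eqI)
  fix K
  have "fps_cong K (fps_dil k (fps_isum f)) (fps_dil k (\<Sum>j<K. f j))"
    using assms by (intro fps_cong_dil fps_isum_cong) auto
  also have "fps_dil k (\<Sum>j<K. f j) = (\<Sum>j<K. fps_dil k (f j))"
    by (rule fps_dil_sum)
  also have "fps_cong K \<dots> (fps_isum (\<lambda>j. fps_dil k (f j)))"
    using fps_cong_dil[OF assms(1) assms(2)] by (intro fps_cong_sym[OF fps_isum_cong]) auto
  finally show "fps_cong K (fps_dil k (fps_isum f)) (fps_isum (\<lambda>j. fps_dil k (f j)))" .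
qed

lemma fps_dil_iprod:
  assumes "k > 0" "\<And>j. fps_cong (Suc j) (f j) 1"
  shows "fps_dil k (fps_iprod f) = fps_iprod (\<lambda>j. fps_dil k (f j))"
proof (rule fps_cong_eqI)
  fix K
  have "fps_cong K (fps_dil k (fps_iprod f)) (fps_dil k (\<Prod>j<K. f j))"
    using assms by (intro fps_cong_dil fps_iprod_cong) auto
  also have "fps_dil k (\<Prod>j<K. f j) = (\<Prod>j<K. fps_dil k (f j))"
    by (rule fps_dil_prod[OF assms(1)])
  also have "fps_cong K \<dots> (fps_iprod (\<lambda>j. fps_dil k (f j)))"
    using fps_cong_dil[OF assms(1) assms(2)] by (intro fps_cong_sym[OF fps_iprod_cong]) auto
  finally show "fps_cong K (fps_dil k (fps_iprod f)) (fps_iprod (\<lambda>j. fps_dil k (f j)))" .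
qed

lemma fps_isum_mult_left:
  assumes "\<And>j. fps_cong j (f j) 0"
  shows "c * fps_isum f = fps_isum (\<lambda>j. c * f j)"
proof (rule fps_cong_eqI)
  fix K
  have *: "fps_cong j (c * f j) 0" for j
    using fps_cong_mult[OF fps_cong_refl[of j c] assms[of j]] by simp
  have "fps_cong K (c * fps_isum f) (c * (\<Sum>j<K. f j))"
    using assms by (intro fps_cong_mult fps_isum_cong) auto
  also have "c * (\<Sum>j<K. f j) = (\<Sum>j<K. c * f j)"
    by (rule sum_distrib_left)
  also have "fps_cong K \<dots> (fps_isum (\<lambda>j. c * f j))"
    by (rule fps_cong_sym[OF fps_isum_cong]) (auto intro: *)
  finally show "fps_cong K (c * fps_isum f) (fps_isum (\<lambda>j. c * f j))" .
qed

section \<open>Partial fractions\<close>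

text \<open>Up to sign the sum is the divided difference of the constant 1 over at least two nodes;
  the divided-difference recursion \<open>step\<close> reduces it to fewer nodes, down to 1 -
  1.\<close>

lemma sum_inverse_prod_diff_eq_0:
  fixes B :: "'a::field set"
  assumes "finite B" "p \<noteq> q" "p \<notin> B" "q \<notin> B"
  shows "(\<Sum>a\<in>insert p (insert q B). 1 / (\<Prod>b\<in>insert p (insert q B) - {a}. b - a)) = 0"
proof -
  define Z where "Z = (\<lambda>A :: 'a set. \<Sum>a\<in>A. 1 / (\<Prod>b\<in>A - {a}. b - a))"
  \<comment> \<open>Term by term from (q-p)/((p-a)(q-a)) = 1/(p-a) - 1/(q-a); the nodes p and q
    themselves each feed only one of the two sums on the right.\<close>
  have step: "(q - p) * Z (insert p (insert q B)) = Z (insert p B) - Z (insert q B)"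
    if B: "finite B" and pq: "p \<noteq> q" "p \<notin> B" "q \<notin> B" for B p q
  proof -
    have sets: "insert p (insert q B) - {p} = insert q B" "insert p (insert q B) - {q} = insert p B"
      "insert p B - {p} = B" "insert q B - {q} = B"
      using pq by auto
    have sets': "insert p (insert q B) - {a} = insert p (insert q (B - {a}))"
      "insert p B - {a} = insert p (B - {a})" "insert q B - {a} = insert q (B - {a})" if "a \<in> B" for a
      using pq that by auto
    have tm: "(q - p) / ((p - a) * ((q - a) * P)) = 1 / ((p - a) * P) - 1 / ((q - a) * P)"
      if "a \<noteq> p" "a \<noteq> q" for a P :: 'a
    proof -
      have "(v - u) / (u * (v * P)) = 1 / (u * P) - 1 / (v * P)" if "u \<noteq> 0" "v \<noteq> 0" for u v
        using that by (cases "P = 0") (simp_all add: field_simps)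
      from this[of "p - a" "q - a"] show ?thesis using that by simp
    qed
    have "Z (insert p (insert q B)) = 1 / ((q - p) * (\<Prod>b\<in>B. b - p)) + (1 / ((p - q) * (\<Prod>b\<in>B. b - q)) +
        (\<Sum>a\<in>B. 1 / ((p - a) * ((q - a) * (\<Prod>b\<in>B - {a}. b - a)))))"
      using B pq by (simp add: Z_def sets sets' cong: sum.cong_simp)
    then have "(q - p) * Z (insert p (insert q B)) =
        (q - p) * (1 / ((q - p) * (\<Prod>b\<in>B. b - p))) + ((q - p) * (1 / ((p - q) * (\<Prod>b\<in>B. b - q))) +
        (q - p) * (\<Sum>a\<in>B. 1 / ((p - a) * ((q - a) * (\<Prod>b\<in>B - {a}. b - a)))))"
      by (simp only: distrib_left)
    also have "(q - p) * (1 / ((q - p) * (\<Prod>b\<in>B. b - p))) = 1 / (\<Prod>b\<in>B. b - p)"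
      using pq by simp
    also have "(q - p) * (1 / ((p - q) * (\<Prod>b\<in>B. b - q))) = - (1 / (\<Prod>b\<in>B. b - q))"
    proof -
      have "(q - p) * (1 / ((p - q) * (\<Prod>b\<in>B. b - q))) = - ((p - q) * (1 / ((p - q) * (\<Prod>b\<in>B. b - q))))"
        by (simp only: minus_diff_eq flip: mult_minus_left)
      then show ?thesis using pq by simp
    qed
    also have "(q - p) * (\<Sum>a\<in>B. 1 / ((p - a) * ((q - a) * (\<Prod>b\<in>B - {a}. b - a)))) =
        (\<Sum>a\<in>B. (q - p) / ((p - a) * ((q - a) * (\<Prod>b\<in>B - {a}. b - a))))"
      by (simp add: sum_distrib_left)
    also have "(\<Sum>a\<in>B. (q - p) / ((p - a) * ((q - a) * (\<Prod>b\<in>B - {a}. b - a)))) =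
        (\<Sum>a\<in>B. 1 / ((p - a) * (\<Prod>b\<in>B - {a}. b - a)) - 1 / ((q - a) * (\<Prod>b\<in>B - {a}. b - a)))"
      using pq by (intro sum.cong refl tm) auto
    also have "1 / (\<Prod>b\<in>B. b - p) + (- (1 / (\<Prod>b\<in>B. b - q)) + \<dots>) = Z (insert p B) - Z (insert q B)"
      using B pq by (simp add: Z_def sets sets' sum_subtractf cong: sum.cong_simp)
    finally show ?thesis .
  qed
  have "Z (insert p (insert q B)) = 0"
    using assms
  proof (induction B arbitrary: p q rule: finite_induct)
    case empty
    then show ?case using step[of "{}" p q] by (simp add: Z_def)
  next
    case (insert r B)
    have "Z (insert p (insert r B)) = 0" "Z (insert q (insert r B)) = 0"
      using insert by auto
    then show ?case using step[of "insert r B" p q] insert by simp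
  qed
  then show ?thesis by (simp add: Z_def)
qed

text \<open>With \<open>t\<close> as an additional node in the preceding identity, its own term is
  the left-hand side and the other terms are the negatives of those on the right.\<close>

lemma partial_fractions_field:
  fixes x :: "'i \<Rightarrow> 'a::field"
  assumes "finite I" "I \<noteq> {}" "inj_on x I" "\<And>i. i \<in> I \<Longrightarrow> x i \<noteq> t"
  shows "1 / (\<Prod>i\<in>I. x i - t) = (\<Sum>j\<in>I. 1 / ((x j - t) * (\<Prod>i\<in>I - {j}. x i - x j)))"
proof -
  obtain k where k: "k \<in> I" using assms by blast
  define B where "B = x ` I - {x k}"
  have xI: "insert (x k) B = x ` I" using k by (auto simp: B_def)
  have t: "t \<notin> x ` I" using assms by auto
  have "(\<Sum>a\<in>insert t (insert (x k) B). 1 / (\<Prod>b\<in>insert t (insert (x k) B) - {a}. b - a)) = 0"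
    using assms k t by (intro sum_inverse_prod_diff_eq_0) (auto simp: B_def)
  then have "0 = (\<Sum>a\<in>insert t (x ` I). 1 / (\<Prod>b\<in>insert t (x ` I) - {a}. b - a))"
    by (simp only: xI)
  also have "\<dots> = 1 / (\<Prod>b\<in>x ` I. b - t) + (\<Sum>a\<in>x ` I. 1 / (\<Prod>b\<in>insert t (x ` I) - {a}. b - a))"
    using t assms by (subst sum.insert) auto
  also have "(\<Sum>a\<in>x ` I. 1 / (\<Prod>b\<in>insert t (x ` I) - {a}. b - a)) =
      (\<Sum>j\<in>I. 1 / (\<Prod>b\<in>insert t (x ` I) - {x j}. b - x j))"
    using assms by (subst sum.reindex) auto
  also have "\<dots> = (\<Sum>j\<in>I. - (1 / ((x j - t) * (\<Prod>i\<in>I - {j}. x i - x j))))"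
  proof (intro sum.cong refl)
    fix j assume j: "j \<in> I"
    have "insert t (x ` I) - {x j} = insert t (x ` (I - {j}))"
      using j assms by (auto simp: inj_on_def)
    moreover have "(\<Prod>b\<in>insert t (x ` (I - {j})). b - x j) = (t - x j) * (\<Prod>i\<in>I - {j}. x i - x j)"
      using t assms by (subst prod.insert) (auto simp: prod.reindex inj_on_diff)
    ultimately have "1 / (\<Prod>b\<in>insert t (x ` I) - {x j}. b - x j)
        = 1 / ((- (x j - t)) * (\<Prod>i\<in>I - {j}. x i - x j))"
      by simp
    also have "\<dots> = - (1 / ((x j - t) * (\<Prod>i\<in>I - {j}. x i - x j)))"
      by (simp only: mult_minus_left divide_minus_right)
    finally show "1 / (\<Prod>b\<in>insert t (x ` I) - {x j}. b - x j)
        = - (1 / ((x j - t) * (\<Prod>i\<in>I - {j}. x i - x j)))" .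
  qed
  also have "(\<Prod>b\<in>x ` I. b - t) = (\<Prod>i\<in>I. x i - t)"
    using assms by (subst prod.reindex) auto
  finally show ?thesis by (simp add: sum_negf)
qed
lemma fps_prod_nth_0: "prod f A $ 0 = (\<Prod>i\<in>A. (f i :: 'a::comm_ring_1 fps) $ 0)"
  by (induction A rule: infinite_finite_induct) simp_all

lemma fps_to_fls_prod: "fps_to_fls (prod f A) = (\<Prod>i\<in>A. fps_to_fls (f i :: 'a::comm_ring_1 fps))"
  by (induction A rule: infinite_finite_induct) (simp_all add: fls_times_fps_to_fls)

lemma fps_to_fls_sum: "fps_to_fls (sum f A) = (\<Sum>i\<in>A. fps_to_fls (f i :: 'a::comm_ring_1 fps))"
  by (induction A rule: infinite_finite_induct) simp_all

lemma fps_to_fls_inverse: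
  "(f :: 'a::field fps) $ 0 \<noteq> 0 \<Longrightarrow> fps_to_fls (inverse f) = inverse (fps_to_fls f)"
  by (subst fls_inverse_fps_to_fls) (auto simp: subdegree_eq_0_iff)

definition pf_den :: "'a::field_char_0 \<Rightarrow> 'a \<times> nat \<Rightarrow> 'a fps" where
  "pf_den t p = 1 - fps_const (fst p * t) * fps_X ^ snd p + fps_X ^ (2 * snd p)"

definition pf_num :: "'a::field_char_0 \<times> nat \<Rightarrow> 'a \<times> nat \<Rightarrow> 'a fps" where
  "pf_num p r = (if snd p < snd r then - fps_const (fst p * fst r) * fps_X ^ (snd r - snd p) else 1)"

definition pf_gap :: "'a::field_char_0 \<times> nat \<Rightarrow> 'a \<times> nat \<Rightarrow> 'a fps" where
  "pf_gap p r = (1 - fps_const (fst p * fst r) * fps_X ^ (if snd p < snd r then snd r - snd p else snd p - snd r))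
     * (1 - fps_const (fst p * fst r) * fps_X ^ (snd p + snd r))"

text \<open>As a function of \<open>t\<close>, every \<^const>\<open>pf_den\<close> is linear with root
  $\varepsilon (q^e + q^{-e})$, so this is a Lagrange expansion; \<^const>\<open>pf_num\<close> and \<^const>\<open>pf_gap\<close>
  evaluate one denominator at the root of another without negative powers of $q$.\<close>

lemma partial_fractions_fps:
  fixes I :: "('a::field_char_0 \<times> nat) set"
  assumes fin: "finite I" and ne: "I \<noteq> {}" and sgn: "\<And>p. p \<in> I \<Longrightarrow> fst p = 1 \<or> fst p = -1"
    and unit: "\<And>p. p \<in> I \<Longrightarrow> pf_den t p $ 0 \<noteq> 0"
  shows "inverse (\<Prod>p\<in>I. pf_den t p) =
    (\<Sum>r\<in>I. (\<Prod>p\<in>I - {r}. pf_num p r * inverse (pf_gap p r)) * inverse (pf_den t r))"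
proof -
  \<comment> \<open>In t, \<open>pf_den\<close> is m p times (x p - t). The root contains q^(-e),
    hence the passage to Laurent series.\<close>
  define x where "x = (\<lambda>p :: 'a \<times> nat. fls_const (fst p) * (fls_X ^ snd p + inverse (fls_X ^ snd p)))"
  define m where "m = (\<lambda>p :: 'a \<times> nat. fls_const (fst p) * fls_X ^ snd p :: 'a fls)"
  have sgn': "fls_const (fst p) * fls_const (fst p) = 1" if "p \<in> I" for p
    using sgn[OF that] by auto
  have den: "fps_to_fls (pf_den t p) = m p * (x p - fls_const t)" if "p \<in> I" for p
  proof -
    have "1 - c * T * A + A * A = c * A * (c * (A + inverse A) - T)"
      if "c * c = 1" "A \<noteq> 0" for c A T :: "'a fls"
    proof -
      have "c * A * (c * (A + inverse A) - T) = (c * c) * (A * A + A * inverse A) - c * T * A"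
        by (simp only: algebra_simps)
      then show ?thesis using that by simp
    qed
    from this[of "fls_const (fst p)" "fls_X ^ snd p" "fls_const t", OF sgn'[OF that]] show ?thesis
      by (simp add: pf_den_def m_def x_def fls_times_fps_to_fls fps_to_fls_power power_add mult_2)
  qed
  have m0: "m p \<noteq> 0" if "p \<in> I" for p
    using sgn[OF that] by (auto simp: m_def)
  \<comment> \<open>With a = snd p, b = snd r and signs c, d, the value at the root is (1 - cd
    q^(a-b)) (1 - cd q^(a+b)). For a < b one pulls -cd q^(a-b) out of the first factor; the
    reciprocal of what is pulled out is \<open>pf_num\<close>.\<close>
  have gap: "fps_to_fls (pf_num p r) * (m p * (x p - x r)) = fps_to_fls (pf_gap p r)"
    if pr: "p \<in> I" "r \<in> I" for p r
  proof -
    define c where "c = fls_const (fst p)"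
    define d where "d = fls_const (fst r)"
    have c2: "c * c = 1" "d * d = 1"
      using sgn' pr by (simp_all add: c_def d_def)
    define Y where "Y = (fls_X :: 'a fls)"
    have Y0: "Y \<noteq> 0" by (simp add: Y_def)
    have fc: "fls_const (fst p * fst r) = c * d" by (simp add: c_def d_def)
    note defs = pf_num_def pf_gap_def m_def x_def
    show ?thesis
    proof (cases "snd p < snd r")
      case True
      then obtain k where k: "snd r = snd p + k" "k > 0" using less_imp_add_positive by metis
      define A where "A = Y ^ snd p"
      define B where "B = Y ^ k"
      have AB: "A \<noteq> 0" "B \<noteq> 0" by (simp_all add: A_def B_def Y0)
      have "fps_to_fls (pf_num p r) * (m p * (x p - x r))
         = - (c * d) * B * (c * A * (c * (A + inverse A) - d * (A * B + inverse (A * B))))"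
        using k by (simp add: defs fls_times_fps_to_fls fps_to_fls_power power_add fc
            flip: c_def d_def Y_def A_def B_def)
      also have "\<dots> = - (c * d) * (c * c) * (A * A * B + B * (A * inverse A))
          + (c * c) * (d * d) * (A * A * B * B + (A * B) * inverse (A * B))"
        by (simp add: algebra_simps del: inverse_mult_distrib)
      also have "\<dots> = - (c * d) * (c * c) * (A * A * B + B) + (c * c) * (d * d) * (A * A * B * B + 1)"
        using AB by (simp del: inverse_mult_distrib)
      also have "\<dots> = (1 - c * d * B) * (1 - c * d * (A * (A * B)))"
      proof -
        have "(1 - c * d * B) * (1 - c * d * (A * (A * B)))
           = 1 - c * d * (A * A * B + B) + (c * c) * (d * d) * (A * A * B * B)"
          by (simp add: algebra_simps)
        then show ?thesis using c2 by (simp add: algebra_simps)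
      qed
      also have "\<dots> = fps_to_fls (pf_gap p r)"
        using k by (simp add: defs fls_times_fps_to_fls fps_to_fls_power power_add fc
            flip: c_def d_def Y_def A_def B_def)
      finally show ?thesis .
    next
      case False
      then obtain k where k: "snd p = snd r + k" by (auto simp: not_less le_iff_add)
      define A where "A = Y ^ snd r"
      define B where "B = Y ^ k"
      have AB: "A \<noteq> 0" "B \<noteq> 0" by (simp_all add: A_def B_def Y0)
      have "fps_to_fls (pf_num p r) * (m p * (x p - x r))
         = c * (A * B) * (c * (A * B + inverse (A * B)) - d * (A + inverse A))"
        using k by (simp add: defs fls_times_fps_to_fls fps_to_fls_power power_add fc
            flip: c_def d_def Y_def A_def B_def)
      also have "\<dots> = (c * c) * (A * A * B * B + (A * B) * inverse (A * B)) - c * d * (A * A * B + B * (A * inverse A))"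
        by (simp add: algebra_simps del: inverse_mult_distrib)
      also have "\<dots> = (c * c) * (A * A * B * B + 1) - c * d * (A * A * B + B)"
        using AB by (simp del: inverse_mult_distrib)
      also have "\<dots> = (1 - c * d * B) * (1 - c * d * (A * B * A))"
      proof -
        have "(1 - c * d * B) * (1 - c * d * (A * B * A))
           = 1 - c * d * (A * A * B + B) + (c * c) * (d * d) * (A * A * B * B)"
          by (simp add: algebra_simps)
        then show ?thesis using c2 by (simp add: algebra_simps)
      qed
      also have "\<dots> = fps_to_fls (pf_gap p r)"
        using k by (simp add: defs fls_times_fps_to_fls fps_to_fls_power power_add fc
            flip: c_def d_def Y_def A_def B_def)
      finally show ?thesis .
    qed
  qed
  \<comment> \<open>Distinct nodes with equal exponents have opposite signs, so the first factor is
    then 2 and not 0.\<close>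
  have gap0: "pf_gap p r $ 0 \<noteq> 0" if pr: "p \<in> I" "r \<in> I" "p \<noteq> r" for p r
  proof -
    have "fst p * fst r = -1" if "snd p = snd r"
      using sgn[OF pr(1)] sgn[OF pr(2)] pr(3) that by (auto simp: prod_eq_iff)
    then show ?thesis
      by (auto simp: pf_gap_def)
  qed
  have coeff: "fps_to_fls (pf_num p r * inverse (pf_gap p r)) = 1 / (m p * (x p - x r))"
    and xne: "x p \<noteq> x r"
    if pr: "p \<in> I" "r \<in> I" "p \<noteq> r" for p r
  proof -
    have "fps_to_fls (pf_gap p r) \<noteq> 0" using gap0[OF pr] by auto
    moreover have eq: "fps_to_fls (pf_num p r) * (m p * (x p - x r)) = fps_to_fls (pf_gap p r)"
      using gap pr by blast
    ultimately have nz: "m p * (x p - x r) \<noteq> 0" by auto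
    then show "x p \<noteq> x r" by auto
    have "fps_to_fls (pf_num p r) \<noteq> 0"
      using eq gap0[OF pr] by auto
    then show "fps_to_fls (pf_num p r * inverse (pf_gap p r)) = 1 / (m p * (x p - x r))"
      using nz unfolding fls_times_fps_to_fls fps_to_fls_inverse[OF gap0[OF pr]] eq[symmetric]
      by (simp add: fls_times_fps_to_fls fps_to_fls_inverse[OF gap0[OF pr]] divide_inverse)
  qed
  have den0: "fps_to_fls (pf_den t p) \<noteq> 0" if "p \<in> I" for p
    using unit[OF that] by auto
  have unitP: "(\<Prod>p\<in>I. pf_den t p) $ 0 \<noteq> 0"
    using unit fin by (simp add: fps_prod_nth_0)
  have M0: "(\<Prod>p\<in>I. m p) \<noteq> 0" using m0 fin by simp
  have "fps_to_fls (inverse (\<Prod>p\<in>I. pf_den t p)) = inverse (\<Prod>p\<in>I. m p * (x p - fls_const t))"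
    using unitP by (simp add: fps_to_fls_inverse fps_to_fls_prod den)
  also have "\<dots> = inverse (\<Prod>p\<in>I. m p) * (1 / (\<Prod>p\<in>I. x p - fls_const t))"
    by (simp add: prod.distrib divide_inverse)
  also have "1 / (\<Prod>p\<in>I. x p - fls_const t) =
      (\<Sum>r\<in>I. 1 / ((x r - fls_const t) * (\<Prod>p\<in>I - {r}. x p - x r)))"
  proof (rule partial_fractions_field[OF fin ne])
    show "inj_on x I" using xne unfolding inj_on_def by blast
    show "x p \<noteq> fls_const t" if "p \<in> I" for p using den[OF that] den0[OF that] by auto
  qed
  also have "inverse (\<Prod>p\<in>I. m p) * \<dots> =
      (\<Sum>r\<in>I. (\<Prod>p\<in>I - {r}. 1 / (m p * (x p - x r))) * (1 / (m r * (x r - fls_const t))))"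
    unfolding sum_distrib_left
  proof (intro sum.cong refl)
    fix r assume r: "r \<in> I"
    have "(\<Prod>p\<in>I. m p) = m r * (\<Prod>p\<in>I - {r}. m p)"
      using fin r by (simp add: prod.remove)
    moreover have "(\<Prod>p\<in>I - {r}. 1 / (m p * (x p - x r))) = 1 / ((\<Prod>p\<in>I - {r}. m p) * (\<Prod>p\<in>I - {r}. x p - x r))"
      by (simp only: prod_dividef prod.distrib prod.neutral_const)
    ultimately show "inverse (\<Prod>p\<in>I. m p) * (1 / ((x r - fls_const t) * (\<Prod>p\<in>I - {r}. x p - x r))) =
        (\<Prod>p\<in>I - {r}. 1 / (m p * (x p - x r))) * (1 / (m r * (x r - fls_const t)))"
      by (simp add: divide_inverse mult_ac)
  qed
  also have "\<dots> = (\<Sum>r\<in>I. (\<Prod>p\<in>I - {r}. fps_to_fls (pf_num p r * inverse (pf_gap p r)))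
      * inverse (fps_to_fls (pf_den t r)))"
    by (intro sum.cong refl arg_cong2[of _ _ _ _ "(*)"] prod.cong) (auto simp: coeff den divide_inverse)
  also have "\<dots> = fps_to_fls (\<Sum>r\<in>I. (\<Prod>p\<in>I - {r}. pf_num p r * inverse (pf_gap p r))
      * inverse (pf_den t r))"
    unfolding fps_to_fls_sum
    by (intro sum.cong refl) (simp add: fls_times_fps_to_fls fps_to_fls_prod fps_to_fls_inverse[OF unit])
  finally show ?thesis by (simp only: fps_to_fls_eq_iff)
qed

section \<open>Durfee rectangles and Jacobi's triple product\<close>

abbreviation fps_summable :: "(nat \<Rightarrow> 'a::comm_ring_1 fps) \<Rightarrow> bool" where
  "fps_summable f \<equiv> \<forall>j. fps_cong j (f j) 0"

lemma fps_cong_power_mult_0: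
  fixes p :: "'a::comm_ring_1 fps"
  assumes "p $ 0 = 0" "K \<le> e"
  shows "fps_cong K (p ^ e * f) 0"
proof -
  have "p = fps_X * fps_shift 1 p"
    using assms(1) by (auto simp: fps_eq_iff fps_X_mult_nth)
  then have "p ^ e = fps_X ^ e * fps_shift 1 p ^ e"
    by (metis power_mult_distrib)
  then show ?thesis
    using fps_cong_X_power_0[OF assms(2)] by (simp add: mult.assoc)
qed

text \<open>Gains one order per multiplication; iterated, it kills a series that reproduces itself
  with a factor vanishing at q = 0.\<close>

lemma fps_cong_Suc_mult_0:
  fixes p :: "'a::comm_ring_1 fps"
  assumes "p $ 0 = 0" "fps_cong K f 0"
  shows "fps_cong (Suc K) (p * f) 0"
  unfolding fps_cong_def
proof (intro allI impI)
  fix n assume n: "n < Suc K"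
  have "p $ i * f $ (n - i) = 0" if "i \<le> n" for i
    using assms n that by (cases i) (auto simp: fps_cong_def)
  then show "(p * f) $ n = 0 $ n" by (simp add: fps_mult_nth)
qed

lemma fps_isum_diff: "fps_isum f - fps_isum g = fps_isum (\<lambda>i. f i - g i)"
  by (simp add: fps_isum_def fps_eq_iff fps_sum_nth sum_subtractf)

lemma fps_isum_Suc:
  assumes "fps_summable f"
  shows "fps_isum f = f 0 + fps_isum (\<lambda>i. f (Suc i))"
proof (rule fps_cong_eqI)
  fix K
  have "fps_cong K (fps_isum f) (\<Sum>j<Suc K. f j)"
    using assms by (intro fps_isum_cong) auto
  also have "\<dots> = f 0 + (\<Sum>j<K. f (Suc j))"
    by (rule sum.lessThan_Suc_shift)
  also have "fps_cong K \<dots> (f 0 + fps_isum (\<lambda>i. f (Suc i)))"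
    using assms
    by (intro fps_cong_add fps_cong_refl fps_cong_sym[OF fps_isum_cong]) (auto intro: fps_cong_mono)
  finally show "fps_cong K (fps_isum f) (f 0 + fps_isum (\<lambda>i. f (Suc i)))" .
qed

lemma fps_summable_Suc:
  assumes "fps_summable f"
  shows "fps_summable (\<lambda>i. f (Suc i))"
proof
  fix j
  show "fps_cong j (f (Suc j)) 0"
    by (rule fps_cong_mono[OF assms[rule_format, of "Suc j"]]) simp
qed

lemma fps_isum_cong_fun: "(\<And>i. f i = g i) \<Longrightarrow> fps_isum f = fps_isum g"
  by presburger

section \<open>q-Pochhammer symbols and sums over Durfee rectangles\<close>

definition qpoch :: "'a::comm_ring_1 fps \<Rightarrow> nat \<Rightarrow> 'a fps" where
  "qpoch p n = (\<Prod>i<n. 1 - p ^ Suc i)"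

definition qpoch_inf :: "'a::comm_ring_1 fps \<Rightarrow> 'a fps" where
  "qpoch_inf p = fps_iprod (\<lambda>i. 1 - p ^ Suc i)"

lemma qpoch_0 [simp]: "qpoch p 0 = 1"
  by (simp add: qpoch_def)

lemma qpoch_Suc: "qpoch p (Suc n) = qpoch p n * (1 - p ^ Suc n)"
  by (simp add: qpoch_def)

lemma qpoch_nth_0: "p $ 0 = 0 \<Longrightarrow> qpoch p n $ 0 = 1"
  by (induction n) (simp_all add: qpoch_Suc)

lemma one_minus_power_cong: "p $ 0 = 0 \<Longrightarrow> K \<le> e \<Longrightarrow> fps_cong K (1 - p ^ e) 1"
  using fps_cong_diff[OF fps_cong_refl[of K 1] fps_cong_power_mult_0[of p K e 1]] by simp

lemma one_plus_mult_power_cong: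
  assumes "p $ 0 = 0" "x $ 0 = 0" "K \<le> Suc e"
  shows "fps_cong K (1 + x * p ^ e) 1"
proof -
  have "fps_cong K (x * (p ^ e * 1)) 0"
    by (rule fps_cong_mono[OF fps_cong_Suc_mult_0[OF assms(2)  fps_cong_power_mult_0[OF assms(1)]]])
      (use assms in auto)
  from fps_cong_add[OF fps_cong_refl[of K 1] this] show ?thesis by simp
qed

lemma qpoch_cong:
  assumes "p $ 0 = 0" "K \<le> N"
  shows "fps_cong K (qpoch p N) (qpoch_inf p)"
  unfolding qpoch_def qpoch_inf_def
  using assms by (intro fps_cong_sym[OF fps_iprod_cong] one_minus_power_cong) auto

lemma qpoch_inf_nth_0: "p $ 0 = 0 \<Longrightarrow> qpoch_inf p $ 0 = 1"
  using qpoch_cong[of p 1 1] qpoch_nth_0[of p 1] by (simp add: fps_cong_def)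

lemma inverse_qpoch_eq:
  fixes p :: "'a::field fps"
  assumes "p $ 0 = 0"
  shows "inverse (qpoch p n) = (1 - p ^ Suc n) * inverse (qpoch p (Suc n))"
proof -
  have "(1 - p ^ Suc n) $ 0 \<noteq> 0" using assms by simp
  from inverse_mult_eq_1[OF this] show ?thesis
    by (simp add: qpoch_Suc fps_inverse_mult mult_ac)
qed

text \<open>The sum over Durfee rectangles. Writing $F_a$ for it, the differences satisfy
  $F_a - F_{a+1} = -p^{a+1} (F_{a+1} - F_{a+2})$ and hence vanish.\<close>

lemma durfee_rectangle_sum:
  fixes p :: "'a::field fps"
  assumes p: "p $ 0 = 0"
  shows "fps_isum (\<lambda>i. p ^ (i * (i + a)) * inverse (qpoch p i * qpoch p (i + a))) = inverse (qpoch_inf p)"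
proof -
  define f where "f = (\<lambda>a i. p ^ (i * (i + a)) * inverse (qpoch p i * qpoch p (i + a)))"
  define g where "g = (\<lambda>a i. p ^ (i * (i + a)) * (1 - p ^ i - p ^ Suc (i + a))
      * inverse (qpoch p i * qpoch p (Suc (i + a))))"
  \<comment> \<open>The factor 1 - p^i - p^(i+a+1) of \<open>g\<close> is split so that
    \<open>u\<close> vanishes at i = 0 and can be shifted by one; the shifted \<open>u\<close> and
    \<open>v\<close> recombine to \<open>g\<close> at a + 1.\<close>
  define u where "u = (\<lambda>a i. p ^ (i * (i + a)) * ((1 - p ^ i) * inverse (qpoch p i * qpoch p (Suc (i + a)))))"
  define v where "v = (\<lambda>a i. p ^ (i * (i + a)) * (p ^ Suc (i + a) * inverse (qpoch p i * qpoch p (Suc (i + a)))))"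
  have le: "i \<le> i * (i + a)" for i a :: nat by (cases i) auto
  have sf: "fps_summable (f a)" and sg: "fps_summable (g a)" and su: "fps_summable (u a)"
    and sv: "fps_summable (v a)" for a
    unfolding f_def g_def u_def v_def mult.assoc by (intro allI fps_cong_power_mult_0 p le)+
  have F_diff: "fps_isum (f a) - fps_isum (f (Suc a)) = fps_isum (g a)" for a
    unfolding fps_isum_diff
  proof (rule fps_isum_cong_fun)
    fix i
    have "inverse (qpoch p (i + a)) = (1 - p ^ Suc (i + a)) * inverse (qpoch p (Suc (i + a)))"
      by (rule inverse_qpoch_eq[OF p])
    then have "f a i = p ^ (i * (i + a)) * (1 - p ^ Suc (i + a)) * inverse (qpoch p i * qpoch p (Suc (i + a)))"
      by (simp add: f_def fps_inverse_mult mult_ac)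
    moreover have "i * (i + Suc a) = i * (i + a) + i" by simp
    then have "f (Suc a) i = p ^ (i * (i + a)) * p ^ i * inverse (qpoch p i * qpoch p (Suc (i + a)))"
      unfolding f_def by (simp only: power_add add_Suc_right)
    moreover have "Z * (1 - V) * W - Z * Y * W = Z * (1 - Y - V) * W" for Z V W Y :: "'a fps"
      by (simp add: algebra_simps)
    ultimately show "f a i - f (Suc a) i = g a i"
      by (simp only: g_def)
  qed
  have G: "fps_isum (g a) = - (p ^ Suc a) * fps_isum (g (Suc a))" for a
  proof -
    have "fps_isum (g a) = fps_isum (u a) - fps_isum (v a)"
      unfolding fps_isum_diff
    proof (rule fps_isum_cong_fun)
      have "Z * (1 - Y - V) * W = Z * ((1 - Y) * W) - Z * (V * W)" for Z V W Y :: "'a fps"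
        by (simp add: algebra_simps)
      then show "g a i = u a i - v a i" for i by (simp only: g_def u_def v_def)
    qed
    also have "fps_isum (u a) = fps_isum (\<lambda>i. u a (Suc i))"
      by (subst fps_isum_Suc[OF su]) (simp add: u_def)
    also have "fps_isum (\<lambda>i. u a (Suc i)) - fps_isum (v a) = fps_isum (\<lambda>i. u a (Suc i) - v a i)"
      by (rule fps_isum_diff)
    also have "\<dots> = fps_isum (\<lambda>i. - (p ^ Suc a) * g (Suc a) i)"
    proof (rule fps_isum_cong_fun)
      fix i
      define W where "W = inverse (qpoch p i * qpoch p (Suc (Suc (i + a))))"
      have 1: "u a (Suc i) = p ^ (Suc i * (Suc i + a)) * W"
        unfolding u_def W_def fps_inverse_mult inverse_qpoch_eq[OF p, of i] add_Suc by (simp only: mult_ac)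
      have "inverse (qpoch p (Suc (i + a))) = (1 - p ^ Suc (Suc (i + a))) * inverse (qpoch p (Suc (Suc (i + a))))"
        by (rule inverse_qpoch_eq[OF p])
      then have 2: "v a i = p ^ (i * (i + a)) * p ^ Suc (i + a) * (1 - p ^ Suc (Suc (i + a))) * W"
        unfolding v_def W_def fps_inverse_mult by (simp only: mult_ac)
      have 3: "g (Suc a) i = p ^ (i * (i + a)) * p ^ i * (1 - p ^ i - p ^ Suc (Suc (i + a))) * W"
      proof -
        have "i * (i + Suc a) = i * (i + a) + i" by simp
        then show ?thesis unfolding g_def W_def by (simp only: power_add add_Suc_right)
      qed
      have 4: "p ^ (Suc i * (Suc i + a)) = p ^ (i * (i + a)) * p ^ i * p ^ i * p ^ Suc a"
      proof -
        have "Suc i * (Suc i + a) = i * (i + a) + i + i + Suc a" by simp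
        then show ?thesis by (simp only: power_add)
      qed
      have 5: "p ^ Suc (i + a) = p ^ i * p ^ Suc a"
        by (simp add: power_add)
      have "Z * Y * Y * A * W - Z * (Y * A) * (1 - V) * W = - A * (Z * Y * (1 - Y - V) * W)"
        for Z Y A V :: "'a fps" by (simp add: algebra_simps)
      from this[of "p ^ (i * (i + a))" "p ^ i" "p ^ Suc a" "p ^ Suc (Suc (i + a))"]
      show "u a (Suc i) - v a i = - (p ^ Suc a) * g (Suc a) i"
        by (simp only: 1 2 3 4 5)
    qed
    also have "\<dots> = - (p ^ Suc a) * fps_isum (g (Suc a))"
      using sg by (intro fps_isum_mult_left[symmetric]) auto
    finally show ?thesis .
  qed
  \<comment> \<open>Each use of \<open>G\<close> contributes a factor without constant term, so the
    sum vanishes to every order.\<close>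
  have "fps_cong K (fps_isum (g a)) 0" for K a
  proof (induction K arbitrary: a)
    case 0
    then show ?case by (simp add: fps_cong_def)
  next
    case (Suc K)
    have "fps_cong (Suc K) (- (p ^ Suc a) * fps_isum (g (Suc a))) 0"
      using p Suc by (intro fps_cong_Suc_mult_0) auto
    then show ?case by (subst G)
  qed
  then have "fps_isum (g a) = 0" for a by (rule fps_cong_eqI)
  then have step: "fps_isum (f a) = fps_isum (f (Suc a))" for a
    using F_diff[of a] by simp
  \<comment> \<open>The sum does not depend on a. At a + K only the term i = 0 survives below order
    K, and it is a complete product to that order.\<close>
  have const: "fps_isum (f a) = fps_isum (f (a + K))" for K
    by (induction K) (simp_all add: step[symmetric])
  have "fps_isum (f a) = inverse (qpoch_inf p)"
  proof (rule fps_cong_eqI)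
    fix K
    have "fps_cong K (fps_isum (f (a + K))) (\<Sum>i<Suc K. f (a + K) i)"
      using sf by (intro fps_isum_cong) auto
    also have "fps_cong K (\<Sum>i<Suc K. f (a + K) i) (\<Sum>i\<in>{0}. f (a + K) i)"
    proof (rule fps_cong_subset_sum)
      fix i assume "i \<in> {..<Suc K} - {0}"
      then have "K \<le> i * (i + (a + K))" by (cases i) auto
      then show "fps_cong K (f (a + K) i) 0"
        unfolding f_def by (intro fps_cong_power_mult_0 p)
    qed auto
    also have "(\<Sum>i\<in>{0}. f (a + K) i) = inverse (qpoch p (a + K))"
      by (simp add: f_def)
    also have "fps_cong K \<dots> (inverse (qpoch_inf p))"
      using p by (intro fps_cong_inverse qpoch_cong) (auto simp: qpoch_nth_0 qpoch_inf_nth_0)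
    finally show "fps_cong K (fps_isum (f a)) (inverse (qpoch_inf p))"
      using const[of K] by simp
  qed
  then show ?thesis by (simp add: f_def)
qed

text \<open>In F(x) - F(xp) the factor 1 - p^k shortens the Pochhammer symbol, whence F(x) = (1 + x)
  F(xp). Iteration builds the product while F(x p^N) tends to 1.\<close>

lemma euler_expansion:
  fixes p :: "'a::field fps"
  assumes p: "p $ 0 = 0" and x: "x $ 0 = 0"
  shows "fps_isum (\<lambda>k. x ^ k * (p ^ (k choose 2) * inverse (qpoch p k))) = fps_iprod (\<lambda>i. 1 + x * p ^ i)"
proof -
  define f where "f = (\<lambda>x k. x ^ k * (p ^ (k choose 2) * inverse (qpoch p k)))"
  have sf: "fps_summable (f x)" if "x $ 0 = 0" for x
    using that unfolding f_def by (intro allI fps_cong_power_mult_0) auto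
  have step: "fps_isum (f x) = (1 + x) * fps_isum (f (x * p))" if x: "x $ 0 = 0" for x
  proof -
    have xp: "(x * p) $ 0 = 0" using x by simp
    have "fps_isum (f x) - fps_isum (f (x * p)) = fps_isum (\<lambda>k. f x k - f (x * p) k)"
      by (rule fps_isum_diff)
    also have "\<dots> = (f x 0 - f (x * p) 0) + fps_isum (\<lambda>k. f x (Suc k) - f (x * p) (Suc k))"
    proof (rule fps_isum_Suc, intro allI)
      fix j show "fps_cong j (f x j - f (x * p) j) 0"
        using fps_cong_diff[OF sf[OF x, rule_format, of j] sf[OF xp, rule_format, of j]] by simp
    qed
    also have "\<dots> = fps_isum (\<lambda>k. x * f (x * p) k)"
    proof -
      have "f x (Suc k) - f (x * p) (Suc k) = x * f (x * p) k" for k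
      proof -
        define P where "P = p ^ (k choose 2) * p ^ k * x ^ k * x"
        have "f x (Suc k) = P * inverse (qpoch p (Suc k))"
          by (simp add: f_def P_def numeral_2_eq_2 power_add mult_ac)
        moreover have "f (x * p) (Suc k) = P * (p ^ Suc k * inverse (qpoch p (Suc k)))"
          by (simp add: f_def P_def numeral_2_eq_2 power_add power_mult_distrib mult_ac)
        moreover have "x * f (x * p) k = P * inverse (qpoch p k)"
          by (simp add: f_def P_def power_mult_distrib mult_ac)
        ultimately show ?thesis
          unfolding inverse_qpoch_eq[OF p, of k] by (simp only:) (simp add: algebra_simps)
      qed
      then show ?thesis by (simp add: f_def)
    qed
    also have "\<dots> = x * fps_isum (f (x * p))"
      using sf[OF xp] by (intro fps_isum_mult_left[symmetric]) auto
    finally show ?thesis by (simp add: algebra_simps)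
  qed
  have iter: "fps_isum (f x) = (\<Prod>i<N. 1 + x * p ^ i) * fps_isum (f (x * p ^ N))" for N
  proof (induction N)
    case (Suc N)
    have "fps_isum (f (x * p ^ N)) = (1 + x * p ^ N) * fps_isum (f (x * p ^ N * p))"
      using x by (intro step) simp
    then show ?case using Suc by (simp add: mult_ac)
  qed simp
  have "fps_isum (f x) = fps_iprod (\<lambda>i. 1 + x * p ^ i)"
  proof (rule fps_cong_eqI)
    fix K
    have "fps_cong K (fps_isum (f (x * p ^ K))) 1"
    proof -
      have "fps_cong K (fps_isum (f (x * p ^ K))) (\<Sum>i<Suc K. f (x * p ^ K) i)"
        by (rule fps_isum_cong) (use sf[of "x * p ^ K"] x in auto)
      also have "fps_cong K (\<Sum>i<Suc K. f (x * p ^ K) i) (\<Sum>i\<in>{0}. f (x * p ^ K) i)"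
      proof (rule fps_cong_subset_sum)
        fix i assume "i \<in> {..<Suc K} - {0}"
        then obtain i' where "i = Suc i'" by (cases i) auto
        then have "f (x * p ^ K) i = p ^ K * (x * ((x * p ^ K) ^ i' * (p ^ (i choose 2) * inverse (qpoch p i))))"
          by (simp add: f_def mult_ac)
        then show "fps_cong K (f (x * p ^ K) i) 0"
          by (simp only:) (intro fps_cong_power_mult_0 p order_refl)
      qed auto
      also have "(\<Sum>i\<in>{0}. f (x * p ^ K) i) = 1"
        by (simp add: f_def numeral_2_eq_2)
      finally show ?thesis .
    qed
    then have "fps_cong K ((\<Prod>i<K. 1 + x * p ^ i) * fps_isum (f (x * p ^ K))) ((\<Prod>i<K. 1 + x * p ^ i) * 1)"
      by (intro fps_cong_mult) auto
    then have "fps_cong K (fps_isum (f x)) (\<Prod>i<K. 1 + x * p ^ i)"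
      using iter[of K] by simp
    also have "fps_cong K \<dots> (fps_iprod (\<lambda>i. 1 + x * p ^ i))"
      by (intro fps_cong_sym[OF fps_iprod_cong] one_plus_mult_power_cong p x) auto
    finally show "fps_cong K (fps_isum (f x)) (fps_iprod (\<lambda>i. 1 + x * p ^ i))" .
  qed
  then show ?thesis by (simp add: f_def)
qed

text \<open>Groups a double sum by k - l, which becomes the index of the theta series.\<close>

lemma sum_square_by_difference:
  fixes f :: "nat \<Rightarrow> nat \<Rightarrow> 'a::comm_monoid_add"
  shows "(\<Sum>k<K. \<Sum>l<K. f k l) =
    (\<Sum>l<K. f l l) + (\<Sum>j=1..<K. (\<Sum>l<K-j. f (l + j) l) + (\<Sum>l<K-j. f l (l + j)))"
proof -
  have "(\<Sum>k<K. \<Sum>l<K. f k l) = (\<Sum>(k,l)\<in>{..<K}\<times>{..<K}. f k l)"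
    by (rule sum.cartesian_product)
  also have "{..<K}\<times>{..<K} = (\<lambda>l. (l,l)) ` {..<K} \<union>
     ((\<lambda>(j,l). (l+j,l)) ` (SIGMA j:{1..<K}. {..<K-j}) \<union> (\<lambda>(j,l). (l,l+j)) ` (SIGMA j:{1..<K}. {..<K-j}))"
    (is "_ = ?A \<union> (?B \<union> ?C)")
  proof (intro equalityI subsetI)
    fix x assume x: "x \<in> {..<K}\<times>{..<K}"
    obtain k l where [simp]: "x = (k,l)" by (cases x)
    consider "k = l" | "k > l" | "k < l" by linarith
    then show "x \<in> ?A \<union> (?B \<union> ?C)"
    proof cases
      case 1 then show ?thesis using x by auto
    next
      case 2 then have "x \<in> ?B" using x by (intro image_eqI[of _ _ "(k-l,l)"]) auto
      then show ?thesis by blast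
    next
      case 3 then have "x \<in> ?C" using x by (intro image_eqI[of _ _ "(l-k,k)"]) auto
      then show ?thesis by blast
    qed
  qed auto
  also have "(\<Sum>(k,l)\<in>?A \<union> (?B \<union> ?C). f k l) = (\<Sum>(k,l)\<in>?A. f k l) + ((\<Sum>(k,l)\<in>?B. f k l) + (\<Sum>(k,l)\<in>?C. f k l))"
    by (subst sum.union_disjoint, simp, simp, fastforce, subst sum.union_disjoint) (simp, simp, fastforce, simp)
  also have "(\<Sum>(k,l)\<in>?A. f k l) = (\<Sum>l<K. f l l)"
    by (subst sum.reindex) (auto simp: inj_on_def)
  also have "(\<Sum>(k,l)\<in>?B. f k l) = (\<Sum>j=1..<K. \<Sum>l<K-j. f (l + j) l)"
    by (subst sum.reindex, force simp: inj_on_def) (simp add: sum.Sigma case_prod_unfold)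
  also have "(\<Sum>(k,l)\<in>?C. f k l) = (\<Sum>j=1..<K. \<Sum>l<K-j. f l (l + j))"
    by (subst sum.reindex, force simp: inj_on_def) (simp add: sum.Sigma case_prod_unfold)
  finally show ?thesis by (simp add: sum.distrib)
qed

text \<open>The terms j and -j of the bilateral series of A^(j(j+1)/2) B^(j(j-1)/2) are merged, so
  that a sum over the natural numbers suffices.\<close>

definition theta_term :: "'a::comm_ring_1 fps \<Rightarrow> 'a fps \<Rightarrow> nat \<Rightarrow> 'a fps" where
  "theta_term A B j = (if j = 0 then 1 else
     A ^ (Suc j choose 2) * B ^ (j choose 2) + A ^ (j choose 2) * B ^ (Suc j choose 2))"

text \<open>Multiply two Euler expansions. The terms with index difference j contribute
  \<open>theta_term A B j\<close> times the Durfee rectangle sum with a = j, and that sum is the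
  same for every j.\<close>

lemma jacobi_triple_product:
  fixes A B :: "'a::field fps"
  assumes A: "A $ 0 = 0" and B: "B $ 0 = 0"
  shows "fps_iprod (\<lambda>i. 1 + A * (A * B) ^ i) * fps_iprod (\<lambda>i. 1 + B * (A * B) ^ i) * qpoch_inf (A * B)
     = fps_isum (theta_term A B)"
proof -
  define p where "p = A * B"
  have p: "p $ 0 = 0" by (simp add: p_def A)
  define a where "a = (\<lambda>k. A ^ k * (p ^ (k choose 2) * inverse (qpoch p k)))"
  define b where "b = (\<lambda>k. B ^ k * (p ^ (k choose 2) * inverse (qpoch p k)))"
  define d where "d = (\<lambda>j l. p ^ (l * (l + j)) * inverse (qpoch p l * qpoch p (l + j)))"
  \<comment> \<open>Collects the powers of p after writing A^(l+j) B^l as A^j p^l; the summand l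
    comes from this p^l.\<close>
  have ch: "((l + j) choose 2) + (l choose 2) + l = (j choose 2) + l * (l + j)" for l j :: nat
    by (induction l) (simp_all add: numeral_2_eq_2)
  have sa: "fps_cong K (a k) 0" and sb: "fps_cong K (b k) 0" if "K \<le> k" for K k
    unfolding a_def b_def using A B that by (intro fps_cong_power_mult_0; auto)+
  have ab: "a (l + j) * b l = A ^ (Suc j choose 2) * B ^ (j choose 2) * d j l"
    and ba: "a l * b (l + j) = A ^ (j choose 2) * B ^ (Suc j choose 2) * d j l" for j l
  proof -
    have "a (l + j) * b l = A ^ j * p ^ (((l + j) choose 2) + (l choose 2) + l) * inverse (qpoch p l * qpoch p (l + j))"
      by (simp add: a_def b_def p_def power_add power_mult_distrib fps_inverse_mult mult_ac)
    then show "a (l + j) * b l = A ^ (Suc j choose 2) * B ^ (j choose 2) * d j l"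
      unfolding ch by (simp add: d_def power_add numeral_2_eq_2 p_def power_mult_distrib mult_ac)
    have "a l * b (l + j) = B ^ j * p ^ (((l + j) choose 2) + (l choose 2) + l) * inverse (qpoch p l * qpoch p (l + j))"
      by (simp add: a_def b_def p_def power_add power_mult_distrib fps_inverse_mult mult_ac)
    then show "a l * b (l + j) = A ^ (j choose 2) * B ^ (Suc j choose 2) * d j l"
      unfolding ch by (simp add: d_def power_add numeral_2_eq_2 p_def power_mult_distrib mult_ac)
  qed
  have le: "l \<le> l * (l + j)" for l j :: nat by (cases l) auto
  have sd: "fps_summable (d j)" for j
    unfolding d_def by (intro allI fps_cong_power_mult_0 p le)
  have D: "fps_cong K (\<Sum>l<K. d j l) (inverse (qpoch_inf p))" for j K
    using fps_cong_sym[OF fps_isum_cong[of "d j" K K]] sd durfee_rectangle_sum[OF p, of j]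
    by (simp add: d_def)
  have st: "fps_summable (theta_term A B)"
  proof
    fix j
    have "j \<le> Suc j choose 2" by (simp add: numeral_2_eq_2)
    then have "fps_cong j (A ^ (Suc j choose 2) * B ^ (j choose 2)) 0"
      "fps_cong j (B ^ (Suc j choose 2) * A ^ (j choose 2)) 0"
      using A B by (auto intro!: fps_cong_power_mult_0)
    from fps_cong_add[OF this] show "fps_cong j (theta_term A B j) 0"
      by (cases "j = 0") (auto simp: theta_term_def mult_ac fps_cong_def)
  qed
  have main: "fps_isum a * fps_isum b = fps_isum (theta_term A B) * inverse (qpoch_inf p)"
  proof (rule fps_cong_eqI)
    fix K
    have "fps_cong K (fps_isum a * fps_isum b) ((\<Sum>k<K. a k) * (\<Sum>l<K. b l))"
      by (intro fps_cong_mult fps_isum_cong sa sb) auto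
    also have "(\<Sum>k<K. a k) * (\<Sum>l<K. b l) = (\<Sum>k<K. \<Sum>l<K. a k * b l)"
      by (rule sum_product)
    also have "\<dots> = (\<Sum>l<K. a l * b l) + (\<Sum>j=1..<K. (\<Sum>l<K-j. a (l + j) * b l) + (\<Sum>l<K-j. a l * b (l + j)))"
      by (rule sum_square_by_difference)
    \<comment> \<open>The terms added by extending the inner ranges have l + j >= K, so they are of
      order at least K.\<close>
    also have "fps_cong K \<dots> ((\<Sum>l<K. a l * b l) + (\<Sum>j=1..<K. (\<Sum>l<K. a (l + j) * b l) + (\<Sum>l<K. a l * b (l + j))))"
    proof (intro fps_cong_add fps_cong_refl fps_cong_sum)
      fix j assume "j \<in> {1..<K}"
      show "fps_cong K (\<Sum>l<K-j. a (l + j) * b l) (\<Sum>l<K. a (l + j) * b l)"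
      proof (rule fps_cong_sym[OF fps_cong_subset_sum])
        fix i assume "i \<in> {..<K} - {..<K-j}"
        then have "fps_cong K (a (i + j)) 0" by (intro sa) auto
        from fps_cong_mult[OF this fps_cong_refl[of K "b i"]] show "fps_cong K (a (i + j) * b i) 0" by simp
      qed auto
      show "fps_cong K (\<Sum>l<K-j. a l * b (l + j)) (\<Sum>l<K. a l * b (l + j))"
      proof (rule fps_cong_sym[OF fps_cong_subset_sum])
        fix i assume "i \<in> {..<K} - {..<K-j}"
        then have "fps_cong K (b (i + j)) 0" by (intro sb) auto
        from fps_cong_mult[OF fps_cong_refl[of K "a i"] this] show "fps_cong K (a i * b (i + j)) 0" by simp
      qed auto
    qed
    also have "(\<Sum>l<K. a l * b l) + (\<Sum>j=1..<K. (\<Sum>l<K. a (l + j) * b l) + (\<Sum>l<K. a l * b (l + j)))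
       = (\<Sum>l<K. d 0 l) + (\<Sum>j=1..<K. theta_term A B j * (\<Sum>l<K. d j l))"
    proof (intro arg_cong2[of _ _ _ _ "(+)"] sum.cong refl)
      show "a l * b l = d 0 l" for l using ab[of l 0] by (simp add: numeral_2_eq_2)
      fix j assume "j \<in> {1..<K}"
      then show "(\<Sum>l<K. a (l + j) * b l) + (\<Sum>l<K. a l * b (l + j)) = theta_term A B j * (\<Sum>l<K. d j l)"
        unfolding ab ba by (simp add: theta_term_def sum_distrib_left[symmetric] distrib_right)
    qed
    also have "fps_cong K \<dots> (inverse (qpoch_inf p) + (\<Sum>j=1..<K. theta_term A B j * inverse (qpoch_inf p)))"
      by (intro fps_cong_add fps_cong_sum fps_cong_mult fps_cong_refl D)
    also have "fps_cong K \<dots> ((\<Sum>j<K. theta_term A B j) * inverse (qpoch_inf p))"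
    proof (cases K)
      case (Suc K')
      have "(\<Sum>j<K. theta_term A B j) = 1 + (\<Sum>j=1..<K. theta_term A B j)"
        using Suc by (simp add: lessThan_atLeast0 sum.atLeast_Suc_lessThan theta_term_def)
      then show ?thesis by (simp add: distrib_right sum_distrib_right)
    qed (simp add: fps_cong_def)
    also have "fps_cong K \<dots> (fps_isum (theta_term A B) * inverse (qpoch_inf p))"
      using st by (intro fps_cong_mult fps_cong_refl fps_cong_sym[OF fps_isum_cong]) auto
    finally show "fps_cong K (fps_isum a * fps_isum b) (fps_isum (theta_term A B) * inverse (qpoch_inf p))" .
  qed
  have "qpoch_inf p $ 0 \<noteq> 0" by (simp add: qpoch_inf_nth_0 p)
  from inverse_mult_eq_1[OF this]
  have "fps_isum a * fps_isum b * qpoch_inf p = fps_isum (theta_term A B)"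
    by (simp add: main mult.assoc)
  moreover have "fps_isum a = fps_iprod (\<lambda>i. 1 + A * p ^ i)"
    unfolding a_def by (rule euler_expansion[OF p A])
  moreover have "fps_isum b = fps_iprod (\<lambda>i. 1 + B * p ^ i)"
    unfolding b_def by (rule euler_expansion[OF p B])
  ultimately show ?thesis by (simp add: p_def)
qed

section \<open>Generating functions of odd Durfee symbols\<close>

text \<open>\<open>m\<close> counts the admissible part sizes 1, 3, ..., 2m-1, so the recursion can
  start from the empty row; the rows belonging to subscript D are those with m = D + 1.\<close>

definition odd_rows :: "nat \<Rightarrow> nat \<Rightarrow> nat list set" where
  "odd_rows m n = {xs. sorted_wrt (\<ge>) xs \<and> (\<forall>x\<in>set xs. odd x \<and> x < 2 * m) \<and> sum_list xs = n}"

definition odd_rows_gf :: "complex \<Rightarrow> nat \<Rightarrow> complex fps" where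
  "odd_rows_gf z m = Abs_fps (\<lambda>n. \<Sum>xs\<in>odd_rows m n. z ^ length xs)"

lemma finite_odd_rows: "finite (odd_rows m n)"
proof (rule finite_subset)
  show "odd_rows m n \<subseteq> {xs. set xs \<subseteq> {..n} \<and> length xs \<le> n}"
    using length_le_sum_list_pos member_le_sum_list by (fastforce simp: odd_rows_def)
  show "finite {xs. set xs \<subseteq> {..n} \<and> length xs \<le> n}"
    by (rule finite_lists_length_le) simp
qed

lemma odd_rows_0: "odd_rows 0 n = (if n = 0 then {[]} else {})"
  by (auto simp: odd_rows_def)

text \<open>A non-increasing row that contains the largest admissible part has it at the head;
  removing one copy leaves the bound unchanged.\<close>

lemma odd_rows_Suc:
  "odd_rows (Suc m) n = odd_rows m n \<union>
     (if n < 2 * m + 1 then {} else (#) (2 * m + 1) ` odd_rows (Suc m) (n - (2 * m + 1)))"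
  (is "?L = ?R")
proof (intro equalityI subsetI)
  fix xs assume xs: "xs \<in> ?L"
  show "xs \<in> ?R"
  proof (cases "\<exists>ys. xs = (2 * m + 1) # ys")
    case True
    then obtain ys where ys: "xs = (2 * m + 1) # ys" by blast
    have n: "n = 2 * m + 1 + sum_list ys" using xs by (simp add: odd_rows_def ys)
    then have "ys \<in> odd_rows (Suc m) (n - (2 * m + 1))" "\<not> n < 2 * m + 1"
      using xs by (simp_all add: odd_rows_def ys)
    then show ?thesis using ys by simp
  next
    case False
    have "x < 2 * m" if "x \<in> set xs" for x
    proof -
      obtain y ys where y: "xs = y # ys" using \<open>x \<in> set xs\<close> by (cases xs) auto
      have "odd y" "y < 2 * Suc m" "y \<noteq> 2 * m + 1" using xs y False by (auto simp: odd_rows_def)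
      then have "y < 2 * m" by presburger
      moreover have "x \<le> y" using xs y that by (auto simp: odd_rows_def)
      ultimately show ?thesis by simp
    qed
    then have "xs \<in> odd_rows m n" using xs by (auto simp: odd_rows_def)
    then show ?thesis by blast
  qed
next
  fix xs assume "xs \<in> ?R"
  then consider "xs \<in> odd_rows m n"
    | ys where "xs = (2 * m + 1) # ys" "2 * m + 1 \<le> n" "ys \<in> odd_rows (Suc m) (n - (2 * m + 1))"
    by (cases "n < 2 * m + 1") auto
  then show "xs \<in> ?L"
  proof cases
    case 1
    have "x < 2 * Suc m" if "x \<in> set xs" for x
    proof -
      have "x < 2 * m" using 1 that unfolding odd_rows_def by blast
      then show ?thesis by simp
    qed
    then show ?thesis using 1 unfolding odd_rows_def by blast
  next
    case 2
    have ys: "sorted_wrt (\<ge>) ys" "\<forall>x\<in>set ys. odd x \<and> x < 2 * Suc m" "sum_list ys = n - (2 * m + 1)"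
      using 2(3) unfolding odd_rows_def by blast+
    have le: "x \<le> 2 * m + 1" if "x \<in> set ys" for x
    proof -
      have "x < 2 * Suc m" using ys(2) that by blast
      then show ?thesis by simp
    qed
    have "sum_list xs = n" using ys(3) 2(1,2) by simp
    moreover have "sorted_wrt (\<ge>) xs" unfolding 2(1) sorted_wrt.simps using ys(1) le by blast
    moreover have "odd (2 * m + 1)" "2 * m + 1 < 2 * Suc m" by simp_all
    then have "\<forall>x\<in>set xs. odd x \<and> x < 2 * Suc m"
      unfolding 2(1) list.set using ys(2) by blast
    ultimately show ?thesis unfolding odd_rows_def by blast
  qed
qed

lemma odd_rows_gf_Suc:
  "odd_rows_gf z (Suc m) * (1 - fps_const z * fps_X ^ (2 * m + 1)) = odd_rows_gf z m"
proof -
  have "odd_rows_gf z (Suc m) = odd_rows_gf z m + fps_X ^ (2 * m + 1) * (fps_const z * odd_rows_gf z (Suc m))"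
  proof (rule fps_ext)
    fix n
    have disj: "odd_rows m n \<inter> (#) (2 * m + 1) ` odd_rows (Suc m) (n - (2 * m + 1)) = {}"
    proof -
      have "(2 * m + 1) # ys \<notin> odd_rows m n" for ys
      proof
        assume "(2 * m + 1) # ys \<in> odd_rows m n"
        then have "2 * m + 1 < 2 * m" unfolding odd_rows_def by simp
        then show False by simp
      qed
      then show ?thesis by blast
    qed
    have "odd_rows_gf z (Suc m) $ n = (\<Sum>xs\<in>odd_rows (Suc m) n. z ^ length xs)"
      by (simp add: odd_rows_gf_def)
    also have "\<dots> = (\<Sum>xs\<in>odd_rows m n. z ^ length xs) +
        (if n < 2 * m + 1 then 0 else \<Sum>xs\<in>(#) (2 * m + 1) ` odd_rows (Suc m) (n - (2 * m + 1)). z ^ length xs)"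
      using disj by (subst odd_rows_Suc) (simp add: sum.union_disjoint finite_odd_rows)
    also have "\<dots> = (odd_rows_gf z m + fps_X ^ (2 * m + 1) * (fps_const z * odd_rows_gf z (Suc m))) $ n"
      unfolding fps_add_nth fps_X_power_mult_nth fps_mult_left_const_nth
      by (simp add: odd_rows_gf_def sum.reindex sum_distrib_left)
    finally show "odd_rows_gf z (Suc m) $ n = \<dots>" .
  qed
  moreover have "G * (1 - c * Y) = G - Y * (c * G)" for G c Y :: "complex fps"
    by (simp add: algebra_simps)
  ultimately show ?thesis by (metis add_diff_cancel_right')
qed

lemma odd_rows_gf_eq: "odd_rows_gf z m = inverse (\<Prod>j<m. 1 - fps_const z * fps_X ^ (2 * j + 1))"
proof (induction m)
  case 0
  then show ?case by (auto simp: odd_rows_gf_def odd_rows_0 fps_eq_iff)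
next
  case (Suc m)
  have nz: "(1 - fps_const z * fps_X ^ (2 * m + 1)) $ 0 \<noteq> 0" by simp
  have "odd_rows_gf z (Suc m) = odd_rows_gf z (Suc m) * (1 - fps_const z * fps_X ^ (2 * m + 1))
      * inverse (1 - fps_const z * fps_X ^ (2 * m + 1))"
    using inverse_mult_eq_1'[OF nz] by (simp add: mult.assoc)
  also have "\<dots> = odd_rows_gf z m * inverse (1 - fps_const z * fps_X ^ (2 * m + 1))"
    by (simp only: odd_rows_gf_Suc)
  finally show ?case by (simp only: Suc fps_inverse_mult prod.lessThan_Suc)
qed

section \<open>The rank generating function and its Lambert series\<close>

definition rank_gf :: "complex \<Rightarrow> complex fps" where
  "rank_gf z = Abs_fps (\<lambda>n. \<Sum>S\<in>odd_durfee_symbols n. z powi odd_rank S)"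

lemma odd_durfee_row_iff: "odd_durfee_row D xs \<longleftrightarrow> xs \<in> odd_rows (Suc D) (sum_list xs)"
proof -
  have "x \<le> 2 * D + 1 \<longleftrightarrow> x < 2 * Suc D" for x by (simp add: less_Suc_eq_le)
  then show ?thesis unfolding odd_durfee_row_def odd_rows_def by simp
qed

lemma odd_rows_sum_list: "xs \<in> odd_rows m n \<Longrightarrow> sum_list xs = n"
  by (simp add: odd_rows_def)

lemma rank_gf_eq_isum:
  assumes z: "z \<noteq> 0"
  shows "rank_gf z = fps_isum (\<lambda>D. fps_X ^ (2 * D\<^sup>2 + 2 * D + 1)
     * (odd_rows_gf z (Suc D) * odd_rows_gf (inverse z) (Suc D)))"
proof (rule fps_ext)
  fix n
  define w where "w = (\<lambda>D. 2 * D\<^sup>2 + 2 * D + 1 :: nat)"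
  \<comment> \<open>The sum \<open>a\<close> of the top row is carried along as an index, which
    turns the part over a fixed D into a Cauchy product. The bound D <= n matches the partial sum in
    \<open>fps_isum\<close>.\<close>
  define I where "I = (SIGMA D:{D. D \<le> n \<and> w D \<le> n}. SIGMA a:{0..n - w D}.
      odd_rows (Suc D) a \<times> odd_rows (Suc D) (n - w D - a))"
  have "(\<Sum>S\<in>odd_durfee_symbols n. z powi odd_rank S)
      = (\<Sum>(D, a, xs, ys)\<in>I. z ^ length xs * inverse z ^ length ys)"
  proof (rule sum.reindex_bij_witness[of _ "\<lambda>(D, a, xs, ys). (D, xs, ys)"
        "\<lambda>(D, xs, ys). (D, sum_list xs, xs, ys)"])
    fix S assume "S \<in> odd_durfee_symbols n"
    then obtain D xs ys where S: "S = (D, xs, ys)" "odd_durfee_row D xs" "odd_durfee_row D ys"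
      "n = sum_list xs + sum_list ys + w D"
      by (auto simp: odd_durfee_symbols_def w_def)
    have "z powi odd_rank S = z ^ length xs * inverse z ^ length ys"
      using z by (simp add: S(1) power_int_diff divide_inverse power_inverse)
    then show "(case case S of (D, xs, ys) \<Rightarrow> (D, sum_list xs, xs, ys) of
        (D, a, xs, ys) \<Rightarrow> z ^ length xs * inverse z ^ length ys) = z powi odd_rank S"
      by (simp add: S(1))
    show "(case S of (D, xs, ys) \<Rightarrow> (D, sum_list xs, xs, ys)) \<in> I"
    proof -
      have "D \<le> w D" by (simp add: w_def)
      then have "D \<le> n" "w D \<le> n" "sum_list xs \<le> n - w D" "n - w D - sum_list xs = sum_list ys"
        using S(4) by linarith+
      then show ?thesis
        using S(2,3) unfolding S(1) odd_durfee_row_iff by (simp add: I_def)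
    qed
    show "(case case S of (D, xs, ys) \<Rightarrow> (D, sum_list xs, xs, ys) of (D, a, xs, ys) \<Rightarrow> (D, xs, ys)) = S"
      by (simp add: S(1))
  next
    fix b assume "b \<in> I"
    then obtain D a xs ys where b: "b = (D, a, xs, ys)" "w D \<le> n" "a \<le> n - w D"
      "xs \<in> odd_rows (Suc D) a" "ys \<in> odd_rows (Suc D) (n - w D - a)"
      by (auto simp: I_def)
    note sums = odd_rows_sum_list[OF b(4)] odd_rows_sum_list[OF b(5)]
    show "(case case b of (D, a, xs, ys) \<Rightarrow> (D, xs, ys) of (D, xs, ys) \<Rightarrow> (D, sum_list xs, xs, ys)) = b"
      using sums by (simp add: b(1))
    show "(case b of (D, a, xs, ys) \<Rightarrow> (D, xs, ys)) \<in> odd_durfee_symbols n"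
    proof -
      have "odd_durfee_row D xs" "odd_durfee_row D ys"
        unfolding odd_durfee_row_iff sums using b(4,5) by blast+
      moreover have "n = sum_list xs + sum_list ys + w D" using b(2,3) sums by linarith
      ultimately show ?thesis unfolding odd_durfee_symbols_def by (simp add: b(1) w_def)
    qed
  qed
  also have "\<dots> = (\<Sum>D\<in>{D. D \<le> n \<and> w D \<le> n}. \<Sum>a=0..n - w D.
      (\<Sum>xs\<in>odd_rows (Suc D) a. \<Sum>ys\<in>odd_rows (Suc D) (n - w D - a). z ^ length xs * inverse z ^ length ys))"
    unfolding I_def by (simp add: sum.Sigma finite_odd_rows finite_SigmaI)
  also have "\<dots> = (\<Sum>D\<in>{D. D \<le> n \<and> w D \<le> n}. (odd_rows_gf z (Suc D) * odd_rows_gf (inverse z) (Suc D)) $ (n - w D))"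
    by (simp add: fps_mult_nth odd_rows_gf_def sum_product)
  also have "\<dots> = (\<Sum>D\<le>n. (fps_X ^ w D * (odd_rows_gf z (Suc D) * odd_rows_gf (inverse z) (Suc D))) $ n)"
    unfolding fps_X_power_mult_nth
    by (intro sum.mono_neutral_cong_left) auto
  finally show "rank_gf z $ n = fps_isum (\<lambda>D. fps_X ^ (2 * D\<^sup>2 + 2 * D + 1)
     * (odd_rows_gf z (Suc D) * odd_rows_gf (inverse z) (Suc D))) $ n"
    by (simp add: rank_gf_def fps_isum_def fps_sum_nth w_def)
qed

lemma odd_rows_gf_mult:
  assumes z: "z \<noteq> 0"
  shows "odd_rows_gf z m * odd_rows_gf (inverse z) m = inverse (\<Prod>j<m. pf_den (z + inverse z) (1, 2 * j + 1))"
proof -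
  have "(1 - fps_const z * Y) * (1 - fps_const (inverse z) * Y) = 1 - fps_const (z + inverse z) * Y + Y * Y"
    for Y :: "complex fps"
  proof -
    have "fps_const z * fps_const (inverse z) = 1" using z by simp
    then have "fps_const z * Y * (fps_const (inverse z) * Y) = Y * Y"
      by (metis mult.assoc mult.left_commute mult_1)
    then show ?thesis unfolding fps_const_add[symmetric] by (simp only: algebra_simps mult_1_left mult_1_right)
  qed
  then have "(1 - fps_const z * fps_X ^ (2 * j + 1)) * (1 - fps_const (inverse z) * fps_X ^ (2 * j + 1))
      = pf_den (z + inverse z) (1, 2 * j + 1)" for j
    by (simp only: pf_den_def fst_conv snd_conv mult_1_left mult_2[of "2 * j + 1"] power_add[of _ "2 * j + 1"])
  then show ?thesis
    by (simp only: odd_rows_gf_eq fps_inverse_mult[symmetric] prod.distrib[symmetric])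
qed

lemma prod_power_choose: "(\<Prod>i<j. - (p ^ Suc i)) = (-1) ^ j * (p :: 'a::comm_ring_1 fps) ^ (Suc j choose 2)"
  by (induction j) (simp_all add: numeral_2_eq_2 power_add algebra_simps)

text \<open>In units of 2d the differences of nodes fill 1..j and 1..N-1-j, and the sums fill
  j+1..N+j except 2j+1, missing because i = j is omitted. The first list of differences completes
  the sums from below, and 1 - p^(2j+1) closes the hole.\<close>

lemma pf_coeff_arith:
  assumes d: "d > 0" and j: "j < N" and e: "e * e = (1 :: 'a::field_char_0)"
  defines "p \<equiv> fps_X ^ (2 * d) :: 'a fps"
  shows "(\<Prod>i\<in>{..<N} - {j}. pf_num (e, d * (2 * i + 1)) (e, d * (2 * j + 1))
      * inverse (pf_gap (e, d * (2 * i + 1)) (e, d * (2 * j + 1)))) =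
    p ^ (Suc j choose 2) * ((-1) ^ j * (1 - p ^ (2 * j + 1)) * inverse (qpoch p (N - 1 - j) * qpoch p (N + j)))"
proof -
  have p0: "p $ 0 = 0" using d by (simp add: p_def)
  have split: "{..<N} - {j} = {..<j} \<union> {Suc j..<N}" using j by auto
  have num: "pf_num (e, d * (2 * i + 1)) (e, d * (2 * j + 1)) = (if i < j then - (p ^ (j - i)) else 1)" for i
  proof -
    have "d * (2 * j + 1) - d * (2 * i + 1) = 2 * d * (j - i)"
      by (simp add: diff_mult_distrib2 algebra_simps)
    then show ?thesis using d by (simp add: pf_num_def e p_def power_mult)
  qed
  have gap: "pf_gap (e, d * (2 * i + 1)) (e, d * (2 * j + 1)) =
      (1 - p ^ (if i < j then j - i else i - j)) * (1 - p ^ (i + j + 1))" for i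
  proof -
    have "d * (2 * j + 1) - d * (2 * i + 1) = 2 * d * (j - i)"
      "d * (2 * i + 1) - d * (2 * j + 1) = 2 * d * (i - j)"
      "d * (2 * i + 1) + d * (2 * j + 1) = 2 * d * (i + j + 1)"
      by (simp_all add: diff_mult_distrib2 algebra_simps)
    moreover have "d * (2 * i + 1) < d * (2 * j + 1) \<longleftrightarrow> i < j" using d by simp
    moreover have "p ^ k = fps_X ^ (2 * d * k)" for k by (simp only: p_def power_mult)
    ultimately show ?thesis
      by (cases "i < j") (simp_all only: pf_gap_def fst_conv snd_conv e fps_const_1_eq_1 mult_1_left
          if_True if_False simp_thms)
  qed
  have rev: "(\<Prod>i<j. f (j - i)) = (\<Prod>i<j. f (Suc i))" for f :: "nat \<Rightarrow> 'a fps"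
    by (rule prod.reindex_bij_witness[of _ "\<lambda>i. j - Suc i" "\<lambda>i. j - Suc i"]) (auto simp: Suc_diff_Suc)
  have N1: "(\<Prod>i\<in>{..<N} - {j}. pf_num (e, d * (2 * i + 1)) (e, d * (2 * j + 1))) = (-1) ^ j * p ^ (Suc j choose 2)"
  proof -
    have "(\<Prod>i\<in>{..<N} - {j}. pf_num (e, d * (2 * i + 1)) (e, d * (2 * j + 1)))
        = (\<Prod>i<j. - (p ^ (j - i)))"
      unfolding num split by (subst prod.union_disjoint) auto
    also have "\<dots> = (\<Prod>i<j. - (p ^ Suc i))" by (rule rev)
    finally show ?thesis by (simp only: prod_power_choose)
  qed
  have G1: "(\<Prod>i\<in>{..<N} - {j}. 1 - p ^ (if i < j then j - i else i - j)) = qpoch p j * qpoch p (N - 1 - j)"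
  proof -
    have "(\<Prod>i\<in>{..<N} - {j}. 1 - p ^ (if i < j then j - i else i - j)) =
        (\<Prod>i<j. 1 - p ^ (j - i)) * (\<Prod>i=Suc j..<N. 1 - p ^ (i - j))"
      unfolding split by (subst prod.union_disjoint) auto
    also have "(\<Prod>i<j. 1 - p ^ (j - i)) = (\<Prod>i<j. 1 - p ^ Suc i)" by (rule rev)
    also have "(\<Prod>i=Suc j..<N. 1 - p ^ (i - j)) = (\<Prod>i<N - 1 - j. 1 - p ^ Suc i)"
      by (rule prod.reindex_bij_witness[of _ "\<lambda>i. i + Suc j" "\<lambda>i. i - Suc j"]) (auto simp: Suc_diff_Suc)
    finally show ?thesis by (simp only: qpoch_def)
  qed
  have G2: "qpoch p j * (1 - p ^ (2 * j + 1)) * (\<Prod>i\<in>{..<N} - {j}. 1 - p ^ (i + j + 1)) = qpoch p (N + j)"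
  proof -
    have "(1 - p ^ (2 * j + 1)) * (\<Prod>i\<in>{..<N} - {j}. 1 - p ^ (i + j + 1)) = (\<Prod>i<N. 1 - p ^ (i + j + 1))"
      using j by (subst prod.remove[of _ j]) (auto simp: mult_2)
    moreover have "qpoch p j * (\<Prod>i<n. 1 - p ^ (i + j + 1)) = qpoch p (n + j)" for n
      by (induction n) (simp_all add: qpoch_Suc mult.assoc[symmetric])
    ultimately show ?thesis by (simp only: mult.assoc)
  qed
  have "(1 - p ^ (2 * j + 1)) * (\<Prod>i\<in>{..<N} - {j}. pf_gap (e, d * (2 * i + 1)) (e, d * (2 * j + 1))) =
      qpoch p (N - 1 - j) * (qpoch p j * (1 - p ^ (2 * j + 1)) * (\<Prod>i\<in>{..<N} - {j}. 1 - p ^ (i + j + 1)))"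
    unfolding gap prod.distrib G1 by (simp only: mult_ac)
  also have "\<dots> = qpoch p (N - 1 - j) * qpoch p (N + j)"
    by (simp only: G2)
  finally have "inverse (1 - p ^ (2 * j + 1)) * inverse (\<Prod>i\<in>{..<N} - {j}. pf_gap (e, d * (2 * i + 1)) (e, d * (2 * j + 1)))
      = inverse (qpoch p (N - 1 - j) * qpoch p (N + j))"
    by (simp only: fps_inverse_mult[symmetric])
  moreover have "(1 - p ^ (2 * j + 1)) $ 0 \<noteq> 0" using p0 by simp
  from inverse_mult_eq_1'[OF this] have "(1 - p ^ (2 * j + 1)) * (inverse (1 - p ^ (2 * j + 1)) * Y) = Y" for Y
    by (simp only: mult.assoc[symmetric] mult_1_left)
  ultimately have "inverse (\<Prod>i\<in>{..<N} - {j}. pf_gap (e, d * (2 * i + 1)) (e, d * (2 * j + 1))) =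
      (1 - p ^ (2 * j + 1)) * inverse (qpoch p (N - 1 - j) * qpoch p (N + j))"
    by metis
  then show ?thesis
    unfolding prod.distrib N1 inverse_prod_fps[symmetric] by (simp only: mult_ac)
qed

lemma pf_den_odd_nth_0: "pf_den t (e, 2 * j + 1) $ 0 = 1"
  by (simp add: pf_den_def)

lemma inverse_prod_pf_den:
  fixes s :: complex
  assumes N: "N > 0"
  shows "inverse (\<Prod>j<N. pf_den s (1, 2 * j + 1)) =
    (\<Sum>j<N. fps_X ^ (2 * (Suc j choose 2)) * ((-1) ^ j * (1 - fps_X ^ (4 * j + 2))
       * inverse (qpoch (fps_X ^ 2) (N - 1 - j) * qpoch (fps_X ^ 2) (N + j)) * inverse (pf_den s (1, 2 * j + 1))))"
proof -
  define h where "h = (\<lambda>j::nat. (1 :: complex, 2 * j + 1))"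
  have inj: "inj_on h A" for A by (auto simp: h_def inj_on_def)
  have "inverse (\<Prod>p\<in>h ` {..<N}. pf_den s p) =
    (\<Sum>r\<in>h ` {..<N}. (\<Prod>p\<in>h ` {..<N} - {r}. pf_num p r * inverse (pf_gap p r)) * inverse (pf_den s r))"
    using N by (intro partial_fractions_fps) (auto simp: h_def pf_den_odd_nth_0 simp del: One_nat_def)
  also have "\<dots> = (\<Sum>j<N. (\<Prod>p\<in>h ` {..<N} - {h j}. pf_num p (h j) * inverse (pf_gap p (h j))) * inverse (pf_den s (h j)))"
    by (simp add: sum.reindex inj)
  also have "\<dots> = (\<Sum>j<N. fps_X ^ (2 * (Suc j choose 2)) * ((-1) ^ j * (1 - fps_X ^ (4 * j + 2))
       * inverse (qpoch (fps_X ^ 2) (N - 1 - j) * qpoch (fps_X ^ 2) (N + j)) * inverse (pf_den s (h j))))"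
  proof (intro sum.cong refl)
    fix j assume j: "j \<in> {..<N}"
    have "h ` {..<N} - {h j} = h ` ({..<N} - {j})"
      by (auto simp: h_def)
    then have "(\<Prod>p\<in>h ` {..<N} - {h j}. pf_num p (h j) * inverse (pf_gap p (h j))) =
        (\<Prod>i\<in>{..<N} - {j}. pf_num (h i) (h j) * inverse (pf_gap (h i) (h j)))"
      by (simp add: prod.reindex inj)
    also have "\<dots> = fps_X ^ (2 * (Suc j choose 2)) * ((-1) ^ j * (1 - fps_X ^ (4 * j + 2))
       * inverse (qpoch (fps_X ^ 2) (N - 1 - j) * qpoch (fps_X ^ 2) (N + j)))"
    proof -
      have "j < N" "(1::complex) * 1 = 1" using j by simp_all
      note * = pf_coeff_arith[of 1 j N "1::complex", OF zero_less_one this, unfolded mult_1_left mult_1_right]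
      have "4 * j + 2 = 2 * (2 * j + 1)" by simp
      then show ?thesis unfolding h_def by (simp only: * power_mult)
    qed
    finally show "(\<Prod>p\<in>h ` {..<N} - {h j}. pf_num p (h j) * inverse (pf_gap p (h j))) * inverse (pf_den s (h j)) =
      fps_X ^ (2 * (Suc j choose 2)) * ((-1) ^ j * (1 - fps_X ^ (4 * j + 2))
       * inverse (qpoch (fps_X ^ 2) (N - 1 - j) * qpoch (fps_X ^ 2) (N + j)) * inverse (pf_den s (h j)))"
      by (simp only: mult_ac)
  qed
  finally show ?thesis by (simp add: prod.reindex inj) (simp add: h_def)
qed

lemma fps_isum_triangle:
  assumes "\<And>i j. fps_cong (i + j) (f j i) 0"
  shows "fps_isum (\<lambda>D. \<Sum>j\<le>D. f j (D - j)) = fps_isum (\<lambda>j. fps_isum (f j))"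
proof (rule fps_ext)
  fix n
  have z: "f j i $ n = 0" if "n < i + j" for i j
    using assms[of i j] that by (simp add: fps_cong_def)
  have "fps_isum (\<lambda>D. \<Sum>j\<le>D. f j (D - j)) $ n = (\<Sum>D\<le>n. \<Sum>j\<le>D. f j (D - j) $ n)"
    by (simp add: fps_isum_def fps_sum_nth)
  also have "\<dots> = (\<Sum>(j,i)\<in>{(j,i). j + i \<le> n}. f j i $ n)"
    by (rule sum.triangle_reindex_eq[symmetric])
  also have "\<dots> = (\<Sum>(j,i)\<in>{..n} \<times> {..n}. f j i $ n)"
    by (intro sum.mono_neutral_left) (auto intro!: z simp: not_le add.commute)
  also have "\<dots> = (\<Sum>j\<le>n. \<Sum>i\<le>n. f j i $ n)"
    by (rule sum.cartesian_product[symmetric])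
  finally show "fps_isum (\<lambda>D. \<Sum>j\<le>D. f j (D - j)) $ n = fps_isum (\<lambda>j. fps_isum (f j)) $ n"
    by (simp add: fps_isum_def fps_sum_nth)
qed

lemma choose_2_Suc: "2 * (Suc j choose 2) = j * j + j"
  by (induction j) (simp_all add: numeral_2_eq_2)

text \<open>Put D = i + j in the expanded summand: 2D^2 + 2D + j(j+1) = 3j(j+1) + 2i(i+2j+1), and
  the Pochhammer symbols get the indices i and i+2j+1. The sum over i is then a Durfee rectangle sum
  in q^2 with a = 2j+1, independent of j.\<close>

lemma rank_gf_lambert:
  assumes z: "z \<noteq> 0"
  shows "rank_gf z = fps_X * inverse (qpoch_inf (fps_X ^ 2)) *
    fps_isum (\<lambda>j. fps_X ^ (6 * (Suc j choose 2)) * ((-1) ^ j * (1 - fps_X ^ (4 * j + 2))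
      * inverse (pf_den (z + inverse z) (1, 2 * j + 1))))"
proof -
  define p where "p = (fps_X ^ 2 :: complex fps)"
  have p0: "p $ 0 = 0" by (simp add: p_def)
  define s where "s = z + inverse z"
  define c where "c = (\<lambda>j. (-1) ^ j * (1 - fps_X ^ (4 * j + 2)) * inverse (pf_den s (1, 2 * j + 1)))"
  define g where "g = (\<lambda>j i. p ^ (i * (i + (2 * j + 1))) * inverse (qpoch p i * qpoch p (i + (2 * j + 1))))"
  define f where "f = (\<lambda>j i. fps_X ^ Suc (6 * (Suc j choose 2)) * c j * g j i)"
  have term_eq: "fps_X ^ (2 * D\<^sup>2 + 2 * D + 1) * inverse (\<Prod>j<Suc D. pf_den s (1, 2 * j + 1)) = (\<Sum>j\<le>D. f j (D - j))" for D
    unfolding inverse_prod_pf_den[OF zero_less_Suc] p_def[symmetric]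
    unfolding lessThan_Suc_atMost sum_distrib_left
  proof (intro sum.cong refl)
    fix j assume "j \<in> {..D}"
    then have "D = (D - j) + j" by simp
    then obtain i where D: "D = i + j" by blast
    have ex: "2 * D\<^sup>2 + 2 * D + 1 + 2 * (Suc j choose 2) = Suc (6 * (Suc j choose 2)) + 2 * (i * (i + (2 * j + 1)))"
    proof -
      have "6 * (Suc j choose 2) = 2 * (Suc j choose 2) + 2 * (2 * (Suc j choose 2))" by simp
      then show ?thesis unfolding choose_2_Suc by (simp add: D power2_eq_square algebra_simps)
    qed
    have E: "fps_X ^ (2 * D\<^sup>2 + 2 * D + 1) * (fps_X ^ (2 * (Suc j choose 2)) * Y)
       = fps_X ^ Suc (6 * (Suc j choose 2)) * p ^ (i * (i + (2 * j + 1))) * Y" for Y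
    proof -
    have "fps_X ^ (2 * D\<^sup>2 + 2 * D + 1) * fps_X ^ (2 * (Suc j choose 2))
       = fps_X ^ Suc (6 * (Suc j choose 2)) * p ^ (i * (i + (2 * j + 1)))"
      unfolding p_def power_mult[symmetric] power_add[symmetric] ex ..
    then show ?thesis by (simp only: mult.assoc[symmetric])
    qed
    have "Suc D - 1 - j = i" "Suc D + j = i + (2 * j + 1)" "D - j = i" using D by auto
    then show "fps_X ^ (2 * D\<^sup>2 + 2 * D + 1) * (fps_X ^ (2 * (Suc j choose 2)) * ((-1) ^ j * (1 - fps_X ^ (4 * j + 2))
       * inverse (qpoch p (Suc D - 1 - j) * qpoch p (Suc D + j)) * inverse (pf_den s (1, 2 * j + 1)))) = f j (D - j)"
      unfolding f_def c_def g_def E by (simp only: mult_ac)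
  qed
  have sg: "fps_cong i (g j i) 0" for i j
    unfolding g_def by (intro fps_cong_power_mult_0 p0) (cases i, auto)
  have "rank_gf z = fps_isum (\<lambda>D. \<Sum>j\<le>D. f j (D - j))"
    unfolding rank_gf_eq_isum[OF z] odd_rows_gf_mult[OF z] s_def[symmetric] term_eq ..
  also have "\<dots> = fps_isum (\<lambda>j. fps_isum (f j))"
  proof (rule fps_isum_triangle)
    fix i j
    have "i + j \<le> Suc (6 * (Suc j choose 2)) + 2 * (i * (i + (2 * j + 1)))"
    proof -
      have "i \<le> i * (i + (2 * j + 1))" by (cases i) auto
      moreover have "2 * j \<le> 2 * (Suc j choose 2)" unfolding choose_2_Suc by (cases j) auto
      ultimately show ?thesis by linarith
    qed
    moreover have "f j i = fps_X ^ (Suc (6 * (Suc j choose 2)) + 2 * (i * (i + (2 * j + 1))))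
        * (c j * inverse (qpoch p i * qpoch p (i + (2 * j + 1))))"
      unfolding f_def g_def p_def power_add power_mult by (simp only: mult_ac)
    ultimately show "fps_cong (i + j) (f j i) 0"
      by (simp only: fps_cong_X_power_0)
  qed
  also have "\<dots> = fps_isum (\<lambda>j. fps_X * inverse (qpoch_inf p) * (fps_X ^ (6 * (Suc j choose 2)) * c j))"
  proof (rule fps_isum_cong_fun)
    fix j
    have "fps_isum (f j) = fps_X ^ Suc (6 * (Suc j choose 2)) * c j * fps_isum (g j)"
      unfolding f_def by (rule fps_isum_mult_left[symmetric]) (rule sg)
    also have "fps_isum (g j) = inverse (qpoch_inf p)"
      unfolding g_def by (rule durfee_rectangle_sum[OF p0])
    finally show "fps_isum (f j) = fps_X * inverse (qpoch_inf p) * (fps_X ^ (6 * (Suc j choose 2)) * c j)"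
      by (simp only: power_Suc mult_ac)
  qed
  also have "\<dots> = fps_X * inverse (qpoch_inf p) * fps_isum (\<lambda>j. fps_X ^ (6 * (Suc j choose 2)) * c j)"
  proof (rule fps_isum_mult_left[symmetric])
    fix j
    have "2 * j \<le> 2 * (Suc j choose 2)" unfolding choose_2_Suc by (cases j) auto
    then show "fps_cong j (fps_X ^ (6 * (Suc j choose 2)) * c j) 0"
      by (intro fps_cong_X_power_0) auto
  qed
  finally show ?thesis by (simp only: c_def p_def s_def)
qed

lemma fps_isum_add: "fps_isum f + fps_isum g = fps_isum (\<lambda>i. f i + g i)"
  by (simp add: fps_isum_def fps_eq_iff fps_sum_nth sum.distrib)

lemma choose_2_ge: "j \<le> Suc j choose 2"
  using choose_2_Suc[of j] by (cases j) auto

lemma qpoch_inf_X_power: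
  "k > 0 \<Longrightarrow> qpoch_inf (fps_X ^ k :: 'a::idom fps) = fps_dil k (qpoch_inf fps_X)"
  unfolding qpoch_inf_def
  by (subst fps_dil_iprod) (auto simp: fps_dil_diff fps_dil_mult fps_dil_power fps_dil_X
      intro!: one_minus_power_cong simp del: power_Suc)

text \<open>Even and odd refer to the rank, that is, to the parity in s = z + 1/z, and not to n:
  \<open>lambert_even\<close> carries the odd n and \<open>lambert_odd\<close> the even n. In both,
  q stands for the former q^2.\<close>

definition lambert_even :: "complex \<Rightarrow> complex fps" where
  "lambert_even t = inverse (qpoch_inf fps_X) * fps_isum (\<lambda>j. fps_X ^ (3 * (Suc j choose 2)) *
     ((-1) ^ j * (1 - fps_X ^ (4 * j + 2)) * inverse (pf_den t (1, 2 * j + 1))))"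

definition lambert_odd :: "complex \<Rightarrow> complex fps" where
  "lambert_odd t = inverse (qpoch_inf fps_X) * fps_isum (\<lambda>j. fps_X ^ (3 * (Suc j choose 2) + j + 1) *
     ((-1) ^ j * (1 - fps_X ^ (2 * j + 1)) * inverse (pf_den t (1, 2 * j + 1))))"

lemma fps_dil_pf_den: "k > 0 \<Longrightarrow> fps_dil k (pf_den t (e, m)) = pf_den t (e, k * m)"
  by (simp add: pf_den_def fps_dil_add fps_dil_diff fps_dil_mult fps_dil_X_power mult_ac)

text \<open>Multiplying by the conjugate makes the denominator even in Y = q^(2j+1): (1 + Y^2)^2 -
  s^2 Y^2 = 1 - (s^2 - 2) Y^2 + Y^4.\<close>

lemma inverse_pf_den_split:
  fixes s :: complex
  shows "inverse (pf_den s (1, 2 * j + 1)) =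
    (1 + fps_X ^ (4 * j + 2) + fps_const s * fps_X ^ (2 * j + 1)) * fps_dil 2 (inverse (pf_den (s\<^sup>2 - 2) (1, 2 * j + 1)))"
proof -
  define Y where "Y = (fps_X ^ (2 * j + 1) :: complex fps)"
  define c where "c = fps_const s"
  have Y2: "fps_X ^ (4 * j + 2) = Y * Y" "fps_X ^ (2 * (2 * j + 1)) = Y * Y" "fps_X ^ (2 * (2 * (2 * j + 1))) = Y * Y * (Y * Y)"
    unfolding Y_def power_add[symmetric] by (rule arg_cong[of _ _ "\<lambda>n. fps_X ^ n"], simp)+
  have cc: "fps_const (s\<^sup>2 - 2) = c * c - 2"
    by (simp add: c_def power2_eq_square numeral_fps_const)
  have "(1 + Y * Y + c * Y) * pf_den s (1, 2 * j + 1) = pf_den (s\<^sup>2 - 2) (1, 2 * (2 * j + 1))"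
    unfolding pf_den_def fst_conv snd_conv mult_1_left Y2 Y_def[symmetric] c_def[symmetric] cc
    by (simp add: algebra_simps)
  then have eq: "(1 + Y * Y + c * Y) * pf_den s (1, 2 * j + 1) = fps_dil 2 (pf_den (s\<^sup>2 - 2) (1, 2 * j + 1))"
    by (subst fps_dil_pf_den) auto
  have n1: "pf_den s (1, 2 * j + 1) $ 0 \<noteq> 0" by (simp only: pf_den_odd_nth_0) simp
  have n2: "fps_dil 2 (pf_den (s\<^sup>2 - 2) (1, 2 * j + 1)) $ 0 \<noteq> 0"
    unfolding fps_dil_nth_0 by (simp only: pf_den_odd_nth_0) simp
  have "inverse (pf_den s (1, 2 * j + 1)) = inverse (pf_den s (1, 2 * j + 1)) *
      (fps_dil 2 (pf_den (s\<^sup>2 - 2) (1, 2 * j + 1)) * inverse (fps_dil 2 (pf_den (s\<^sup>2 - 2) (1, 2 * j + 1))))"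
    by (simp only: inverse_mult_eq_1'[OF n2] mult_1_right)
  also have "\<dots> = (pf_den s (1, 2 * j + 1) * inverse (pf_den s (1, 2 * j + 1))) * (1 + Y * Y + c * Y)
      * inverse (fps_dil 2 (pf_den (s\<^sup>2 - 2) (1, 2 * j + 1)))"
    unfolding eq[symmetric] by (simp only: mult_ac)
  finally show ?thesis
    unfolding inverse_mult_eq_1'[OF n1] Y2 c_def Y_def[symmetric] by (simp add: fps_dil_inverse)
qed

text \<open>The numerator 1 - Y^2 of the Lambert series meets 1 + Y^2 + sY: the product 1 - Y^4
  gives the part without s, and Y (1 - Y^2) the part with s.\<close>

lemma rank_gf_split:
  assumes z: "z \<noteq> 0" and t: "t = (z + inverse z)\<^sup>2 - 2"
  shows "rank_gf z = fps_X * fps_dil 2 (lambert_even t) + fps_const (z + inverse z) * fps_dil 2 (lambert_odd t)"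
proof -
  define s where "s = z + inverse z"
  define E where "E = (\<lambda>j. inverse (pf_den t (1, 2 * j + 1)))"
  define f where "f = (\<lambda>j. fps_X ^ (3 * (Suc j choose 2)) * ((-1) ^ j * (1 - fps_X ^ (4 * j + 2)) * E j))"
  define g where "g = (\<lambda>j. fps_X ^ (3 * (Suc j choose 2) + j + 1) * ((-1) ^ j * (1 - fps_X ^ (2 * j + 1)) * E j))"
  have sf: "fps_cong j (f j) 0" and sg: "fps_cong j (g j) 0" for j
    unfolding f_def g_def by (rule fps_cong_X_power_0, use choose_2_ge[of j] in linarith)+
  have "fps_X ^ (6 * (Suc j choose 2)) * ((-1) ^ j * (1 - fps_X ^ (4 * j + 2)) * inverse (pf_den s (1, 2 * j + 1)))
     = fps_dil 2 (f j) + (fps_const s * fps_X ^ (2 * j + 1)) * (fps_X ^ (6 * (Suc j choose 2)) * ((-1) ^ j * (1 - fps_X ^ (4 * j + 2)) * fps_dil 2 (E j)))" for j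
  proof -
    define Y where "Y = (fps_X ^ (2 * j + 1) :: complex fps)"
    have Y2: "fps_X ^ (4 * j + 2) = Y * Y" "fps_X ^ (2 * (4 * j + 2)) = Y * Y * (Y * Y)"
      unfolding Y_def power_add[symmetric] by (rule arg_cong[of _ _ "\<lambda>n. fps_X ^ n"], simp)+
    have "fps_dil 2 (f j) = fps_X ^ (2 * (3 * (Suc j choose 2))) * ((-1) ^ j * (1 - fps_X ^ (2 * (4 * j + 2))) * fps_dil 2 (E j))"
      unfolding f_def by (simp only: fps_dil_mult[OF zero_less_numeral] fps_dil_diff fps_dil_X[OF zero_less_numeral]
          fps_dil_power[OF zero_less_numeral] fps_dil_uminus fps_dil_1 power_mult)
    also have "2 * (3 * (Suc j choose 2)) = 6 * (Suc j choose 2)" by simp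
    finally have fj: "fps_dil 2 (f j) = fps_X ^ (6 * (Suc j choose 2)) * ((-1) ^ j * (1 - Y * Y * (Y * Y)) * fps_dil 2 (E j))"
      unfolding Y2 .
    have Es: "inverse (pf_den s (1, 2 * j + 1)) = (1 + Y * Y + fps_const s * Y) * fps_dil 2 (E j)"
      using inverse_pf_den_split[of s j] by (simp only: E_def t s_def[symmetric] Y2 Y_def[symmetric])
    have "P * (m * (1 - Y * Y) * ((1 + Y * Y + c * Y) * e)) =
        P * (m * (1 - Y * Y * (Y * Y)) * e) + (c * Y) * (P * (m * (1 - Y * Y) * e))" for P m c e :: "complex fps"
      by (simp add: algebra_simps)
    then show ?thesis unfolding fj Es Y2 Y_def[symmetric] by blast
  qed
  moreover have "fps_X * ((fps_const s * fps_X ^ (2 * j + 1)) * (fps_X ^ (6 * (Suc j choose 2)) * ((-1) ^ j * (1 - fps_X ^ (4 * j + 2)) * fps_dil 2 (E j))))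
     = fps_const s * fps_dil 2 (g j)" for j
  proof -
    have "fps_dil 2 (g j) = fps_X ^ (2 * (3 * (Suc j choose 2) + j + 1)) * ((-1) ^ j * (1 - fps_X ^ (2 * (2 * j + 1))) * fps_dil 2 (E j))"
      unfolding g_def by (simp only: fps_dil_mult[OF zero_less_numeral] fps_dil_diff fps_dil_X[OF zero_less_numeral]
          fps_dil_power[OF zero_less_numeral] fps_dil_uminus fps_dil_1 power_mult)
    also have "2 * (3 * (Suc j choose 2) + j + 1) = 1 + (2 * j + 1) + 6 * (Suc j choose 2)" by simp
    also have "2 * (2 * j + 1) = 4 * j + 2" by simp
    finally show ?thesis unfolding power_add power_one_right by (simp only: mult_ac)
  qed
  ultimately have tm: "fps_X * (fps_X ^ (6 * (Suc j choose 2)) * ((-1) ^ j * (1 - fps_X ^ (4 * j + 2)) * inverse (pf_den s (1, 2 * j + 1))))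
     = fps_X * fps_dil 2 (f j) + fps_const s * fps_dil 2 (g j)" for j
    by (simp only: distrib_left)
  have "fps_X * fps_isum (\<lambda>j. fps_X ^ (6 * (Suc j choose 2)) * ((-1) ^ j * (1 - fps_X ^ (4 * j + 2))
      * inverse (pf_den s (1, 2 * j + 1)))) = fps_isum (\<lambda>j. fps_X * fps_dil 2 (f j) + fps_const s * fps_dil 2 (g j))"
  proof (subst fps_isum_mult_left)
    show "fps_cong j (fps_X ^ (6 * (Suc j choose 2)) * ((-1) ^ j * (1 - fps_X ^ (4 * j + 2)) * inverse (pf_den s (1, 2 * j + 1)))) 0" for j
      by (rule fps_cong_X_power_0) (use choose_2_ge[of j] in linarith)
  qed (simp only: tm)
  also have "\<dots> = fps_X * fps_isum (\<lambda>j. fps_dil 2 (f j)) + fps_const s * fps_isum (\<lambda>j. fps_dil 2 (g j))"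
  proof -
    have d: "fps_cong j (fps_dil 2 (f j)) 0" "fps_cong j (fps_dil 2 (g j)) 0" for j
      using fps_cong_dil[of 2, OF _ sf[of j]] fps_cong_dil[of 2, OF _ sg[of j]] by simp_all
    show ?thesis
      unfolding fps_isum_mult_left[of "\<lambda>j. fps_dil 2 (f j)", OF d(1)]
        fps_isum_mult_left[of "\<lambda>j. fps_dil 2 (g j)", OF d(2)] fps_isum_add ..
  qed
  also have "fps_isum (\<lambda>j. fps_dil 2 (f j)) = fps_dil 2 (fps_isum f)"
    using sf by (intro fps_dil_isum[symmetric]) auto
  also have "fps_isum (\<lambda>j. fps_dil 2 (g j)) = fps_dil 2 (fps_isum g)"
    using sg by (intro fps_dil_isum[symmetric]) auto
  finally have main: "fps_X * fps_isum (\<lambda>j. fps_X ^ (6 * (Suc j choose 2)) * ((-1) ^ j * (1 - fps_X ^ (4 * j + 2))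
      * inverse (pf_den s (1, 2 * j + 1)))) = fps_X * fps_dil 2 (fps_isum f) + fps_const s * fps_dil 2 (fps_isum g)" .
  have J: "inverse (qpoch_inf (fps_X ^ 2)) = fps_dil 2 (inverse (qpoch_inf fps_X) :: complex fps)"
    by (simp add: qpoch_inf_X_power fps_dil_inverse)
  have L: "lambert_even t = inverse (qpoch_inf fps_X) * fps_isum f" "lambert_odd t = inverse (qpoch_inf fps_X) * fps_isum g"
    by (simp_all only: lambert_even_def lambert_odd_def f_def g_def E_def)
  have "rank_gf z = inverse (qpoch_inf (fps_X ^ 2)) * (fps_X * fps_isum (\<lambda>j. fps_X ^ (6 * (Suc j choose 2)) * ((-1) ^ j * (1 - fps_X ^ (4 * j + 2))
      * inverse (pf_den s (1, 2 * j + 1)))))"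
    unfolding rank_gf_lambert[OF z] s_def by (simp only: mult_ac)
  then show ?thesis
    unfolding main J L s_def[symmetric] fps_dil_mult[OF zero_less_numeral] by (simp only: distrib_left mult_ac)
qed

definition odd_prod :: "nat \<Rightarrow> complex fps" where
  "odd_prod n = (\<Prod>i<n. 1 + fps_X ^ (2 * i + 1))"

text \<open>In the usual notation this is (-q; q^2) with infinitely many factors;
  \<open>odd_diff_inf\<close> below is (q; q^2).\<close>

definition odd_prod_inf :: "complex fps" where
  "odd_prod_inf = fps_iprod (\<lambda>i. 1 + fps_X ^ (2 * i + 1))"

lemma fps_cong_one_plus_X_power': "K \<le> e \<Longrightarrow> fps_cong K (1 + fps_X ^ e) 1"
  using fps_cong_one_plus_X_power[of K e 1] by simp

lemma odd_prod_cong: "K \<le> N \<Longrightarrow> fps_cong K (odd_prod N) odd_prod_inf"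
  unfolding odd_prod_def odd_prod_inf_def
  by (intro fps_cong_sym[OF fps_iprod_cong] fps_cong_one_plus_X_power'; linarith)

lemma odd_prod_nth_0: "odd_prod n $ 0 = 1"
  by (simp add: odd_prod_def fps_prod_nth_0)

lemma odd_prod_inf_nth_0: "odd_prod_inf $ 0 = 1"
  using odd_prod_cong[of 1 1] odd_prod_nth_0[of 1] by (simp add: fps_cong_def)

text \<open>Compares exponents as sets, so that a product running through the odd numbers in an
  irregular order need not be reindexed.\<close>

lemma odd_set_prod_cong:
  assumes "finite A" "\<And>a. a \<in> A \<Longrightarrow> odd a" "\<And>a. odd a \<Longrightarrow> a < K \<Longrightarrow> a \<in> A"
  shows "fps_cong K (\<Prod>a\<in>A. 1 + fps_X ^ a) odd_prod_inf"
proof -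
  define B where "B = {a. odd a \<and> a < K}"
  have finB: "finite B" by (simp add: B_def)
  have "fps_cong K (\<Prod>a\<in>A. 1 + fps_X ^ a) (\<Prod>a\<in>B. 1 + fps_X ^ a :: complex fps)"
  proof (rule fps_cong_subset_prod)
    show "B \<subseteq> A" using assms by (auto simp: B_def)
    show "fps_cong K (1 + fps_X ^ i) 1" if "i \<in> A - B" for i
      using fps_cong_one_plus_X_power[of K i 1] that assms(2) by (auto simp: B_def)
  qed (rule assms)
  also have "fps_cong K (\<Prod>a\<in>B. 1 + fps_X ^ a) (\<Prod>a\<in>(\<lambda>i. 2 * i + 1) ` {..<K}. 1 + fps_X ^ a :: complex fps)"
  proof (rule fps_cong_sym[OF fps_cong_subset_prod])
    show "B \<subseteq> (\<lambda>i. 2 * i + 1) ` {..<K}"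
      by (auto simp: B_def image_iff elim!: oddE)
    show "fps_cong K (1 + fps_X ^ i) 1" if "i \<in> (\<lambda>i. 2 * i + 1) ` {..<K} - B" for i
      using fps_cong_one_plus_X_power[of K i 1] that by (auto simp: B_def)
  qed simp
  also have "(\<Prod>a\<in>(\<lambda>i. 2 * i + 1) ` {..<K}. 1 + fps_X ^ a) = odd_prod K"
    unfolding odd_prod_def by (subst prod.reindex) (auto simp: inj_on_def)
  also have "fps_cong K \<dots> odd_prod_inf" by (rule odd_prod_cong) simp
  finally show ?thesis .
qed

section \<open>Partial fractions with two families of poles\<close>

lemma Suc_choose_2: "Suc j choose 2 = j + (j choose 2)"
  by (simp add: numeral_2_eq_2)

text \<open>Truncated subtraction selects the k with 4k+2 < 2j+1, for which \<open>pf_num\<close>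
  contributes a power of q. Passing from j to j + 2 shifts k by one, hence the induction in steps of
  two.\<close>

lemma sum_odd_minus_4k_2: "j \<le> n \<Longrightarrow> (\<Sum>k<n. (2 * j + 1) - (4 * k + 2)) = (Suc j choose 2)"
proof (induction j arbitrary: n rule: induct_nat_012)
  case (ge2 j)
  then obtain m where m: "n = Suc m" "j \<le> m" by (cases n) auto
  have "(\<Sum>k<n. (2 * Suc (Suc j) + 1) - (4 * k + 2)) = (2 * j + 3) + (\<Sum>k<m. (2 * j + 1) - (4 * k + 2))"
    unfolding m sum.lessThan_Suc_shift by simp
  then show ?case using ge2.IH(1)[OF m(2)] by (simp add: Suc_choose_2)
next
  case 1
  then obtain m where n: "n = Suc m" by (cases n) auto
  have "(\<Sum>k<m. (2 * Suc 0 + 1) - (4 * Suc k + 2)) = 0" by simp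
  then show ?case unfolding n sum.lessThan_Suc_shift by (simp add: Suc_choose_2)
qed simp

lemma sum_odd_minus_4k: "j < n \<Longrightarrow> (\<Sum>k<n. (2 * j + 1) - 4 * k) = (Suc (Suc j) choose 2)"
proof (induction j arbitrary: n rule: induct_nat_012)
  case (ge2 j)
  then obtain m where m: "n = Suc m" "j < m" by (cases n) auto
  have "(\<Sum>k<n. (2 * Suc (Suc j) + 1) - 4 * k) = (2 * j + 5) + (\<Sum>k<m. (2 * j + 1) - 4 * k)"
    unfolding m sum.lessThan_Suc_shift by simp
  then show ?case using ge2.IH(1)[OF m(2)] by (simp add: Suc_choose_2)
next
  case 0
  then obtain m where n: "n = Suc m" by (cases n) auto
  have "(\<Sum>k<m. (2 * 0 + 1) - 4 * Suc k) = 0" by simp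
  then show ?case unfolding n sum.lessThan_Suc_shift by (simp add: Suc_choose_2)
next
  case 1
  then obtain m where n: "n = Suc m" by (cases n) auto
  have "(\<Sum>k<m. (2 * Suc 0 + 1) - 4 * Suc k) = 0" by simp
  then show ?case unfolding n sum.lessThan_Suc_shift by (simp add: Suc_choose_2)
qed

lemma sum_even_minus_odd: "(m::nat) \<le> n \<Longrightarrow> (\<Sum>j<n. 2 * m - (2 * j + 1)) = m * m"
proof (induction m arbitrary: n)
  case (Suc m)
  then obtain n' where n: "n = Suc n'" "m \<le> n'" by (cases n) auto
  have "(\<Sum>j<n. 2 * Suc m - (2 * j + 1)) = (2 * m + 1) + (\<Sum>j<n'. 2 * m - (2 * j + 1))"
    unfolding n sum.lessThan_Suc_shift by simp
  then show ?case using Suc.IH[OF n(2)] by simp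
qed simp

lemma pf_num_opposite: "e * f = -1 \<Longrightarrow> pf_num (e, a) (f, b) = fps_X ^ (b - a)"
  by (simp add: pf_num_def flip: fps_const_neg)

lemma pf_gap_opposite: "e * f = -1 \<Longrightarrow>
    pf_gap (e, a) (f, b) = (1 + fps_X ^ (if a < b then b - a else a - b)) * (1 + fps_X ^ (a + b))"
  by (simp add: pf_gap_def flip: fps_const_neg)

lemma inverse_cong_mult:
  fixes f :: "complex fps"
  assumes "fps_cong K f g" "f $ 0 \<noteq> 0" "g $ 0 \<noteq> 0"
  shows "fps_cong K (h * inverse f) (h * inverse g)"
  using assms by (intro fps_cong_mult fps_cong_inverse) auto

text \<open>The exponents \<open>a\<close> and \<open>b\<close> enumerate the odd numbers without
  repetition: 2y+1 is a value of \<open>a\<close> if y + j is even or y < j, and a value of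
  \<open>b\<close> otherwise. What depends on j is only the power of q from the numerators.\<close>

lemma pf_coeff_opposite_2:
  assumes N: "K + j \<le> N"
  shows "fps_cong K (\<Prod>k<N. pf_num (-1, 4 * k + 2) (1, 2 * j + 1) * inverse (pf_gap (-1, 4 * k + 2) (1, 2 * j + 1)))
    (fps_X ^ (Suc j choose 2) * inverse odd_prod_inf)"
proof -
  define a where "a = (\<lambda>k. if 4 * k + 2 < 2 * j + 1 then 2 * j + 1 - (4 * k + 2) else 4 * k + 2 - (2 * j + 1))"
  define b where "b = (\<lambda>k. 4 * k + 2 + (2 * j + 1))"
  have gap: "pf_gap (-1, 4 * k + 2) (1, 2 * j + 1) = (1 + fps_X ^ a k) * (1 + fps_X ^ b k :: complex fps)" for k
    by (subst pf_gap_opposite) (simp_all only: a_def b_def mult_1_right)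
  have a: "a k + (4 * k + 2) = 2 * j + 1 \<or> a k + (2 * j + 1) = 4 * k + 2" for k
    by (cases "4 * k + 2 < 2 * j + 1") (simp_all add: a_def)
  have odd_a: "odd (a k)" for k
    by (rule disjE[OF a[of k]]; drule arg_cong[of _ _ even]; simp)
  have inja: "inj_on a {..<N}"
  proof (rule inj_onI)
    fix k l assume "a k = a l"
    then have "k = l \<or> 2 * k + 2 * l + 2 = 2 * j + 1" using a[of k] a[of l] by linarith
    moreover have "2 * k + 2 * l + 2 \<noteq> 2 * j + 1" by (rule notI, drule arg_cong[of _ _ even], simp)
    ultimately show "k = l" by blast
  qed
  have injb: "inj_on b {..<N}" by (auto simp: inj_on_def b_def)
  have disj: "a ` {..<N} \<inter> b ` {..<N} = {}"
  proof -
    have "a k \<noteq> b l" for k l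
    proof
      assume "a k = b l"
      then have "2 * k + 1 = 2 * l + 2 * j + 2 \<or> 4 * l + 4 * k + 4 = 0" using a[of k] unfolding b_def by linarith
      moreover have "2 * k + 1 \<noteq> 2 * l + 2 * j + 2" by (rule notI, drule arg_cong[of _ _ even], simp)
      ultimately show False by simp
    qed
    then show ?thesis by blast
  qed
  have "(\<Prod>k<N. pf_gap (-1, 4 * k + 2) (1, 2 * j + 1)) = (\<Prod>k<N. 1 + fps_X ^ a k) * (\<Prod>k<N. 1 + fps_X ^ b k :: complex fps)"
    by (simp only: gap prod.distrib)
  also have "\<dots> = (\<Prod>x\<in>a ` {..<N} \<union> b ` {..<N}. 1 + fps_X ^ x)"
    using inja injb disj by (subst prod.union_disjoint) (simp_all add: prod.reindex)
  finally have eq: "(\<Prod>k<N. pf_gap (-1, 4 * k + 2) (1, 2 * j + 1)) = (\<Prod>x\<in>a ` {..<N} \<union> b ` {..<N}. 1 + fps_X ^ x :: complex fps)" .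
  have "fps_cong K (\<Prod>k<N. pf_gap (-1, 4 * k + 2) (1, 2 * j + 1)) odd_prod_inf"
    unfolding eq
  proof (rule odd_set_prod_cong)
    show "odd x" if "x \<in> a ` {..<N} \<union> b ` {..<N}" for x
      using that odd_a by (auto simp: b_def)
    fix x assume x: "odd x" "x < K"
    obtain y where y: "x = 2 * y + 1" using x(1) by (rule oddE)
    have "x \<noteq> 2 * j" using x(1) by auto
    then have "x < 2 * j \<or> x > 2 * j" by linarith
    then consider "even (y + j)" | "odd (y + j)" "x < 2 * j" | "odd (y + j)" "x > 2 * j" by blast
    then show "x \<in> a ` {..<N} \<union> b ` {..<N}"
    proof cases
      case 1
      then obtain k where k: "y + j = 2 * k" by (rule evenE)
      have "x = a k" "k < N" using k y x N unfolding a_def by auto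
      then show ?thesis by blast
    next
      case 2
      have "y < j" using 2(2) y by linarith
      then obtain d where d: "j = Suc (y + d)" using less_imp_Suc_add by blast
      then have "even d" using 2(1) by (simp, blast)
      then obtain k where k: "j = y + 1 + 2 * k" using d by auto
      have "x = a k" "k < N" using k y x N unfolding a_def by auto
      then show ?thesis by blast
    next
      case 3
      have "y \<noteq> j" using 3(1) by auto
      then have "j < y" using 3(2) y by linarith
      then obtain d where d: "y = Suc (j + d)" using less_imp_Suc_add by blast
      then have "even d" using 3(1) by (simp, blast)
      then obtain k where k: "y = 2 * k + 1 + j" using d by auto
      have "x = b k" "k < N" using k y x N unfolding b_def by auto
      then show ?thesis by blast
    qed
  qed simp
  then have "fps_cong K (fps_X ^ (Suc j choose 2) * inverse (\<Prod>k<N. pf_gap (-1, 4 * k + 2) (1, 2 * j + 1)))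
      (fps_X ^ (Suc j choose 2) * inverse odd_prod_inf)"
  proof (rule inverse_cong_mult)
    have "a k > 0" for k using odd_a[of k] by (rule odd_pos)
    then show "(\<Prod>k<N. pf_gap (-1, 4 * k + 2) (1, 2 * j + 1) :: complex fps) $ 0 \<noteq> 0"
      unfolding fps_prod_nth_0 gap by (simp add: b_def)
  qed (simp add: odd_prod_inf_nth_0)
  moreover have "(\<Prod>k<N. pf_num (-1, 4 * k + 2) (1, 2 * j + 1)) = (fps_X ^ (Suc j choose 2) :: complex fps)"
    using sum_odd_minus_4k_2[of j N] N by (simp add: pf_num_opposite power_sum[symmetric])
  ultimately show ?thesis
    by (simp only: prod.distrib inverse_prod_fps[symmetric])
qed

text \<open>As for 4k+2, except that k = 0 yields a 0 = b 0 = 2j+1, so this odd number occurs twice.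
  The surplus factor 1 + q^(2j+1) later reduces 1 - q^(4j+2) to the 1 - q^(2j+1) of
  \<open>lambert_odd\<close>.\<close>

lemma pf_coeff_opposite_0:
  assumes N: "K + j < N"
  shows "fps_cong K (\<Prod>k<N. pf_num (-1, 4 * k) (1, 2 * j + 1) * inverse (pf_gap (-1, 4 * k) (1, 2 * j + 1)))
    (fps_X ^ (Suc (Suc j) choose 2) * inverse (odd_prod_inf * (1 + fps_X ^ (2 * j + 1))))"
proof -
  define a where "a = (\<lambda>k. if 4 * k < 2 * j + 1 then 2 * j + 1 - 4 * k else 4 * k - (2 * j + 1))"
  define b where "b = (\<lambda>k. 4 * k + (2 * j + 1))"
  have gap: "pf_gap (-1, 4 * k) (1, 2 * j + 1) = (1 + fps_X ^ a k) * (1 + fps_X ^ b k :: complex fps)" for k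
    by (subst pf_gap_opposite) (simp_all only: a_def b_def mult_1_right)
  have a: "a k + 4 * k = 2 * j + 1 \<or> a k + (2 * j + 1) = 4 * k" for k
    by (cases "4 * k < 2 * j + 1") (simp_all add: a_def)
  have odd_a: "odd (a k)" for k
    by (rule disjE[OF a[of k]]; drule arg_cong[of _ _ even]; simp)
  have inja: "inj_on a {..<N}"
  proof (rule inj_onI)
    fix k l assume "a k = a l"
    then have "k = l \<or> 2 * k + 2 * l = 2 * j + 1" using a[of k] a[of l] by linarith
    moreover have "2 * k + 2 * l \<noteq> 2 * j + 1" by (rule notI, drule arg_cong[of _ _ even], simp)
    ultimately show "k = l" by blast
  qed
  have injb: "inj_on b {1..<N}" by (auto simp: inj_on_def b_def)
  have disj: "a ` {..<N} \<inter> b ` {1..<N} = {}"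
  proof -
    have "a k \<noteq> b l" if "l \<ge> 1" for k l
    proof
      assume "a k = b l"
      then have "2 * k = 2 * l + 2 * j + 1 \<or> 4 * l + 4 * k = 0" using a[of k] unfolding b_def by linarith
      moreover have "2 * k \<noteq> 2 * l + 2 * j + 1" by (rule notI, drule arg_cong[of _ _ even], simp)
      ultimately show False using that by simp
    qed
    then show ?thesis by auto
  qed
  have N0: "{..<N} = insert 0 {1..<N}" using N by auto
  have bprod: "(\<Prod>k<N. 1 + fps_X ^ b k :: complex fps) = (1 + fps_X ^ (2 * j + 1)) * (\<Prod>k=1..<N. 1 + fps_X ^ b k)"
    unfolding N0 by (subst prod.insert) (simp_all add: b_def)
  have "(\<Prod>k<N. pf_gap (-1, 4 * k) (1, 2 * j + 1)) =
      ((\<Prod>k<N. 1 + fps_X ^ a k) * (\<Prod>k=1..<N. 1 + fps_X ^ b k :: complex fps)) * (1 + fps_X ^ (2 * j + 1))"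
    unfolding gap prod.distrib bprod by (simp only: mult_ac)
  also have "(\<Prod>k<N. 1 + fps_X ^ a k) * (\<Prod>k=1..<N. 1 + fps_X ^ b k :: complex fps)
      = (\<Prod>x\<in>a ` {..<N} \<union> b ` {1..<N}. 1 + fps_X ^ x)"
    using inja injb disj by (subst prod.union_disjoint) (simp_all add: prod.reindex)
  finally have eq: "(\<Prod>k<N. pf_gap (-1, 4 * k) (1, 2 * j + 1))
      = (\<Prod>x\<in>a ` {..<N} \<union> b ` {1..<N}. 1 + fps_X ^ x :: complex fps) * (1 + fps_X ^ (2 * j + 1))" .
  have "fps_cong K (\<Prod>k<N. pf_gap (-1, 4 * k) (1, 2 * j + 1)) (odd_prod_inf * (1 + fps_X ^ (2 * j + 1)))"
    unfolding eq
  proof (rule fps_cong_mult[OF odd_set_prod_cong fps_cong_refl])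
    show "odd x" if "x \<in> a ` {..<N} \<union> b ` {1..<N}" for x
      using that odd_a by (auto simp: b_def)
    fix x assume x: "odd x" "x < K"
    obtain y where y: "x = 2 * y + 1" using x(1) by (rule oddE)
    have "x \<le> 2 * j + 1 \<or> x > 2 * j + 1" by linarith
    then consider "odd (y + j)" | "even (y + j)" "x \<le> 2 * j + 1" | "even (y + j)" "x > 2 * j + 1" by blast
    then show "x \<in> a ` {..<N} \<union> b ` {1..<N}"
    proof cases
      case 1
      then have "even (y + j + 1)" by simp
      then obtain k where k: "y + j + 1 = 2 * k" by (rule evenE)
      have "x = a k" "k < N" using k y x N unfolding a_def by auto
      then show ?thesis by blast
    next
      case 2
      have "y \<le> j" using 2(2) y by linarith
      then obtain d where d: "j = y + d" using le_Suc_ex by blast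
      then have "even d" using 2(1) by (simp, blast)
      then obtain k where k: "j = y + 2 * k" using d by auto
      have "x = a k" "k < N" using k y x N unfolding a_def by auto
      then show ?thesis by blast
    next
      case 3
      have "j < y" using 3(2) y by linarith
      then obtain d where d: "y = Suc (j + d)" using less_imp_Suc_add by blast
      then have "odd d" using 3(1) by (simp, blast)
      then obtain k' where "d = 2 * k' + 1" by (rule oddE)
      then have "y = 2 * Suc k' + j" "Suc k' \<ge> 1" using d by simp_all
      then obtain k where k: "y = 2 * k + j" "k \<ge> 1" by blast
      have "x = b k" "k < N" using k y x N unfolding b_def by auto
      then show ?thesis using k(2) by auto
    qed
  qed simp
  then have "fps_cong K (fps_X ^ (Suc (Suc j) choose 2) * inverse (\<Prod>k<N. pf_gap (-1, 4 * k) (1, 2 * j + 1)))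
      (fps_X ^ (Suc (Suc j) choose 2) * inverse (odd_prod_inf * (1 + fps_X ^ (2 * j + 1))))"
  proof (rule inverse_cong_mult)
    have "a k > 0" for k using odd_a[of k] by (rule odd_pos)
    then show "(\<Prod>k<N. pf_gap (-1, 4 * k) (1, 2 * j + 1) :: complex fps) $ 0 \<noteq> 0"
      unfolding fps_prod_nth_0 gap by (simp add: b_def)
  qed (simp add: odd_prod_inf_nth_0)
  moreover have "(\<Prod>k<N. pf_num (-1, 4 * k) (1, 2 * j + 1)) = (fps_X ^ (Suc (Suc j) choose 2) :: complex fps)"
    using sum_odd_minus_4k[of j N] N by (simp add: pf_num_opposite power_sum[symmetric])
  ultimately show ?thesis
    by (simp only: prod.distrib inverse_prod_fps[symmetric])
qed

text \<open>Seen from the node 2m, the differences are 1, 3, ..., 2m-1 and 1, 3, ..., 2(N-m)-1,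
  while the sums start at 2m+1; the first list fills in below the sums. The numerators contribute
  the exponent 1 + 3 + ... + (2m-1) = m^2.\<close>

lemma pf_coeff_opposite_odd:
  assumes m: "m \<le> N"
  shows "(\<Prod>j<N. pf_num (1, 2 * j + 1) (-1, 2 * m) * inverse (pf_gap (1, 2 * j + 1) (-1, 2 * m)))
     = fps_X ^ (m * m) * inverse (odd_prod (N - m) * odd_prod (N + m))"
proof -
  define a where "a = (\<lambda>j. if 2 * j + 1 < 2 * m then 2 * m - (2 * j + 1) else 2 * j + 1 - 2 * m)"
  have gap: "pf_gap (1, 2 * j + 1) (-1, 2 * m) = (1 + fps_X ^ a j) * (1 + fps_X ^ (2 * j + 1 + 2 * m) :: complex fps)" for j
    by (subst pf_gap_opposite) (simp_all only: a_def mult_1_left)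
  have split: "{..<N} = {..<m} \<union> {m..<N}" using m by auto
  have "(\<Prod>j<N. 1 + fps_X ^ a j :: complex fps) = (\<Prod>j<m. 1 + fps_X ^ a j) * (\<Prod>j=m..<N. 1 + fps_X ^ a j)"
    unfolding split by (subst prod.union_disjoint) auto
  also have "(\<Prod>j<m. 1 + fps_X ^ a j :: complex fps) = odd_prod m"
    unfolding odd_prod_def
    by (rule prod.reindex_bij_witness[of _ "\<lambda>i. m - Suc i" "\<lambda>i. m - Suc i"])
      (auto simp: a_def intro!: arg_cong[of _ _ "\<lambda>n. fps_X ^ n"] simp del: power_Suc)
  also have "(\<Prod>j=m..<N. 1 + fps_X ^ a j :: complex fps) = odd_prod (N - m)"
    unfolding odd_prod_def
    by (rule prod.reindex_bij_witness[of _ "\<lambda>i. i + m" "\<lambda>i. i - m"])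
      (auto simp: a_def intro!: arg_cong[of _ _ "\<lambda>n. fps_X ^ n"] simp del: power_Suc)
  finally have 1: "(\<Prod>j<N. 1 + fps_X ^ a j :: complex fps) = odd_prod m * odd_prod (N - m)" .
  have 2: "odd_prod m * (\<Prod>j<n. 1 + fps_X ^ (2 * j + 1 + 2 * m)) = odd_prod (n + m)" for n
  proof (induction n)
    case (Suc n)
    have e: "2 * n + 1 + 2 * m = 2 * (n + m) + 1" by simp
    show ?case using Suc by (simp only: odd_prod_def add_Suc prod.lessThan_Suc mult.assoc[symmetric] e)
  qed simp
  have "(\<Prod>j<N. pf_gap (1, 2 * j + 1) (-1, 2 * m)) = odd_prod (N - m) * odd_prod (N + m)"
    unfolding gap prod.distrib 1 2[symmetric] by (simp only: mult_ac)
  moreover have "(\<Prod>j<N. pf_num (1, 2 * j + 1) (-1, 2 * m)) = (fps_X ^ (m * m) :: complex fps)"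
    using sum_even_minus_odd[OF m] by (simp add: pf_num_opposite power_sum[symmetric])
  ultimately show ?thesis
    by (simp only: prod.distrib inverse_prod_fps[symmetric])
qed

text \<open>Within the second family all differences and sums of exponents are multiples of 4; this
  is what confines the mock part to few residue classes of exponents.\<close>

lemma pf_coeff_even_dil:
  "\<exists>g. (\<Prod>l\<in>A. pf_num (-1, 4 * l + 2 * c) (-1, 4 * k + 2 * c)
     * inverse (pf_gap (-1, 4 * l + 2 * c) (-1, 4 * k + 2 * c))) = fps_dil 4 (g :: complex fps)"
proof
  have num: "pf_num (-1, 4 * l + 2 * c) (-1, 4 * k + 2 * c) =
      fps_dil 4 (if l < k then - (fps_X ^ (k - l)) else 1 :: complex fps)" for l
    by (simp add: pf_num_def fps_dil_uminus fps_dil_X_power diff_mult_distrib2)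
  have gap: "pf_gap (-1, 4 * l + 2 * c) (-1, 4 * k + 2 * c) =
      fps_dil 4 ((1 - fps_X ^ (if l < k then k - l else l - k)) * (1 - fps_X ^ (l + k + c)) :: complex fps)" for l
  proof -
    have "4 * l + 2 * c + (4 * k + 2 * c) = 4 * (l + k + c)" by simp
    then show ?thesis
      by (simp add: pf_gap_def fps_dil_diff fps_dil_mult fps_dil_X_power diff_mult_distrib2)
  qed
  show "(\<Prod>l\<in>A. pf_num (-1, 4 * l + 2 * c) (-1, 4 * k + 2 * c)
     * inverse (pf_gap (-1, 4 * l + 2 * c) (-1, 4 * k + 2 * c))) =
     fps_dil 4 (\<Prod>l\<in>A. (if l < k then - (fps_X ^ (k - l)) else (1 :: complex fps)) *
       inverse ((1 - fps_X ^ (if l < k then k - l else l - k)) * (1 - fps_X ^ (l + k + c))))"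
    unfolding fps_dil_prod[OF zero_less_numeral]
    by (intro prod.cong refl) (simp only: num gap fps_dil_mult[OF zero_less_numeral] fps_dil_inverse[OF zero_less_numeral])
qed

text \<open>Applied with c = 2 and c = 0. For c = 0 the denominator with k = 0 is the constant 2 +
  t, which must be invertible.\<close>

lemma partial_fractions_two_families:
  fixes t :: complex
  assumes N: "N > 0" and unit: "c > 0 \<or> t \<noteq> -2"
  shows "inverse ((\<Prod>j<N. pf_den t (1, 2 * j + 1)) * (\<Prod>k<N. pf_den t (-1, 4 * k + c))) =
    (\<Sum>j<N. (\<Prod>i\<in>{..<N} - {j}. pf_num (1, 2 * i + 1) (1, 2 * j + 1) * inverse (pf_gap (1, 2 * i + 1) (1, 2 * j + 1)))
       * (\<Prod>k<N. pf_num (-1, 4 * k + c) (1, 2 * j + 1) * inverse (pf_gap (-1, 4 * k + c) (1, 2 * j + 1)))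
       * inverse (pf_den t (1, 2 * j + 1))) +
    (\<Sum>k<N. (\<Prod>l\<in>{..<N} - {k}. pf_num (-1, 4 * l + c) (-1, 4 * k + c) * inverse (pf_gap (-1, 4 * l + c) (-1, 4 * k + c)))
       * (\<Prod>j<N. pf_num (1, 2 * j + 1) (-1, 4 * k + c) * inverse (pf_gap (1, 2 * j + 1) (-1, 4 * k + c)))
       * inverse (pf_den t (-1, 4 * k + c)))"
proof -
  define h where "h = (\<lambda>j::nat. (1 :: complex, 2 * j + 1))"
  define g where "g = (\<lambda>k::nat. (-1 :: complex, 4 * k + c))"
  define I where "I = h ` {..<N} \<union> g ` {..<N}"
  have inj: "inj_on h A" "inj_on g A" for A by (auto simp: h_def g_def inj_on_def)
  have hg: "h i \<noteq> g j" for i j by (simp add: h_def g_def)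
  have disj: "h ` A \<inter> g ` B = {}" for A B by (auto simp: h_def g_def)
  have pI: "(\<Prod>p\<in>h ` A \<union> g ` B. F p) = (\<Prod>j\<in>A. F (h j)) * (\<Prod>k\<in>B. F (g k))" if "finite A" "finite B"
    for A B and F :: "complex \<times> nat \<Rightarrow> complex fps"
    using that disj by (subst prod.union_disjoint) (auto simp: prod.reindex inj)
  have "pf_den t p $ 0 \<noteq> 0" if "p \<in> I" for p
  proof -
    have "t \<noteq> -2 \<longleftrightarrow> - t \<noteq> 2" by (metis minus_minus)
    then show ?thesis using that unit by (auto simp: I_def h_def g_def pf_den_def algebra_simps)
  qed
  then have "inverse (\<Prod>p\<in>I. pf_den t p) =
    (\<Sum>r\<in>I. (\<Prod>p\<in>I - {r}. pf_num p r * inverse (pf_gap p r)) * inverse (pf_den t r))"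
    using N by (intro partial_fractions_fps) (auto simp: I_def h_def g_def)
  also have "\<dots> = (\<Sum>j<N. (\<Prod>p\<in>I - {h j}. pf_num p (h j) * inverse (pf_gap p (h j))) * inverse (pf_den t (h j)))
      + (\<Sum>k<N. (\<Prod>p\<in>I - {g k}. pf_num p (g k) * inverse (pf_gap p (g k))) * inverse (pf_den t (g k)))"
    unfolding I_def using disj by (subst sum.union_disjoint) (auto simp: sum.reindex inj)
  finally have E: "inverse (\<Prod>p\<in>I. pf_den t p) = (\<Sum>j<N. (\<Prod>p\<in>I - {h j}. pf_num p (h j) * inverse (pf_gap p (h j))) * inverse (pf_den t (h j)))
      + (\<Sum>k<N. (\<Prod>p\<in>I - {g k}. pf_num p (g k) * inverse (pf_gap p (g k))) * inverse (pf_den t (g k)))" .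
  have Ih: "I - {h j} = h ` ({..<N} - {j}) \<union> g ` {..<N}" for j
    by (auto simp: I_def h_def g_def)
  have Ig: "I - {g k} = h ` {..<N} \<union> g ` ({..<N} - {k})" for k
    by (auto simp: I_def h_def g_def)
  have "inverse ((\<Prod>j<N. pf_den t (h j)) * (\<Prod>k<N. pf_den t (g k))) =
     (\<Sum>j<N. (\<Prod>i\<in>{..<N} - {j}. pf_num (h i) (h j) * inverse (pf_gap (h i) (h j)))
       * (\<Prod>k<N. pf_num (g k) (h j) * inverse (pf_gap (g k) (h j))) * inverse (pf_den t (h j))) +
     (\<Sum>k<N. (\<Prod>l\<in>{..<N} - {k}. pf_num (g l) (g k) * inverse (pf_gap (g l) (g k)))
       * (\<Prod>j<N. pf_num (h j) (g k) * inverse (pf_gap (h j) (g k))) * inverse (pf_den t (g k)))"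
  proof -
    have "(\<Prod>p\<in>I. pf_den t p) = (\<Prod>j<N. pf_den t (h j)) * (\<Prod>k<N. pf_den t (g k))"
      unfolding I_def by (rule pI) auto
    then show ?thesis
      using E unfolding Ih Ig by (simp add: pI mult_ac)
  qed
  then show ?thesis unfolding h_def g_def .
qed

section \<open>Euler products and the normalising factor\<close>

definition euler_prod :: "nat \<Rightarrow> complex fps" where
  "euler_prod k = fps_dil k (qpoch_inf fps_X)"

lemma fps_dil_euler_prod: "k > 0 \<Longrightarrow> l > 0 \<Longrightarrow> fps_dil k (euler_prod l) = euler_prod (k * l)"
  by (simp add: euler_prod_def fps_dil_dil)

lemma euler_prod_nth_0 [simp]: "euler_prod k $ 0 = 1"
  by (simp add: euler_prod_def qpoch_inf_nth_0)

lemma euler_prod_1: "euler_prod 1 = qpoch_inf fps_X"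
  by (simp add: euler_prod_def)

lemma euler_prod_eq: "k > 0 \<Longrightarrow> euler_prod k = qpoch_inf (fps_X ^ k)"
  by (simp add: euler_prod_def qpoch_inf_X_power)

definition odd_diff_inf :: "complex fps" where
  "odd_diff_inf = fps_iprod (\<lambda>i. 1 - fps_X ^ (2 * i + 1))"

lemma fps_cong_one_minus_X_power': "K \<le> e \<Longrightarrow> fps_cong K (1 - fps_X ^ e) 1"
  using fps_cong_one_minus_X_power[of K e 1] by simp

lemma odd_diff_cong: "K \<le> N \<Longrightarrow> fps_cong K odd_diff_inf (\<Prod>i<N. 1 - fps_X ^ (2 * i + 1))"
  unfolding odd_diff_inf_def
  by (intro fps_iprod_cong fps_cong_one_minus_X_power'; linarith)

lemma odd_diff_inf_nth_0 [simp]: "odd_diff_inf $ 0 = 1"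
  using odd_diff_cong[of 1 1] by (simp add: fps_cong_def)

declare odd_prod_inf_nth_0 [simp]

lemma odd_diff_mult_euler: "odd_diff_inf * euler_prod 2 = euler_prod 1"
proof (rule fps_cong_eqI)
  fix K
  have "fps_cong K (odd_diff_inf * euler_prod 2) ((\<Prod>i<K. 1 - fps_X ^ (2 * i + 1)) * qpoch (fps_X ^ 2) K)"
    by (intro fps_cong_mult odd_diff_cong) (simp_all add: euler_prod_eq fps_cong_sym[OF qpoch_cong])
  also have "(\<Prod>i<n. 1 - fps_X ^ (2 * i + 1)) * qpoch (fps_X ^ 2) n = qpoch (fps_X :: complex fps) (2 * n)" for n
  proof (induction n)
    case (Suc n)
    have "qpoch (fps_X :: complex fps) (2 * Suc n) = qpoch fps_X (2 * n) * (1 - fps_X ^ (2 * n + 1)) * (1 - fps_X ^ (2 * Suc n))"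
      by (simp add: qpoch_Suc)
    then show ?case unfolding Suc[symmetric] qpoch_Suc prod.lessThan_Suc power_mult[symmetric] by (simp only: mult_ac)
  qed simp
  also have "fps_cong K (qpoch (fps_X :: complex fps) (2 * K)) (euler_prod 1)"
    unfolding euler_prod_1 by (rule qpoch_cong) simp_all
  finally show "fps_cong K (odd_diff_inf * euler_prod 2) (euler_prod 1)" .
qed

lemma fps_dil_odd_diff: "k > 0 \<Longrightarrow> fps_dil k odd_diff_inf = fps_iprod (\<lambda>i. 1 - fps_X ^ (k * (2 * i + 1)))"
  unfolding odd_diff_inf_def
proof (subst fps_dil_iprod)
  show "fps_cong (Suc j) (1 - fps_X ^ (2 * j + 1) :: complex fps) 1" for j
    by (rule fps_cong_one_minus_X_power') simp
qed (simp_all only: fps_dil_diff fps_dil_1 fps_dil_X_power)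

lemma fps_dil_odd_prod: "k > 0 \<Longrightarrow> fps_dil k odd_prod_inf = fps_iprod (\<lambda>i. 1 + fps_X ^ (k * (2 * i + 1)))"
  unfolding odd_prod_inf_def
proof (subst fps_dil_iprod)
  show "fps_cong (Suc j) (1 + fps_X ^ (2 * j + 1) :: complex fps) 1" for j
    by (rule fps_cong_one_plus_X_power') simp
qed (simp_all only: fps_dil_add fps_dil_1 fps_dil_X_power)

lemma fps_iprod_mult:
  assumes "\<And>j. fps_cong (Suc j) (f j) 1" "\<And>j. fps_cong (Suc j) (g j) 1"
  shows "fps_iprod f * fps_iprod g = fps_iprod (\<lambda>j. f j * g j)"
proof (rule fps_cong_eqI)
  fix K
  have fg: "fps_cong (Suc j) (f j * g j) 1" for j
    using fps_cong_mult[OF assms[of j]] by simp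
  have "fps_cong K (fps_iprod f * fps_iprod g) ((\<Prod>j<K. f j) * (\<Prod>j<K. g j))"
    by (intro fps_cong_mult fps_iprod_cong assms) auto
  also have "(\<Prod>j<K. f j) * (\<Prod>j<K. g j) = (\<Prod>j<K. f j * g j)"
    by (simp add: prod.distrib)
  also have "fps_cong K \<dots> (fps_iprod (\<lambda>j. f j * g j))"
    by (intro fps_cong_sym[OF fps_iprod_cong] fg) auto
  finally show "fps_cong K (fps_iprod f * fps_iprod g) (fps_iprod (\<lambda>j. f j * g j))" .
qed

lemma odd_diff_mult_odd_prod: "odd_diff_inf * odd_prod_inf = fps_dil 2 odd_diff_inf"
proof -
  have "odd_diff_inf * odd_prod_inf = fps_iprod (\<lambda>j. (1 - fps_X ^ (2 * j + 1)) * (1 + fps_X ^ (2 * j + 1)))"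
    unfolding odd_diff_inf_def odd_prod_inf_def
    by (rule fps_iprod_mult; rule fps_cong_one_minus_X_power' fps_cong_one_plus_X_power'; simp)
  also have "(\<lambda>j. (1 - fps_X ^ (2 * j + 1)) * (1 + fps_X ^ (2 * j + 1)) :: complex fps) = (\<lambda>j. 1 - fps_X ^ (2 * (2 * j + 1)))"
    unfolding mult_2[of "2 * _ + 1"] power_add[of _ "2 * _ + 1" "2 * _ + 1"] by (simp add: algebra_simps)
  finally show ?thesis by (simp add: fps_dil_odd_diff)
qed

text \<open>Comes from (q; q^2) (-q; q^2) = (q^2; q^4) after rewriting the outer two products by
  Euler products.\<close>

lemma euler_mult_odd_prod: "euler_prod 1 * euler_prod 4 * odd_prod_inf = euler_prod 2 * euler_prod 2"
proof -
  have "fps_dil 2 (odd_diff_inf * euler_prod 2) = fps_dil 2 (euler_prod 1)"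
    by (simp only: odd_diff_mult_euler)
  then have *: "fps_dil 2 odd_diff_inf * euler_prod 4 = euler_prod 2"
    by (simp add: fps_dil_mult fps_dil_euler_prod)
  have "euler_prod 1 * euler_prod 4 * odd_prod_inf = (odd_diff_inf * odd_prod_inf) * euler_prod 4 * euler_prod 2"
    unfolding odd_diff_mult_euler[symmetric] by (simp only: mult_ac)
  then show ?thesis unfolding odd_diff_mult_odd_prod * .
qed

text \<open>Chosen so that the first family of poles comes out with the factor 1/J 1 of the Lambert
  series, as \<open>theta_const_eq\<close> shows; at the second family the square of
  \<open>odd_prod_inf\<close> cancels completely.\<close>

definition theta_const :: "complex fps" where
  "theta_const = euler_prod 4 * (odd_prod_inf * odd_prod_inf)"

lemma theta_const_eq: "theta_const * (inverse (euler_prod 2 * euler_prod 2) * inverse odd_prod_inf) = inverse (qpoch_inf fps_X)"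
proof -
  have V: "odd_prod_inf * inverse odd_prod_inf = 1" and E: "euler_prod 4 * inverse (euler_prod 4) = 1"
    by (auto intro!: inverse_mult_eq_1')
  have "theta_const * (inverse (euler_prod 2 * euler_prod 2) * inverse odd_prod_inf) =
     (euler_prod 4 * inverse (euler_prod 4)) * ((odd_prod_inf * inverse odd_prod_inf) * (odd_prod_inf * inverse odd_prod_inf))
       * inverse (euler_prod 1)"
    unfolding theta_const_def euler_mult_odd_prod[symmetric] fps_inverse_mult by (simp only: mult_ac)
  then show ?thesis by (simp only: V E mult_1_left euler_prod_1)
qed

lemma pf_den_cong: "K \<le> m \<Longrightarrow> fps_cong K (pf_den t (e, m)) 1"
proof -
  assume K: "K \<le> m"
  have "fps_cong K (1 - fps_const (e * t) * fps_X ^ m + fps_X ^ (2 * m) * 1) (1 + 0)"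
    by (intro fps_cong_add fps_cong_one_minus_X_power fps_cong_X_power_0) (use K in auto)
  then show ?thesis by (simp add: pf_den_def)
qed

definition theta_even :: "complex \<Rightarrow> complex fps" where
  "theta_even t = theta_const * inverse (fps_iprod (\<lambda>j. pf_den t (1, 2 * j + 1)) * fps_iprod (\<lambda>k. pf_den t (-1, 4 * k + 2)))"

text \<open>The constant 2 + t is the k = 0 member of the family 4k. It stands apart because it is
  not of the form 1 + O(q) required in an infinite product.\<close>

definition theta_odd :: "complex \<Rightarrow> complex fps" where
  "theta_odd t = theta_const * inverse (fps_iprod (\<lambda>j. pf_den t (1, 2 * j + 1)) *
     (fps_const (2 + t) * fps_iprod (\<lambda>k. pf_den t (-1, 4 * k + 4))))"

lemma fps_iprod_nth_0: "fps_iprod f $ 0 = f 0 $ 0"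
  by (simp add: fps_iprod_def)

text \<open>For j < K the bound on N makes both Pochhammer symbols complete below q^K; for j >= K
  the power of q alone reaches that order.\<close>

lemma pf_coeff_self_cong:
  assumes "2 * K < N" "j < N"
  shows "fps_cong K (\<Prod>i\<in>{..<N} - {j}. pf_num (1, 2 * i + 1) (1, 2 * j + 1) * inverse (pf_gap (1, 2 * i + 1) (1, 2 * j + 1)))
    (fps_X ^ (2 * (Suc j choose 2)) * ((-1) ^ j * (1 - fps_X ^ (4 * j + 2)) * inverse (euler_prod 2 * euler_prod 2)))"
proof -
  define p where "p = (fps_X ^ 2 :: complex fps)"
  have p0: "p $ 0 = 0" by (simp add: p_def)
  define m where "m = (-1) ^ j * (1 - fps_X ^ (4 * j + 2) :: complex fps)"
  have e1: "(1::complex) * 1 = 1" by simp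
  note * = pf_coeff_arith[of 1 j N "1::complex", OF zero_less_one assms(2) e1, unfolded mult_1_left mult_1_right]
  have "4 * j + 2 = 2 * (2 * j + 1)" by simp
  then have eq: "(\<Prod>i\<in>{..<N} - {j}. pf_num (1, 2 * i + 1) (1, 2 * j + 1) * inverse (pf_gap (1, 2 * i + 1) (1, 2 * j + 1))) =
      fps_X ^ (2 * (Suc j choose 2)) * (m * inverse (qpoch p (N - 1 - j) * qpoch p (N + j)))"
    unfolding m_def p_def by (simp only: * power_mult)
  show ?thesis
  proof (cases "j < K")
    case True
    have "fps_cong K (qpoch p (N - 1 - j) * qpoch p (N + j)) (euler_prod 2 * euler_prod 2)"
      unfolding euler_prod_eq[OF zero_less_numeral] p_def[symmetric]
      using assms True by (intro fps_cong_mult qpoch_cong p0) auto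
    then have "fps_cong K (fps_X ^ (2 * (Suc j choose 2)) * (m * inverse (qpoch p (N - 1 - j) * qpoch p (N + j))))
        (fps_X ^ (2 * (Suc j choose 2)) * (m * inverse (euler_prod 2 * euler_prod 2)))"
      by (intro fps_cong_mult[OF fps_cong_refl] inverse_cong_mult) (simp_all add: qpoch_nth_0 p0)
    then show ?thesis unfolding eq unfolding m_def .
  next
    case False
    then have le: "K \<le> 2 * (Suc j choose 2)" using choose_2_ge[of j] by linarith
    show ?thesis unfolding eq
      by (rule fps_cong_trans[OF fps_cong_X_power_0[OF le] fps_cong_sym[OF fps_cong_X_power_0[OF le]]])
  qed
qed

lemma fps_cong_eq_diff: "fps_cong K (f + g) h \<Longrightarrow> fps_cong K f (h - g)"
  by (simp add: fps_cong_def eq_diff_eq)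

text \<open>Expand a finite version of \<open>theta_even\<close> at both families. The first
  reproduces \<open>lambert_even\<close>, the exponents j(j+1) and j(j+1)/2 adding up. At -q^(4k+2)
  the cofactor is q^((2k+1)^2) times a series in q^4, and (2k+1)^2 = 4k(k+1) + 1, so this part is q
  times a series in q^2. The quantifiers put \<open>g\<close> before \<open>t\<close> because the
  mock parts at t = 2 and t = -2 are to be compared.\<close>

lemma lambert_even_eq_theta:
  "\<exists>g. \<forall>t. fps_cong K (lambert_even t) (theta_even t -
     fps_X * fps_dil 2 (\<Sum>k<K. fps_dil 2 (g k) * inverse (pf_den t (-1, 2 * k + 1))))"
proof -
  \<comment> \<open>Large enough that N-1-j, N-j and N-(2k+1) are at least K for all j, k < K, so
    every finite product may be completed modulo q^K.\<close>
  define N where "N = 3 * K + 2"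
  define A where "A = (\<lambda>j. \<Prod>i\<in>{..<N} - {j}. pf_num (1::complex, 2 * i + 1) (1, 2 * j + 1) * inverse (pf_gap (1, 2 * i + 1) (1, 2 * j + 1)))"
  define B where "B = (\<lambda>j. \<Prod>k<N. pf_num (-1::complex, 4 * k + 2) (1, 2 * j + 1) * inverse (pf_gap (-1, 4 * k + 2) (1, 2 * j + 1)))"
  define S where "S = (\<lambda>k. \<Prod>l\<in>{..<N} - {k}. pf_num (-1::complex, 4 * l + 2) (-1, 4 * k + 2) * inverse (pf_gap (-1, 4 * l + 2) (-1, 4 * k + 2)))"
  define M where "M = (\<lambda>k. \<Prod>j<N. pf_num (1::complex, 2 * j + 1) (-1, 4 * k + 2) * inverse (pf_gap (1, 2 * j + 1) (-1, 4 * k + 2)))"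
  have "\<exists>g. S k = fps_dil 4 g" for k
    using pf_coeff_even_dil[of 1 k "{..<N} - {k}"] by (simp only: S_def mult_1_right)
  then obtain g0 where g0: "\<And>k. S k = fps_dil 4 (g0 k)" by metis
  \<comment> \<open>All exponents divided by 4: q^(4k(k+1)), \<open>S k\<close> and the factor
    \<open>euler_prod 4\<close> of \<open>theta_const\<close> are series in q^4.\<close>
  define g where "g = (\<lambda>k. fps_X ^ (k * (k + 1)) * (euler_prod 1 * g0 k))"
  have g: "fps_X * fps_dil 2 (fps_dil 2 (g k)) = euler_prod 4 * (S k * fps_X ^ ((2 * k + 1) * (2 * k + 1)))" for k
  proof -
    have "fps_dil 2 (fps_dil 2 (g k)) = fps_X ^ (4 * (k * (k + 1))) * (euler_prod 4 * S k)"
      unfolding g_def g0 by (simp add: fps_dil_dil fps_dil_mult fps_dil_X_power fps_dil_euler_prod)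
    moreover have "(2 * k + 1) * (2 * k + 1) = Suc (4 * (k * (k + 1)))" by simp
    ultimately show ?thesis by (simp only: power_Suc mult_ac)
  qed
  have "fps_cong K (lambert_even t) (theta_even t -
     fps_X * fps_dil 2 (\<Sum>k<K. fps_dil 2 (g k) * inverse (pf_den t (-1, 2 * k + 1))))" for t
  proof -
    define D1 where "D1 = (\<lambda>j. pf_den t (1, 2 * j + 1))"
    define D2 where "D2 = (\<lambda>k. pf_den t (-1, 4 * k + 2))"
    have u: "D1 j $ 0 = 1" "D2 j $ 0 = 1" for j by (simp_all add: D1_def D2_def pf_den_def)
    have "fps_cong K (theta_const * inverse ((\<Prod>j<N. D1 j) * (\<Prod>k<N. D2 k))) (theta_even t)"
      unfolding theta_even_def D1_def[symmetric] D2_def[symmetric]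
    proof (rule inverse_cong_mult)
      show "fps_cong K ((\<Prod>j<N. D1 j) * (\<Prod>k<N. D2 k)) (fps_iprod D1 * fps_iprod D2)"
        unfolding D1_def D2_def
        by (intro fps_cong_mult fps_cong_sym[OF fps_iprod_cong] pf_den_cong) (auto simp: N_def)
    qed (simp_all add: fps_prod_nth_0 fps_iprod_nth_0 u)
    moreover have "inverse ((\<Prod>j<N. D1 j) * (\<Prod>k<N. D2 k)) =
        (\<Sum>j<N. A j * B j * inverse (D1 j)) + (\<Sum>k<N. S k * M k * inverse (D2 k))"
      unfolding A_def B_def S_def M_def D1_def D2_def
      by (rule partial_fractions_two_families) (auto simp: N_def)
    ultimately have sum: "fps_cong K ((\<Sum>j<N. theta_const * (A j * B j * inverse (D1 j)))
        + (\<Sum>k<N. theta_const * (S k * M k * inverse (D2 k)))) (theta_even t)"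
      by (simp only: distrib_left sum_distrib_left)
    have "fps_cong K (\<Sum>j<N. theta_const * (A j * B j * inverse (D1 j))) (lambert_even t)"
    proof -
      define f where "f = (\<lambda>j. fps_X ^ (3 * (Suc j choose 2)) * ((-1) ^ j * (1 - fps_X ^ (4 * j + 2)) * inverse (D1 j)))"
      have "fps_cong K (\<Sum>j<N. theta_const * (A j * B j * inverse (D1 j)))
          (\<Sum>j<K. theta_const * (A j * B j * inverse (D1 j)))"
      proof (rule fps_cong_subset_sum)
        show "{..<K} \<subseteq> {..<N}" by (auto simp: N_def)
        fix j assume j: "j \<in> {..<N} - {..<K}"
        have "fps_cong K (A j) (fps_X ^ (2 * (Suc j choose 2)) * ((-1) ^ j * (1 - fps_X ^ (4 * j + 2)) * inverse (euler_prod 2 * euler_prod 2)))"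
          unfolding A_def using j by (intro pf_coeff_self_cong) (auto simp: N_def)
        also have "fps_cong K \<dots> 0"
          using j choose_2_ge[of j] by (intro fps_cong_X_power_0) auto
        finally have "fps_cong K (theta_const * (A j * B j * inverse (D1 j))) (theta_const * (0 * B j * inverse (D1 j)))"
          by (intro fps_cong_mult fps_cong_refl)
        then show "fps_cong K (theta_const * (A j * B j * inverse (D1 j))) 0" by simp
      qed simp
      also have "fps_cong K \<dots> (\<Sum>j<K. inverse (qpoch_inf fps_X) * f j)"
      proof (rule fps_cong_sum)
        fix j assume j: "j \<in> {..<K}"
        define m where "m = (-1) ^ j * (1 - fps_X ^ (4 * j + 2) :: complex fps)"
        have "fps_cong K (theta_const * (A j * B j * inverse (D1 j))) (theta_const *
           (fps_X ^ (2 * (Suc j choose 2)) * (m * inverse (euler_prod 2 * euler_prod 2)) * (fps_X ^ (Suc j choose 2) * inverse odd_prod_inf) * inverse (D1 j)))"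
          unfolding A_def B_def m_def using j
          by (intro fps_cong_mult fps_cong_refl pf_coeff_self_cong pf_coeff_opposite_2) (auto simp: N_def)
        also have "\<dots> = theta_const * (inverse (euler_prod 2 * euler_prod 2) * inverse odd_prod_inf) *
            (fps_X ^ (2 * (Suc j choose 2)) * fps_X ^ (Suc j choose 2) * (m * inverse (D1 j)))"
          by (simp only: mult_ac)
        also have "fps_X ^ (2 * (Suc j choose 2)) * fps_X ^ (Suc j choose 2) = (fps_X ^ (3 * (Suc j choose 2)) :: complex fps)"
          unfolding power_add[symmetric] by simp
        finally show "fps_cong K (theta_const * (A j * B j * inverse (D1 j))) (inverse (qpoch_inf fps_X) * f j)"
          unfolding theta_const_eq f_def m_def .
      qed
      also have "(\<Sum>j<K. inverse (qpoch_inf fps_X) * f j) = inverse (qpoch_inf fps_X) * (\<Sum>j<K. f j)"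
        by (rule sum_distrib_left[symmetric])
      also have "fps_cong K \<dots> (inverse (qpoch_inf fps_X) * fps_isum f)"
      proof (intro fps_cong_mult fps_cong_refl fps_cong_sym[OF fps_isum_cong])
        show "fps_cong j (f j) 0" for j
          unfolding f_def using choose_2_ge[of j] by (intro fps_cong_X_power_0) linarith
      qed simp
      also have "inverse (qpoch_inf fps_X) * fps_isum f = lambert_even t"
        by (simp only: lambert_even_def f_def D1_def)
      finally show ?thesis .
    qed
    moreover have "fps_cong K (\<Sum>k<N. theta_const * (S k * M k * inverse (D2 k)))
        (fps_X * fps_dil 2 (\<Sum>k<K. fps_dil 2 (g k) * inverse (pf_den t (-1, 2 * k + 1))))"
    proof -
      have M: "M k = fps_X ^ ((2 * k + 1) * (2 * k + 1)) * inverse (odd_prod (N - (2 * k + 1)) * odd_prod (N + (2 * k + 1)))"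
        if "2 * k + 1 \<le> N" for k
      proof -
        have "4 * k + 2 = 2 * (2 * k + 1)" by simp
        then show ?thesis unfolding M_def by (simp only: pf_coeff_opposite_odd[OF that])
      qed
      \<comment> \<open>The numerator with j = 0 already contributes the exponent 4k+1. This also
        covers the k with 2k+1 > N, to which the closed form \<open>M\<close> does not
        apply.\<close>
      have M0: "fps_cong K (M k) 0" if k: "K \<le> k" for k
      proof -
        have "(\<Prod>j<N. pf_num (1, 2 * j + 1) (-1, 4 * k + 2)) = (fps_X ^ (\<Sum>j<N. 4 * k + 2 - (2 * j + 1)) :: complex fps)"
          by (simp add: pf_num_opposite power_sum)
        then have "M k = fps_X ^ (\<Sum>j<N. 4 * k + 2 - (2 * j + 1)) * (\<Prod>j<N. inverse (pf_gap (1, 2 * j + 1) (-1, 4 * k + 2)))"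
          unfolding M_def prod.distrib by (simp only:)
        moreover have "K \<le> (\<Sum>j<N. 4 * k + 2 - (2 * j + 1))"
        proof -
          have "4 * k + 2 - (2 * 0 + 1) \<le> (\<Sum>j<N. 4 * k + 2 - (2 * j + 1))"
            by (rule member_le_sum) (auto simp: N_def)
          then show ?thesis using k by simp
        qed
        ultimately show ?thesis by (simp only: fps_cong_X_power_0)
      qed
      have "fps_cong K (\<Sum>k<N. theta_const * (S k * M k * inverse (D2 k))) (\<Sum>k<K. theta_const * (S k * M k * inverse (D2 k)))"
      proof (rule fps_cong_subset_sum)
        show "{..<K} \<subseteq> {..<N}" by (auto simp: N_def)
        fix k assume k: "k \<in> {..<N} - {..<K}"
        have "fps_cong K (theta_const * (S k * M k * inverse (D2 k))) (theta_const * (S k * 0 * inverse (D2 k)))"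
          using k by (intro fps_cong_mult fps_cong_refl M0) auto
        then show "fps_cong K (theta_const * (S k * M k * inverse (D2 k))) 0" by simp
      qed simp
      also have "fps_cong K \<dots> (\<Sum>k<K. fps_X * fps_dil 2 (fps_dil 2 (g k)) * inverse (D2 k))"
      proof (rule fps_cong_sum)
        fix k assume k: "k \<in> {..<K}"
        have le: "2 * k + 1 \<le> N" using k by (auto simp: N_def)
        have "fps_cong K (fps_X ^ ((2 * k + 1) * (2 * k + 1)) * inverse (odd_prod (N - (2 * k + 1)) * odd_prod (N + (2 * k + 1))))
           (fps_X ^ ((2 * k + 1) * (2 * k + 1)) * inverse (odd_prod_inf * odd_prod_inf))"
          using k by (intro inverse_cong_mult fps_cong_mult odd_prod_cong) (auto simp: N_def odd_prod_nth_0)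
        then have "fps_cong K (theta_const * (S k * M k * inverse (D2 k)))
            (theta_const * (S k * (fps_X ^ ((2 * k + 1) * (2 * k + 1)) * inverse (odd_prod_inf * odd_prod_inf)) * inverse (D2 k)))"
          unfolding M[OF le]
          by (rule fps_cong_mult[OF fps_cong_refl fps_cong_mult[OF fps_cong_mult[OF fps_cong_refl] fps_cong_refl]])
        also have "\<dots> = ((odd_prod_inf * inverse odd_prod_inf) * (odd_prod_inf * inverse odd_prod_inf)) *
            (euler_prod 4 * (S k * fps_X ^ ((2 * k + 1) * (2 * k + 1)))) * inverse (D2 k)"
          unfolding theta_const_def fps_inverse_mult by (simp only: mult_ac)
        also have "odd_prod_inf * inverse odd_prod_inf = 1"
          by (rule inverse_mult_eq_1') simp
        finally show "fps_cong K (theta_const * (S k * M k * inverse (D2 k))) (fps_X * fps_dil 2 (fps_dil 2 (g k)) * inverse (D2 k))"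
          unfolding g by (simp only: mult_1_left)
      qed
      also have "(\<Sum>k<K. fps_X * fps_dil 2 (fps_dil 2 (g k)) * inverse (D2 k)) =
          fps_X * fps_dil 2 (\<Sum>k<K. fps_dil 2 (g k) * inverse (pf_den t (-1, 2 * k + 1)))"
        unfolding fps_dil_sum sum_distrib_left
      proof (intro sum.cong refl)
        fix k :: nat
        have "4 * k + 2 = 2 * (2 * k + 1)" by simp
        then show "fps_X * fps_dil 2 (fps_dil 2 (g k)) * inverse (D2 k) =
           fps_X * fps_dil 2 (fps_dil 2 (g k) * inverse (pf_den t (-1, 2 * k + 1)))"
          unfolding D2_def by (simp only: fps_dil_mult[OF zero_less_numeral] fps_dil_inverse[OF zero_less_numeral]
              fps_dil_pf_den[OF zero_less_numeral] mult.assoc)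
      qed
      finally show ?thesis .
    qed
    ultimately have "fps_cong K (lambert_even t + fps_X * fps_dil 2 (\<Sum>k<K. fps_dil 2 (g k) * inverse (pf_den t (-1, 2 * k + 1)))) (theta_even t)"
      using fps_cong_trans[OF fps_cong_sym[OF fps_cong_add] sum] by blast
    then show ?thesis by (rule fps_cong_eq_diff)
  qed
  then show ?thesis by blast
qed

text \<open>The same expansion with the family 4k. Now the cofactor starts with q^((2k)^2), and the
  denominators 1 + t q^(4k) + q^(8k) are series in q^4 as well, so the entire mock part is one. Here
  \<open>g\<close> may depend on \<open>t\<close>, as only the value t = 2 is used later.\<close>

lemma lambert_odd_eq_theta:
  assumes t: "t \<noteq> -2"
  shows "\<exists>g. fps_cong K (lambert_odd t) (theta_odd t - fps_dil 4 g)"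
proof -
  define N where "N = 3 * K + 2"
  define A where "A = (\<lambda>j. \<Prod>i\<in>{..<N} - {j}. pf_num (1::complex, 2 * i + 1) (1, 2 * j + 1) * inverse (pf_gap (1, 2 * i + 1) (1, 2 * j + 1)))"
  define B where "B = (\<lambda>j. \<Prod>k<N. pf_num (-1::complex, 4 * k) (1, 2 * j + 1) * inverse (pf_gap (-1, 4 * k) (1, 2 * j + 1)))"
  define S where "S = (\<lambda>k. \<Prod>l\<in>{..<N} - {k}. pf_num (-1::complex, 4 * l) (-1, 4 * k) * inverse (pf_gap (-1, 4 * l) (-1, 4 * k)))"
  define M where "M = (\<lambda>k. \<Prod>j<N. pf_num (1::complex, 2 * j + 1) (-1, 4 * k) * inverse (pf_gap (1, 2 * j + 1) (-1, 4 * k)))"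
  have "\<exists>g. S k = fps_dil 4 g" for k
    using pf_coeff_even_dil[of 0 k "{..<N} - {k}"] by (simp only: S_def mult_0_right add_0_right)
  then obtain g0 where g0: "\<And>k. S k = fps_dil 4 (g0 k)" by metis
  define g where "g = (\<Sum>k<K. fps_X ^ (k * k) * (euler_prod 1 * g0 k) * inverse (pf_den t (-1, k)))"
  define D1 where "D1 = (\<lambda>j. pf_den t (1, 2 * j + 1))"
  define D2 where "D2 = (\<lambda>k. pf_den t (-1, 4 * k))"
  define D3 where "D3 = (\<lambda>k. pf_den t (-1, 4 * k + 4))"
  have t2: "2 + t \<noteq> 0" using t by (metis add.commute add_eq_0_iff)
  have u: "D1 j $ 0 = 1" "D3 j $ 0 = 1" for j by (simp_all add: D1_def D3_def pf_den_def)
  have D2_prod: "(\<Prod>k<N. D2 k) = fps_const (2 + t) * (\<Prod>k<3 * K + 1. D3 k)"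
  proof -
    have "D2 0 = fps_const (2 + t)"
      by (rule fps_ext) (simp add: D2_def pf_den_def fps_numeral_nth)
    moreover have "D2 (Suc k) = D3 k" for k by (simp add: D2_def D3_def add.commute)
    moreover have "N = Suc (3 * K + 1)" by (simp add: N_def)
    ultimately show ?thesis by (simp only: prod.lessThan_Suc_shift)
  qed
  have "fps_cong K (theta_const * inverse ((\<Prod>j<N. D1 j) * (\<Prod>k<N. D2 k))) (theta_odd t)"
    unfolding theta_odd_def D1_def[symmetric] D3_def[symmetric] D2_prod
  proof (rule inverse_cong_mult)
    show "fps_cong K ((\<Prod>j<N. D1 j) * (fps_const (2 + t) * (\<Prod>k<3 * K + 1. D3 k)))
        (fps_iprod D1 * (fps_const (2 + t) * fps_iprod D3))"
    proof (intro fps_cong_mult fps_cong_refl fps_cong_sym[OF fps_iprod_cong])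
      show "fps_cong (Suc j) (D1 j) 1" "fps_cong (Suc j) (D3 j) 1" for j
        unfolding D1_def D3_def by (rule pf_den_cong, simp)+
    qed (simp_all add: N_def)
  qed (use t2 in \<open>simp_all add: fps_prod_nth_0 fps_iprod_nth_0 u\<close>)
  moreover have "inverse ((\<Prod>j<N. D1 j) * (\<Prod>k<N. D2 k)) =
      (\<Sum>j<N. A j * B j * inverse (D1 j)) + (\<Sum>k<N. S k * M k * inverse (D2 k))"
    unfolding A_def B_def S_def M_def D1_def D2_def
    using partial_fractions_two_families[of N 0 t] t by (simp add: N_def)
  ultimately have sum: "fps_cong K ((\<Sum>j<N. theta_const * (A j * B j * inverse (D1 j)))
      + (\<Sum>k<N. theta_const * (S k * M k * inverse (D2 k)))) (theta_odd t)"
    by (simp only: distrib_left sum_distrib_left)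
  have "fps_cong K (\<Sum>j<N. theta_const * (A j * B j * inverse (D1 j))) (lambert_odd t)"
  proof -
    define f where "f = (\<lambda>j. fps_X ^ (3 * (Suc j choose 2) + j + 1) * ((-1) ^ j * (1 - fps_X ^ (2 * j + 1)) * inverse (D1 j)))"
    have "fps_cong K (\<Sum>j<N. theta_const * (A j * B j * inverse (D1 j)))
        (\<Sum>j<K. theta_const * (A j * B j * inverse (D1 j)))"
    proof (rule fps_cong_subset_sum)
      show "{..<K} \<subseteq> {..<N}" by (auto simp: N_def)
      fix j assume j: "j \<in> {..<N} - {..<K}"
      have "fps_cong K (A j) (fps_X ^ (2 * (Suc j choose 2)) * ((-1) ^ j * (1 - fps_X ^ (4 * j + 2)) * inverse (euler_prod 2 * euler_prod 2)))"
        unfolding A_def using j by (intro pf_coeff_self_cong) (auto simp: N_def)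
      also have "fps_cong K \<dots> 0"
        using j choose_2_ge[of j] by (intro fps_cong_X_power_0) auto
      finally have "fps_cong K (theta_const * (A j * B j * inverse (D1 j))) (theta_const * (0 * B j * inverse (D1 j)))"
        by (intro fps_cong_mult fps_cong_refl)
      then show "fps_cong K (theta_const * (A j * B j * inverse (D1 j))) 0" by simp
    qed simp
    also have "fps_cong K \<dots> (\<Sum>j<K. inverse (qpoch_inf fps_X) * f j)"
    proof (rule fps_cong_sum)
      fix j assume j: "j \<in> {..<K}"
      define Y where "Y = (fps_X ^ (2 * j + 1) :: complex fps)"
      define m where "m = (-1) ^ j * (1 - fps_X ^ (4 * j + 2) :: complex fps)"
      have Y0: "(1 + Y) $ 0 \<noteq> 0" by (simp add: Y_def)
      have Y2: "fps_X ^ (4 * j + 2) = Y * Y"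
        unfolding Y_def power_add[symmetric] by (rule arg_cong[of _ _ "\<lambda>n. fps_X ^ n"]) simp
      have "m * inverse (1 + Y) = (-1) ^ j * (1 - Y) * ((1 + Y) * inverse (1 + Y))"
      proof -
        have "1 - Y * Y = (1 - Y) * (1 + Y)" by (simp add: algebra_simps)
        then show ?thesis unfolding m_def Y2 by (simp only: mult_ac)
      qed
      then have m: "m * inverse (1 + Y) = (-1) ^ j * (1 - Y)"
        by (simp only: inverse_mult_eq_1'[OF Y0] mult_1_right)
      have "fps_cong K (theta_const * (A j * B j * inverse (D1 j))) (theta_const *
         (fps_X ^ (2 * (Suc j choose 2)) * (m * inverse (euler_prod 2 * euler_prod 2)) * (fps_X ^ (Suc (Suc j) choose 2) * inverse (odd_prod_inf * (1 + Y))) * inverse (D1 j)))"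
        unfolding A_def B_def m_def Y_def using j
        by (intro fps_cong_mult fps_cong_refl pf_coeff_self_cong pf_coeff_opposite_0) (auto simp: N_def)
      also have "\<dots> = theta_const * (inverse (euler_prod 2 * euler_prod 2) * inverse odd_prod_inf) *
          (fps_X ^ (2 * (Suc j choose 2)) * fps_X ^ (Suc (Suc j) choose 2) * (m * inverse (1 + Y) * inverse (D1 j)))"
        unfolding fps_inverse_mult by (simp only: mult_ac)
      also have "fps_X ^ (2 * (Suc j choose 2)) * fps_X ^ (Suc (Suc j) choose 2) = (fps_X ^ (3 * (Suc j choose 2) + j + 1) :: complex fps)"
        unfolding power_add[symmetric] Suc_choose_2[of "Suc j"]
        by (rule arg_cong[of _ _ "\<lambda>n. fps_X ^ n"]) simp
      finally show "fps_cong K (theta_const * (A j * B j * inverse (D1 j))) (inverse (qpoch_inf fps_X) * f j)"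
        unfolding theta_const_eq f_def m Y_def[symmetric] .
    qed
    also have "(\<Sum>j<K. inverse (qpoch_inf fps_X) * f j) = inverse (qpoch_inf fps_X) * (\<Sum>j<K. f j)"
      by (rule sum_distrib_left[symmetric])
    also have "fps_cong K \<dots> (inverse (qpoch_inf fps_X) * fps_isum f)"
    proof (intro fps_cong_mult fps_cong_refl fps_cong_sym[OF fps_isum_cong])
      show "fps_cong j (f j) 0" for j
        unfolding f_def by (intro fps_cong_X_power_0) linarith
    qed simp
    also have "inverse (qpoch_inf fps_X) * fps_isum f = lambert_odd t"
      by (simp only: lambert_odd_def f_def D1_def)
    finally show ?thesis .
  qed
  moreover have "fps_cong K (\<Sum>k<N. theta_const * (S k * M k * inverse (D2 k))) (fps_dil 4 g)"
  proof -
    have M: "M k = fps_X ^ (2 * k * (2 * k)) * inverse (odd_prod (N - 2 * k) * odd_prod (N + 2 * k))"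
      if "2 * k \<le> N" for k
    proof -
      have "4 * k = 2 * (2 * k)" by simp
      then show ?thesis unfolding M_def by (simp only: pf_coeff_opposite_odd[OF that])
    qed
    have M0: "fps_cong K (M k) 0" if k: "K \<le> k" for k
    proof -
      have "(\<Prod>j<N. pf_num (1, 2 * j + 1) (-1, 4 * k)) = (fps_X ^ (\<Sum>j<N. 4 * k - (2 * j + 1)) :: complex fps)"
        by (simp add: pf_num_opposite power_sum)
      then have "M k = fps_X ^ (\<Sum>j<N. 4 * k - (2 * j + 1)) * (\<Prod>j<N. inverse (pf_gap (1, 2 * j + 1) (-1, 4 * k)))"
        unfolding M_def prod.distrib by (simp only:)
      moreover have "K \<le> (\<Sum>j<N. 4 * k - (2 * j + 1))"
      proof -
        have "4 * k - (2 * 0 + 1) \<le> (\<Sum>j<N. 4 * k - (2 * j + 1))"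
          by (rule member_le_sum) (auto simp: N_def)
        then show ?thesis using k by linarith
      qed
      ultimately show ?thesis by (simp only: fps_cong_X_power_0)
    qed
    have "fps_cong K (\<Sum>k<N. theta_const * (S k * M k * inverse (D2 k))) (\<Sum>k<K. theta_const * (S k * M k * inverse (D2 k)))"
    proof (rule fps_cong_subset_sum)
      show "{..<K} \<subseteq> {..<N}" by (auto simp: N_def)
      fix k assume k: "k \<in> {..<N} - {..<K}"
      have "fps_cong K (theta_const * (S k * M k * inverse (D2 k))) (theta_const * (S k * 0 * inverse (D2 k)))"
        using k by (intro fps_cong_mult fps_cong_refl M0) auto
      then show "fps_cong K (theta_const * (S k * M k * inverse (D2 k))) 0" by simp
    qed simp
    also have "fps_cong K \<dots> (\<Sum>k<K. fps_dil 4 (fps_X ^ (k * k) * (euler_prod 1 * g0 k) * inverse (pf_den t (-1, k))))"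
    proof (rule fps_cong_sum)
      fix k assume k: "k \<in> {..<K}"
      have le: "2 * k \<le> N" using k by (auto simp: N_def)
      have "fps_cong K (fps_X ^ (2 * k * (2 * k)) * inverse (odd_prod (N - 2 * k) * odd_prod (N + 2 * k)))
         (fps_X ^ (2 * k * (2 * k)) * inverse (odd_prod_inf * odd_prod_inf))"
        using k by (intro inverse_cong_mult fps_cong_mult odd_prod_cong) (auto simp: N_def odd_prod_nth_0)
      then have "fps_cong K (theta_const * (S k * M k * inverse (D2 k)))
          (theta_const * (S k * (fps_X ^ (2 * k * (2 * k)) * inverse (odd_prod_inf * odd_prod_inf)) * inverse (D2 k)))"
        unfolding M[OF le]
        by (rule fps_cong_mult[OF fps_cong_refl fps_cong_mult[OF fps_cong_mult[OF fps_cong_refl] fps_cong_refl]])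
      also have "\<dots> = ((odd_prod_inf * inverse odd_prod_inf) * (odd_prod_inf * inverse odd_prod_inf)) *
          (fps_X ^ (2 * k * (2 * k)) * (euler_prod 4 * S k) * inverse (D2 k))"
        unfolding theta_const_def fps_inverse_mult by (simp only: mult_ac)
      also have "odd_prod_inf * inverse odd_prod_inf = 1"
        by (rule inverse_mult_eq_1') simp
      also have "1 * 1 * (fps_X ^ (2 * k * (2 * k)) * (euler_prod 4 * S k) * inverse (D2 k)) =
          fps_dil 4 (fps_X ^ (k * k) * (euler_prod 1 * g0 k) * inverse (pf_den t (-1, k)))"
      proof -
        have "fps_dil 4 (euler_prod 1) = euler_prod 4" by (simp add: fps_dil_euler_prod)
        moreover have "2 * k * (2 * k) = 4 * (k * k)" by simp
        ultimately show ?thesis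
          unfolding D2_def g0 by (simp only: fps_dil_mult[OF zero_less_numeral] fps_dil_inverse[OF zero_less_numeral]
            fps_dil_pf_den[OF zero_less_numeral] fps_dil_X_power[OF zero_less_numeral] mult_1_left)
      qed
      finally show "fps_cong K (theta_const * (S k * M k * inverse (D2 k)))
         (fps_dil 4 (fps_X ^ (k * k) * (euler_prod 1 * g0 k) * inverse (pf_den t (-1, k))))" .
    qed
    also have "\<dots> = fps_dil 4 g" by (simp only: g_def fps_dil_sum)
    finally show ?thesis .
  qed
  ultimately have "fps_cong K (lambert_odd t + fps_dil 4 g) (theta_odd t)"
    using fps_cong_trans[OF fps_cong_sym[OF fps_cong_add] sum] by blast
  then have "fps_cong K (lambert_odd t) (theta_odd t - fps_dil 4 g)" by (rule fps_cong_eq_diff)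
  then show ?thesis by blast
qed

section \<open>Theta functions\<close>

text \<open>Ramanujan's theta functions: \<open>phi\<close> is the sum of q^(n^2) over all integers
  n, \<open>phi_minus\<close> is phi(-q), and \<open>psi\<close> is the generating function of the
  triangular numbers.\<close>

definition phi :: "complex fps" where "phi = fps_isum (theta_term fps_X fps_X)"
definition phi_minus :: "complex fps" where "phi_minus = fps_isum (theta_term (- fps_X) (- fps_X))"
definition psi :: "complex fps" where "psi = fps_isum (\<lambda>i. fps_X ^ (Suc i choose 2))"

lemma phi_eq_prod: "phi = odd_prod_inf * odd_prod_inf * euler_prod 2"
proof -
  have "(\<lambda>i. 1 + fps_X * (fps_X * fps_X) ^ i) = (\<lambda>i. 1 + fps_X ^ (2 * i + 1) :: complex fps)"
    by (simp add: power_mult power2_eq_square)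
  then show ?thesis
    using jacobi_triple_product[of "fps_X :: complex fps" fps_X]
    by (simp add: phi_def odd_prod_inf_def euler_prod_eq power2_eq_square)
qed

lemma phi_minus_eq_prod: "phi_minus = odd_diff_inf * odd_diff_inf * euler_prod 2"
proof -
  have "(\<lambda>i. 1 + - fps_X * (- fps_X * - fps_X) ^ i) = (\<lambda>i. 1 - fps_X ^ (2 * i + 1) :: complex fps)"
    by (simp add: power_mult power2_eq_square)
  then show ?thesis
    using jacobi_triple_product[of "- fps_X :: complex fps" "- fps_X"]
    by (simp add: phi_minus_def odd_diff_inf_def euler_prod_eq power2_eq_square)
qed

lemma fps_isum_pairs:
  assumes "fps_summable f"
  shows "fps_isum f = fps_isum (\<lambda>i. f (2 * i)) + fps_isum (\<lambda>i. f (2 * i + 1))"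
proof -
  have s: "fps_summable (\<lambda>i. f (2 * i))" "fps_summable (\<lambda>i. f (2 * i + 1))"
    by (intro allI fps_cong_mono[OF assms[rule_format]]; simp)+
  show ?thesis
  proof (rule fps_cong_eqI)
    fix K
    have "fps_cong K (fps_isum f) (\<Sum>j<2 * K. f j)"
      using assms by (intro fps_isum_cong) auto
    also have "(\<Sum>j<2 * n. f j) = (\<Sum>i<n. f (2 * i)) + (\<Sum>i<n. f (2 * i + 1))" for n
      by (induction n) (simp_all add: algebra_simps)
    also have "fps_cong K ((\<Sum>i<K. f (2 * i)) + (\<Sum>i<K. f (2 * i + 1))) (fps_isum (\<lambda>i. f (2 * i)) + fps_isum (\<lambda>i. f (2 * i + 1)))"
      using s by (intro fps_cong_add fps_cong_sym[OF fps_isum_cong]) auto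
    finally show "fps_cong K (fps_isum f) (fps_isum (\<lambda>i. f (2 * i)) + fps_isum (\<lambda>i. f (2 * i + 1)))" .
  qed
qed

lemma choose_2_sum: "(Suc j choose 2) + (j choose 2) = j * j"
  by (induction j) (simp_all add: Suc_choose_2)

lemma psi_summable: "fps_summable (\<lambda>i. fps_X ^ (Suc i choose 2) :: complex fps)"
proof
  fix j
  show "fps_cong j (fps_X ^ (Suc j choose 2) :: complex fps) 0"
    using fps_cong_X_power_0[OF choose_2_ge[of j], of 1] by simp
qed

text \<open>Serves phi(q) and phi(-q) at once, with c = 1 and c = -1. Even indices have squares
  4i^2, odd ones (2i+1)^2 = 8T + 1 with T triangular.\<close>

lemma phi_split_aux:
  fixes c :: complex
  assumes c: "c * c = 1" and f: "\<And>j. f j = (if j = 0 then 1 else fps_const (2 * c ^ j) * fps_X ^ (j * j))"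
  shows "fps_isum f = fps_isum (\<lambda>i. fps_dil 4 (if i = 0 then 1 else fps_const 2 * fps_X ^ (i * i))) + fps_const (2 * c) * fps_X * fps_dil 8 psi"
proof -
  have sf: "fps_summable f"
  proof
    fix j
    show "fps_cong j (f j) 0"
    proof (cases "j = 0")
      case False
      have "fps_cong j (fps_X ^ (j * j) * fps_const (2 * c ^ j)) 0"
        by (rule fps_cong_X_power_0) (use False in auto)
      then show ?thesis using False by (simp add: f mult.commute)
    qed (simp add: fps_cong_def)
  qed
  have ev: "f (2 * i) = fps_dil 4 (if i = 0 then 1 else fps_const 2 * fps_X ^ (i * i))" for i
  proof -
    have "2 * i * (2 * i) = 4 * (i * i)" by simp
    moreover have "c ^ (2 * i) = 1" using c by (simp add: power_mult power2_eq_square)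
    ultimately show ?thesis
      by (cases "i = 0") (simp_all add: f fps_dil_mult fps_dil_X_power del: power_mult)
  qed
  have od: "f (2 * i + 1) = fps_const (2 * c) * fps_X * fps_dil 8 (fps_X ^ (Suc i choose 2))" for i
  proof -
    have e: "(2 * i + 1) * (2 * i + 1) = Suc (8 * (Suc i choose 2))"
      using choose_2_Suc[of i] by simp
    have "f (2 * i + 1) = fps_const (2 * c) * fps_X ^ ((2 * i + 1) * (2 * i + 1))"
    proof -
      have "c ^ (2 * i + 1) = c" using c by (simp add: power_mult power2_eq_square)
      then have "2 * c ^ (2 * i + 1) = 2 * c" by (simp only:)
      then show ?thesis unfolding f by (simp only:) simp
    qed
    then show ?thesis unfolding e by (simp add: fps_dil_X_power mult.assoc)
  qed
  have "fps_isum (\<lambda>i. f (2 * i + 1)) = fps_const (2 * c) * fps_X * fps_isum (\<lambda>i. fps_dil 8 (fps_X ^ (Suc i choose 2)))"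
    unfolding od
  proof (rule fps_isum_mult_left[symmetric])
    show "fps_cong j (fps_dil 8 (fps_X ^ (Suc j choose 2)) :: complex fps) 0" for j
      using fps_cong_dil[of 8, OF _ psi_summable[rule_format, of j]] by simp
  qed
  also have "fps_isum (\<lambda>i. fps_dil 8 (fps_X ^ (Suc i choose 2))) = fps_dil 8 psi"
    unfolding psi_def using psi_summable by (intro fps_dil_isum[symmetric]) auto
  finally show ?thesis unfolding fps_isum_pairs[OF sf] ev by simp
qed

lemma phi_eq_isum: "phi = fps_isum (\<lambda>j. if j = 0 then 1 else fps_const 2 * fps_X ^ (j * j))"
  unfolding phi_def
proof (rule fps_isum_cong_fun)
  fix j :: nat
  have "2 = (fps_const 2 :: complex fps)" by (simp add: numeral_fps_const)
  then show "theta_term fps_X fps_X j = (if j = 0 then 1 else fps_const 2 * fps_X ^ (j * j) :: complex fps)"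
    unfolding theta_term_def power_add[symmetric] add.commute[of "j choose 2"] choose_2_sum by simp
qed

lemma phi_dil_4: "fps_isum (\<lambda>i. fps_dil 4 (if i = 0 then 1 else fps_const 2 * fps_X ^ (i * i))) = fps_dil 4 phi"
  unfolding phi_eq_isum
proof (rule fps_dil_isum[symmetric])
  show "fps_cong j (if j = 0 then 1 else fps_const 2 * fps_X ^ (j * j) :: complex fps) 0" for j
    using fps_cong_X_power_0[of j "j * j" "fps_const 2 :: complex fps"] by (auto simp: mult.commute fps_cong_def)
qed simp

lemma phi_split: "phi = fps_dil 4 phi + 2 * fps_X * fps_dil 8 psi"
proof -
  have "phi = fps_dil 4 phi + fps_const (2 * 1) * fps_X * fps_dil 8 psi"
    unfolding phi_eq_isum
    by (subst phi_split_aux[of 1]) (simp_all add: phi_dil_4 flip: phi_eq_isum)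
  then show ?thesis by (simp add: numeral_fps_const)
qed

lemma phi_minus_split: "phi_minus = fps_dil 4 phi - 2 * fps_X * fps_dil 8 psi"
proof -
  have "theta_term (- fps_X) (- fps_X) j = (if j = 0 then 1 else fps_const (2 * (-1) ^ j) * fps_X ^ (j * j) :: complex fps)" for j
  proof -
    have m: "(- fps_X) ^ (j * j) = fps_const ((-1) ^ j) * (fps_X ^ (j * j) :: complex fps)"
    proof -
      have "(- fps_X :: complex fps) ^ (j * j) = ((-1) * fps_X) ^ (j * j)" by simp
      also have "\<dots> = (-1) ^ (j * j) * fps_X ^ (j * j)" by (rule power_mult_distrib)
      also have "(-1 :: complex fps) ^ (j * j) = (-1) ^ j"
        by (cases "even j") simp_all
      also have "(-1 :: complex fps) ^ j = fps_const ((-1) ^ j)"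
        by (cases "even j") (simp_all flip: fps_const_neg)
      finally show ?thesis .
    qed
    have "fps_const (2 * (-1) ^ j) = fps_const ((-1) ^ j) + fps_const ((-1) ^ j :: complex)" by simp
    then show ?thesis
      unfolding theta_term_def power_add[symmetric] add.commute[of "j choose 2"] choose_2_sum m
      by (simp add: distrib_right numeral_fps_const)
  qed
  from phi_split_aux[of "-1", OF _ this] show ?thesis
    unfolding phi_dil_4 phi_minus_def by (simp add: numeral_fps_const flip: fps_const_neg)
qed

text \<open>Triple product with A = q and B = q^3, whose exponents 2j^2 - j and 2j^2 + j are the
  triangular numbers of index 2j-1 and 2j. The two products interleave to (-q; q^2).\<close>

lemma psi_eq_prod: "psi = odd_prod_inf * euler_prod 4"
proof -
  define A where "A = (fps_X :: complex fps)"
  define B where "B = (fps_X ^ 3 :: complex fps)"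
  have AB: "A * B = fps_X ^ 4" by (simp add: A_def B_def eval_nat_numeral)
  have "fps_iprod (\<lambda>i. 1 + A * (A * B) ^ i) * fps_iprod (\<lambda>i. 1 + B * (A * B) ^ i) = odd_prod_inf"
  proof (rule fps_cong_eqI)
    fix K
    have c: "fps_cong (Suc j) (1 + A * (A * B) ^ j) 1" "fps_cong (Suc j) (1 + B * (A * B) ^ j) 1" for j
      by (rule one_plus_mult_power_cong; simp add: A_def B_def)+
    have "fps_cong K (fps_iprod (\<lambda>i. 1 + A * (A * B) ^ i) * fps_iprod (\<lambda>i. 1 + B * (A * B) ^ i))
       ((\<Prod>i<K. 1 + A * (A * B) ^ i) * (\<Prod>i<K. 1 + B * (A * B) ^ i))"
      by (intro fps_cong_mult fps_iprod_cong c) auto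
    also have "(\<Prod>i<n. 1 + A * (A * B) ^ i) * (\<Prod>i<n. 1 + B * (A * B) ^ i) = odd_prod (2 * n)" for n
    proof (induction n)
      case (Suc n)
      have "A * (A * B) ^ n = fps_X ^ (2 * (2 * n) + 1)" "B * (A * B) ^ n = fps_X ^ (2 * (2 * n + 1) + 1)"
        unfolding AB unfolding A_def B_def power_mult[symmetric] power_Suc[symmetric] power_add[symmetric]
        by (rule arg_cong[of _ _ "\<lambda>n. fps_X ^ n"], simp)+
      moreover have "odd_prod (2 * Suc n) = odd_prod (2 * n) * (1 + fps_X ^ (2 * (2 * n) + 1)) * (1 + fps_X ^ (2 * (2 * n + 1) + 1))"
        by (simp add: odd_prod_def)
      ultimately show ?case unfolding Suc[symmetric] prod.lessThan_Suc by (simp only: mult_ac)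
    qed (simp add: odd_prod_def)
    also have "fps_cong K (odd_prod (2 * K)) odd_prod_inf" by (rule odd_prod_cong) simp
    finally show "fps_cong K (fps_iprod (\<lambda>i. 1 + A * (A * B) ^ i) * fps_iprod (\<lambda>i. 1 + B * (A * B) ^ i)) odd_prod_inf" .
  qed
  then have 1: "odd_prod_inf * euler_prod 4 = fps_isum (theta_term A B)"
    using jacobi_triple_product[of A B] unfolding AB euler_prod_eq[OF zero_less_numeral]
    by (simp add: A_def B_def)
  have ts: "fps_summable (theta_term A B)"
  proof
    fix j
    have "fps_cong j (A ^ (Suc j choose 2) * B ^ (j choose 2) + B ^ (Suc j choose 2) * A ^ (j choose 2)) (0 + 0)"
      by (intro fps_cong_add fps_cong_power_mult_0 choose_2_ge) (simp_all add: A_def B_def)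
    then show "fps_cong j (theta_term A B j) 0"
      by (cases "j = 0") (auto simp: theta_term_def mult_ac fps_cong_def)
  qed
  have s: "fps_summable (\<lambda>i. fps_X ^ (Suc (Suc i) choose 2) :: complex fps)"
    by (rule fps_summable_Suc[OF psi_summable])
  have "psi = 1 + fps_isum (\<lambda>i. fps_X ^ (Suc (Suc i) choose 2))"
    unfolding psi_def by (subst fps_isum_Suc[OF psi_summable]) (simp add: Suc_choose_2 binomial_eq_0)
  also have "fps_isum (\<lambda>i. fps_X ^ (Suc (Suc i) choose 2) :: complex fps) =
      fps_isum (\<lambda>i. fps_X ^ (Suc (Suc (2 * i)) choose 2) + fps_X ^ (Suc (Suc (2 * i + 1)) choose 2))"
    unfolding fps_isum_pairs[OF s] fps_isum_add ..
  also have "\<dots> = fps_isum (\<lambda>i. theta_term A B (Suc i))"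
  proof (rule fps_isum_cong_fun)
    fix i :: nat
    have e: "Suc (Suc (2 * i)) choose 2 = (Suc (Suc i) choose 2) + 3 * (Suc i choose 2)"
      "Suc (Suc (2 * i + 1)) choose 2 = (Suc i choose 2) + 3 * (Suc (Suc i) choose 2)"
      using choose_2_Suc[of "Suc (2 * i)"] choose_2_Suc[of "Suc (2 * i + 1)"] choose_2_Suc[of "Suc i"] choose_2_Suc[of i]
      by (simp_all add: algebra_simps)
    show "fps_X ^ (Suc (Suc (2 * i)) choose 2) + fps_X ^ (Suc (Suc (2 * i + 1)) choose 2) = theta_term A B (Suc i)"
      unfolding e theta_term_def A_def B_def power_mult[symmetric] power_add by simp
  qed
  also have "1 + fps_isum (\<lambda>i. theta_term A B (Suc i)) = fps_isum (theta_term A B)"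
  proof -
    have "theta_term A B 0 = 1" by (simp add: theta_term_def)
    then show ?thesis using fps_isum_Suc[OF ts] by (simp only:)
  qed
  finally show ?thesis using 1 by simp
qed

text \<open>Pentagonal number theorem, from the triple product with A = -q and B = -q^2: j(3j-1)/2
  and j(3j+1)/2 are 0, 1 or 2 modulo 5.\<close>

lemma qpoch_nth_mod_5:
  assumes "n mod 5 = 3 \<or> n mod 5 = 4"
  shows "euler_prod 1 $ n = 0"
proof -
  define A where "A = (- fps_X :: complex fps)"
  define B where "B = (- (fps_X ^ 2) :: complex fps)"
  have AB: "A * B = fps_X ^ 3" by (simp add: A_def B_def eval_nat_numeral)
  have "fps_iprod (\<lambda>i. 1 + A * (A * B) ^ i) * fps_iprod (\<lambda>i. 1 + B * (A * B) ^ i) * qpoch_inf (A * B) = euler_prod 1"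
  proof (rule fps_cong_eqI)
    fix K
    have c: "fps_cong (Suc j) (1 + A * (A * B) ^ j) 1" "fps_cong (Suc j) (1 + B * (A * B) ^ j) 1" for j
      by (rule one_plus_mult_power_cong; simp add: A_def B_def)+
    have "fps_cong K (fps_iprod (\<lambda>i. 1 + A * (A * B) ^ i) * fps_iprod (\<lambda>i. 1 + B * (A * B) ^ i) * qpoch_inf (A * B))
       ((\<Prod>i<K. 1 + A * (A * B) ^ i) * (\<Prod>i<K. 1 + B * (A * B) ^ i) * qpoch (A * B) K)"
      by (intro fps_cong_mult fps_iprod_cong c fps_cong_sym[OF qpoch_cong]) (auto simp: A_def)
    also have "(\<Prod>i<n. 1 + A * (A * B) ^ i) * (\<Prod>i<n. 1 + B * (A * B) ^ i) * qpoch (A * B) n = qpoch fps_X (3 * n)" for n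
    proof (induction n)
      case (Suc n)
      have "1 + A * (A * B) ^ n = 1 - fps_X ^ Suc (3 * n)" "1 + B * (A * B) ^ n = 1 - fps_X ^ Suc (Suc (3 * n))"
        "1 - (A * B) ^ Suc n = 1 - fps_X ^ Suc (Suc (Suc (3 * n)))"
      proof -
        have p: "(A * B) ^ k = fps_X ^ (3 * k)" for k unfolding AB power_mult ..
        show "1 + A * (A * B) ^ n = 1 - fps_X ^ Suc (3 * n)" "1 + B * (A * B) ^ n = 1 - fps_X ^ Suc (Suc (3 * n))"
          unfolding p by (simp_all add: A_def B_def power2_eq_square mult_ac)
        have "3 * Suc n = Suc (Suc (Suc (3 * n)))" by simp
        then show "1 - (A * B) ^ Suc n = 1 - fps_X ^ Suc (Suc (Suc (3 * n)))"
          unfolding p by (simp only:)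
      qed
      moreover have "qpoch (fps_X :: complex fps) (3 * Suc n) = qpoch fps_X (3 * n) * (1 - fps_X ^ Suc (3 * n)) * (1 - fps_X ^ Suc (Suc (3 * n))) * (1 - fps_X ^ Suc (Suc (Suc (3 * n))))"
      proof -
        have "3 * Suc n = Suc (Suc (Suc (3 * n)))" by simp
        then show ?thesis by (simp only: qpoch_Suc)
      qed
      ultimately show ?case unfolding Suc[symmetric] prod.lessThan_Suc qpoch_Suc by (simp only: mult_ac)
    qed simp
    also have "fps_cong K (qpoch fps_X (3 * K)) (euler_prod 1)"
      unfolding euler_prod_1 by (rule qpoch_cong) simp_all
    finally show "fps_cong K (fps_iprod (\<lambda>i. 1 + A * (A * B) ^ i) * fps_iprod (\<lambda>i. 1 + B * (A * B) ^ i) * qpoch_inf (A * B)) (euler_prod 1)" .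
  qed
  then have "euler_prod 1 = fps_isum (theta_term A B)"
    using jacobi_triple_product[of A B] by (simp add: A_def B_def)
  moreover have "theta_term A B j $ n = 0" for j
  proof (cases "j = 0")
    case True
    then show ?thesis using assms by (auto simp: theta_term_def)
  next
    case False
    define a where "a = j choose 2"
    have sj: "Suc j choose 2 = j + a" by (simp add: a_def Suc_choose_2)
    have a2: "2 * a + j = j * j" using choose_2_sum[of j] by (simp add: sj a_def)
    define r where "r = j mod 5"
    define c where "c = (2 * a + j) mod 5"
    have "r < 5" by (simp add: r_def)
    then have r: "r = 0 \<or> r = 1 \<or> r = 2 \<or> r = 3 \<or> r = 4" by linarith
    have c: "c = r * r mod 5" unfolding a2 c_def r_def by (rule mod_mult_eq[symmetric])
    have red: "(4 * (2 * a + j) + d * j) mod 5 = (4 * c + d * r) mod 5" for d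
      unfolding c_def r_def by (rule mod_add_cong; rule mod_mult_right_eq[symmetric])
    \<comment> \<open>Avoids halving: 2a + j = j^2, and modulo 5 the factor 3/2 is 4, so the two
      exponents become 4j^2 + 2j and 4j^2 + 3j.\<close>
    have "4 * (2 * a + j) + 2 * j = (j + a + 2 * a) + 5 * (a + j)"
      "4 * (2 * a + j) + 3 * j = (a + 2 * (j + a)) + 5 * (a + j)" by simp_all
    then have "(4 * (2 * a + j) + 2 * j) mod 5 = (j + a + 2 * a) mod 5"
      "(4 * (2 * a + j) + 3 * j) mod 5 = (a + 2 * (j + a)) mod 5" by (simp_all only: mod_mult_self2)
    then have e: "(j + a + 2 * a) mod 5 = (4 * c + 2 * r) mod 5" "(a + 2 * (j + a)) mod 5 = (4 * c + 3 * r) mod 5"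
      unfolding red by (simp_all only:)
    have "(4 * c + 2 * r) mod 5 \<le> 2 \<and> (4 * c + 3 * r) mod 5 \<le> 2"
      unfolding c by (rule disjE[OF r], simp, elim disjE; simp)
    then have "(j + a + 2 * a) mod 5 \<le> 2 \<and> (a + 2 * (j + a)) mod 5 \<le> 2"
      unfolding e .
    then have "n \<noteq> j + a + 2 * a \<and> n \<noteq> a + 2 * (j + a)"
      using assms by auto
    moreover have "A ^ k * B ^ l = fps_const ((-1) ^ k * (-1) ^ l) * fps_X ^ (k + 2 * l)" for k l
    proof -
      have n1: "- fps_X = fps_const (-1 :: complex) * fps_X" "- (fps_X ^ 2) = fps_const (-1 :: complex) * fps_X ^ 2"
        by (simp_all flip: fps_const_neg)
      show ?thesis unfolding A_def B_def n1 power_mult_distrib fps_const_power power_mult[symmetric] power_add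
        by (simp add: mult_ac)
    qed
    ultimately show ?thesis using False
      unfolding theta_term_def sj a_def[symmetric] by simp
  qed
  ultimately show ?thesis by (simp add: fps_isum_def fps_sum_nth)
qed

section \<open>Identities between Euler quotients and theta functions\<close>

abbreviation (input) "J \<equiv> euler_prod"
text \<open>The quotient that remains, with q replaced by q^2, when phi is split off from 1/J 1 ^ 2;
  see \<open>inverse_euler_sq\<close>.\<close>

abbreviation (input) "\<kappa> \<equiv> euler_prod 2 ^ 2 * inverse (euler_prod 1) ^ 5"

lemma fps_to_fls_eqI: "fps_to_fls f = fps_to_fls g \<Longrightarrow> f = g"
  by simp

lemma euler_prod_nz [simp]: "J k \<noteq> 0"
  using euler_prod_nth_0[of k] by (metis fps_zero_nth zero_neq_one)

lemma euler_prod_fls_nz: "fps_to_fls (J k) \<noteq> 0"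
  using euler_prod_nth_0[of k] by (metis fps_to_fls_eq_0_iff fps_zero_nth zero_neq_one)

lemma euler_prod_fls_inverse: "fps_to_fls (inverse (J k)) = inverse (fps_to_fls (J k))"
  by (simp add: fps_to_fls_inverse)

lemma odd_prod_fls:
  assumes "k > 0"
  shows "fps_to_fls (fps_dil k odd_prod_inf) = fps_to_fls (J (2 * k)) ^ 2 / (fps_to_fls (J k) * fps_to_fls (J (4 * k)))"
proof -
  have "fps_dil k (J 1 * J 4 * odd_prod_inf) = fps_dil k (J 2 * J 2)"
    by (simp only: euler_mult_odd_prod)
  then have "J k * J (4 * k) * fps_dil k odd_prod_inf = J (2 * k) * J (2 * k)"
    using assms by (simp add: fps_dil_mult fps_dil_euler_prod mult.commute)
  then have "fps_to_fls (J k * J (4 * k) * fps_dil k odd_prod_inf) = fps_to_fls (J (2 * k) * J (2 * k))"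
    by (simp only:)
  then show ?thesis
    using euler_prod_fls_nz[of k] euler_prod_fls_nz[of "4 * k"]
    by (simp add: fls_times_fps_to_fls power2_eq_square nonzero_eq_divide_eq mult_ac)
qed

lemma odd_diff_fls:
  assumes "k > 0"
  shows "fps_to_fls (fps_dil k odd_diff_inf) = fps_to_fls (J k) / fps_to_fls (J (2 * k))"
proof -
  have "fps_dil k (odd_diff_inf * J 2) = fps_dil k (J 1)"
    by (simp only: odd_diff_mult_euler)
  then have "fps_dil k odd_diff_inf * J (2 * k) = J k"
    using assms by (simp add: fps_dil_mult fps_dil_euler_prod mult.commute)
  then have "fps_to_fls (fps_dil k odd_diff_inf * J (2 * k)) = fps_to_fls (J k)"
    by (simp only:)
  then show ?thesis
    using euler_prod_fls_nz[of "2 * k"] by (simp add: fls_times_fps_to_fls nonzero_eq_divide_eq)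
qed

lemma phi_fls:
  assumes "k > 0"
  shows "fps_to_fls (fps_dil k phi) = fps_to_fls (J (2 * k)) ^ 5 / (fps_to_fls (J k) * fps_to_fls (J (4 * k))) ^ 2"
proof -
  have "fps_dil k phi = fps_dil k odd_prod_inf * fps_dil k odd_prod_inf * J (2 * k)"
    unfolding phi_eq_prod using assms by (simp add: fps_dil_mult fps_dil_euler_prod mult.commute)
  then show ?thesis
    using euler_prod_fls_nz by (simp add: fls_times_fps_to_fls odd_prod_fls[OF assms] eval_nat_numeral)
qed

lemma psi_fls:
  assumes "k > 0"
  shows "fps_to_fls (fps_dil k psi) = fps_to_fls (J (2 * k)) ^ 2 / fps_to_fls (J k)"
proof -
  have "fps_dil k psi = fps_dil k odd_prod_inf * J (4 * k)"
    unfolding psi_eq_prod using assms by (simp add: fps_dil_mult fps_dil_euler_prod mult.commute)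
  then show ?thesis
    using euler_prod_fls_nz by (simp add: fls_times_fps_to_fls odd_prod_fls[OF assms])
qed

lemma phi_minus_fls: "fps_to_fls phi_minus = fps_to_fls (J 1) ^ 2 / fps_to_fls (J 2)"
  unfolding phi_minus_eq_prod
  using euler_prod_fls_nz odd_diff_fls[of 1] by (simp add: fls_times_fps_to_fls power2_eq_square)

lemmas phi_fls_1 = phi_fls[of 1, simplified fps_dil_one One_nat_def[symmetric] mult_1_right, simplified]
lemmas psi_fls_1 = psi_fls[of 1, simplified fps_dil_one One_nat_def[symmetric] mult_1_right, simplified]

lemmas fls_eval = fls_times_fps_to_fls fps_to_fls_power euler_prod_fls_inverse euler_prod_fls_nz
  phi_fls_1 psi_fls_1 phi_fls psi_fls phi_minus_fls odd_prod_fls odd_diff_fls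

lemmas dil_eval = fps_dil_mult fps_dil_power fps_dil_inverse fps_dil_euler_prod fps_dil_dil

text \<open>Most identities of this group isolate a power of phi and leave a series in q^2, so that
  even and odd parts can be read off from the dissection of phi. In the field of Laurent series they
  reduce to comparing exponents of Euler products.\<close>

lemma inverse_euler_sq: "inverse (J 1) ^ 2 = phi * fps_dil 2 \<kappa>"
  by (rule fps_to_fls_eqI) (simp add: dil_eval fls_eval, simp add: field_simps euler_prod_fls_nz eval_nat_numeral)

lemma psi_sq: "psi ^ 2 = fps_dil 2 psi * phi"
  by (rule fps_to_fls_eqI) (simp add: dil_eval fls_eval, simp add: field_simps euler_prod_fls_nz eval_nat_numeral)

lemma psi_cube_kappa: "psi ^ 3 * \<kappa> = phi ^ 4 * fps_dil 2 (J 2 ^ 8 * inverse (J 1) ^ 12)"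
  by (rule fps_to_fls_eqI) (simp add: dil_eval fls_eval, simp add: field_simps euler_prod_fls_nz eval_nat_numeral)

lemma psi_kappa: "psi * \<kappa> = phi ^ 3 * fps_dil 2 (J 2 ^ 6 * inverse (J 1) ^ 11)"
  by (rule fps_to_fls_eqI) (simp add: dil_eval fls_eval, simp add: field_simps euler_prod_fls_nz eval_nat_numeral)

text \<open>Brings in phi(-q)^2, whose dissection differs from that of phi(q)^2 only by a sign; this
  makes the series \<open>series_A\<close> and \<open>series_B\<close> below comparable.\<close>

lemma euler_cube_kappa: "J 1 ^ 3 * \<kappa> = psi * \<kappa> * phi_minus ^ 2"
  by (rule fps_to_fls_eqI) (simp add: dil_eval fls_eval, simp add: field_simps euler_prod_fls_nz eval_nat_numeral)

lemma euler_cube_kappa': "J 1 ^ 3 * \<kappa> = phi * fps_dil 2 (J 1 ^ 2 * \<kappa>)"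
  by (rule fps_to_fls_eqI) (simp add: dil_eval fls_eval, simp add: field_simps euler_prod_fls_nz eval_nat_numeral)

lemma phi_psi_kappa: "phi ^ 2 * fps_dil 2 psi ^ 2 * \<kappa> = J 2 ^ 10 * inverse (J 1) ^ 9"
  by (rule fps_to_fls_eqI) (simp add: dil_eval fls_eval, simp add: field_simps euler_prod_fls_nz eval_nat_numeral)


section \<open>The theta quotients at t = 2, -2 and 0\<close>

definition all_prod_inf :: "complex fps" where
  "all_prod_inf = fps_iprod (\<lambda>i. 1 + fps_X ^ Suc i)"

lemma all_prod_mult_euler: "all_prod_inf * J 1 = J 2"
proof -
  have "all_prod_inf * J 1 = fps_iprod (\<lambda>i. (1 + fps_X ^ Suc i) * (1 - fps_X ^ Suc i))"
    unfolding all_prod_inf_def euler_prod_1 qpoch_inf_def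
    by (rule fps_iprod_mult; rule fps_cong_one_minus_X_power' fps_cong_one_plus_X_power'; simp)
  also have "(\<lambda>i. (1 + fps_X ^ Suc i) * (1 - fps_X ^ Suc i) :: complex fps) = (\<lambda>i. 1 - (fps_X ^ 2) ^ Suc i)"
    unfolding power_mult[symmetric] mult_2 power_add[of _ "Suc _" "Suc _"] by (simp add: algebra_simps)
  finally show ?thesis by (simp only: euler_prod_eq zero_less_numeral qpoch_inf_def)
qed

lemma all_prod_fls: "fps_to_fls (fps_dil 4 all_prod_inf) = fps_to_fls (J 8) / fps_to_fls (J 4)"
proof -
  have "fps_dil 4 (all_prod_inf * J 1) = fps_dil 4 (J 2)"
    by (simp only: all_prod_mult_euler)
  then have "fps_dil 4 all_prod_inf * J 4 = J 8"
    by (simp add: fps_dil_mult fps_dil_euler_prod)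
  then have "fps_to_fls (fps_dil 4 all_prod_inf * J 4) = fps_to_fls (J 8)"
    by (simp only:)
  then show ?thesis
    using euler_prod_fls_nz[of 4] by (simp add: fls_times_fps_to_fls nonzero_eq_divide_eq)
qed

lemma pf_den_2: "pf_den 2 (1, m) = (1 - fps_X ^ m) * (1 - fps_X ^ m :: complex fps)"
  "pf_den 2 (-1, m) = (1 + fps_X ^ m) * (1 + fps_X ^ m :: complex fps)"
  "pf_den (-2) (1, m) = (1 + fps_X ^ m) * (1 + fps_X ^ m :: complex fps)"
  "pf_den (-2) (-1, m) = (1 - fps_X ^ m) * (1 - fps_X ^ m :: complex fps)"
  "pf_den 0 (e, m) = 1 + fps_X ^ (2 * m)"
  unfolding pf_den_def mult_2 power_add
  by (simp_all add: algebra_simps fps_const_neg[symmetric] numeral_fps_const[symmetric] del: fps_const_neg)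

lemma theta_prods:
  "fps_iprod (\<lambda>j. pf_den 2 (1, 2 * j + 1)) = odd_diff_inf * odd_diff_inf"
  "fps_iprod (\<lambda>j. pf_den (-2) (1, 2 * j + 1)) = odd_prod_inf * odd_prod_inf"
  "fps_iprod (\<lambda>k. pf_den 2 (-1, 4 * k + 2)) = fps_dil 2 odd_prod_inf * fps_dil 2 odd_prod_inf"
  "fps_iprod (\<lambda>k. pf_den (-2) (-1, 4 * k + 2)) = fps_dil 2 odd_diff_inf * fps_dil 2 odd_diff_inf"
  "fps_iprod (\<lambda>j. pf_den 0 (1, 2 * j + 1)) = fps_dil 2 odd_prod_inf"
  "fps_iprod (\<lambda>k. pf_den 0 (-1, 4 * k + 2)) = fps_dil 4 odd_prod_inf"
  "fps_iprod (\<lambda>k. pf_den 2 (-1, 4 * k + 4)) = fps_dil 4 all_prod_inf * fps_dil 4 all_prod_inf"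
proof -
  have e: "2 * (2 * i + 1) = 4 * i + 2" "4 * (2 * i + 1) = 2 * (4 * i + 2)" for i :: nat by simp_all
  note c = fps_cong_one_minus_X_power' fps_cong_one_plus_X_power'
  show "fps_iprod (\<lambda>j. pf_den 2 (1, 2 * j + 1)) = odd_diff_inf * odd_diff_inf"
    unfolding pf_den_2 odd_diff_inf_def by (rule fps_iprod_mult[symmetric]; rule c; simp)
  show "fps_iprod (\<lambda>j. pf_den (-2) (1, 2 * j + 1)) = odd_prod_inf * odd_prod_inf"
    unfolding pf_den_2 odd_prod_inf_def by (rule fps_iprod_mult[symmetric]; rule c; simp)
  show "fps_iprod (\<lambda>k. pf_den 2 (-1, 4 * k + 2)) = fps_dil 2 odd_prod_inf * fps_dil 2 odd_prod_inf"
    unfolding pf_den_2 fps_dil_odd_prod[OF zero_less_numeral] e by (rule fps_iprod_mult[symmetric]; rule c; simp)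
  show "fps_iprod (\<lambda>k. pf_den (-2) (-1, 4 * k + 2)) = fps_dil 2 odd_diff_inf * fps_dil 2 odd_diff_inf"
    unfolding pf_den_2 fps_dil_odd_diff[OF zero_less_numeral] e by (rule fps_iprod_mult[symmetric]; rule c; simp)
  show "fps_iprod (\<lambda>j. pf_den 0 (1, 2 * j + 1)) = fps_dil 2 odd_prod_inf"
    unfolding pf_den_2 fps_dil_odd_prod[OF zero_less_numeral] ..
  show "fps_iprod (\<lambda>k. pf_den 0 (-1, 4 * k + 2)) = fps_dil 4 odd_prod_inf"
    unfolding pf_den_2 fps_dil_odd_prod[OF zero_less_numeral] e ..
  have "fps_dil 4 all_prod_inf = fps_iprod (\<lambda>i. 1 + fps_X ^ (4 * i + 4))"
    unfolding all_prod_inf_def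
  proof (subst fps_dil_iprod)
    show "fps_cong (Suc j) (1 + fps_X ^ Suc j :: complex fps) 1" for j
      by (rule fps_cong_one_plus_X_power') simp
    have "4 * Suc i = 4 * i + 4" for i by simp
    then show "fps_iprod (\<lambda>j. fps_dil 4 (1 + fps_X ^ Suc j)) = fps_iprod (\<lambda>i. 1 + fps_X ^ (4 * i + 4) :: complex fps)"
      by (simp only: fps_dil_add fps_dil_1 fps_dil_X_power[OF zero_less_numeral])
  qed simp
  then show "fps_iprod (\<lambda>k. pf_den 2 (-1, 4 * k + 4)) = fps_dil 4 all_prod_inf * fps_dil 4 all_prod_inf"
    unfolding pf_den_2 by (simp only:) (rule fps_iprod_mult[symmetric]; rule c; simp)
qed

lemma fls_odd_prod_1: "fps_to_fls odd_prod_inf = fps_to_fls (J 2) ^ 2 / (fps_to_fls (J 1) * fps_to_fls (J 4))"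
  using odd_prod_fls[of 1] by simp

lemma fls_odd_diff_1: "fps_to_fls odd_diff_inf = fps_to_fls (J 1) / fps_to_fls (J 2)"
  using odd_diff_fls[of 1] by simp

text \<open>Each of the quotients at t = 2, -2, 0 is a power of phi (the second, the zeroth, the
  first) times a series in q^2, the form needed for dissecting.\<close>

lemma theta_even_2: "theta_even 2 = phi ^ 2 * fps_dil 2 (fps_dil 2 psi * inverse (J 1) ^ 2)"
  unfolding theta_even_def theta_prods theta_const_def
  by (rule fps_to_fls_eqI) (simp add: dil_eval fls_eval fps_to_fls_inverse fls_odd_prod_1 fls_odd_diff_1,
      simp add: field_simps euler_prod_fls_nz eval_nat_numeral)

lemma theta_even_minus_2: "theta_even (-2) = fps_dil 2 (J 2 ^ 3 * inverse (J 1) ^ 2)"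
  unfolding theta_even_def theta_prods theta_const_def
  by (rule fps_to_fls_eqI) (simp add: dil_eval fls_eval fps_to_fls_inverse fls_odd_prod_1 fls_odd_diff_1,
      simp add: field_simps euler_prod_fls_nz eval_nat_numeral)

lemma theta_even_0: "theta_even 0 = phi * fps_dil 8 (J 2 * inverse (J 1))"
  unfolding theta_even_def theta_prods theta_const_def
  by (rule fps_to_fls_eqI) (simp add: dil_eval fls_eval fps_to_fls_inverse fls_odd_prod_1 fls_odd_diff_1,
      simp add: field_simps euler_prod_fls_nz eval_nat_numeral)

text \<open>The factor 4 clears 1/(2 + t) at t = 2.\<close>

lemma theta_odd_2: "4 * theta_odd 2 = phi ^ 2 * fps_dil 2 (phi * inverse (J 1) ^ 2)"
proof -
  have u: "fps_const (2 + 2 :: complex) = 4" by (simp add: numeral_fps_const)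
  have a0: "all_prod_inf $ 0 = 1" by (simp add: all_prod_inf_def fps_iprod_nth_0)
  have f4: "fps_to_fls (4 :: complex fps) = 4" "(4 :: complex fls) \<noteq> 0" by simp_all
  show ?thesis
    unfolding theta_odd_def theta_prods theta_const_def u
    by (rule fps_to_fls_eqI) (simp add: dil_eval fls_eval fps_to_fls_inverse fls_odd_prod_1 fls_odd_diff_1 all_prod_fls a0,
        simp add: field_simps euler_prod_fls_nz eval_nat_numeral)
qed

text \<open>The hypothesis reduces each coefficient to one of half the index, and the constant one
  to its own negative.\<close>

lemma fps_eq_0_if_neg_dil:
  assumes "f = - fps_dil 2 (f :: complex fps)"
  shows "f = 0"
proof (rule fps_ext)
  fix n
  have c: "f $ n = - (if even n then f $ (n div 2) else 0)" for n
    by (subst assms) (simp add: fps_dil_nth)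
  show "f $ n = 0 $ n"
  proof (induction n rule: less_induct)
    case (less n)
    show ?case
    proof (cases "n = 0")
      case True
      then show ?thesis using c[of 0] by simp
    next
      case False
      then show ?thesis using c[of n] less[of "n div 2"] by (auto split: if_splits)
    qed
  qed
qed

text \<open>The defect of the identity changes sign under q -> q^2, hence is zero: insert the
  dissection of phi and psi(q^4)^2 = psi(q^8) phi(q^4).\<close>

lemma phi_sq_split: "phi ^ 2 = fps_dil 2 (phi ^ 2) + 4 * fps_X * fps_dil 2 (fps_dil 2 psi ^ 2)"
proof -
  define a where "a = fps_dil 4 phi"
  define b where "b = fps_dil 8 psi"
  define c where "c = fps_dil 4 psi"
  define \<delta> where "\<delta> = phi ^ 2 - fps_dil 2 phi ^ 2 - 4 * fps_X * c ^ 2"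
  have d2: "fps_dil 2 \<delta> = fps_dil 2 phi ^ 2 - a ^ 2 - 4 * fps_X ^ 2 * b ^ 2"
    unfolding \<delta>_def a_def b_def c_def
    by (simp add: fps_dil_diff fps_dil_mult fps_dil_power fps_dil_dil fps_dil_X)
  have "fps_dil 4 (psi ^ 2) = fps_dil 4 (fps_dil 2 psi * phi)" by (simp only: psi_sq)
  then have c2: "c ^ 2 = b * a"
    by (simp add: fps_dil_power fps_dil_mult fps_dil_dil a_def b_def c_def)
  have "phi = a + 2 * fps_X * b" using phi_split by (simp only: a_def b_def)
  then have "\<delta> = (a + 2 * fps_X * b) ^ 2 - fps_dil 2 phi ^ 2 - 4 * fps_X * (b * a)"
    unfolding \<delta>_def c2 by metis
  also have "\<dots> = - fps_dil 2 \<delta>"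
    unfolding d2 by (simp add: power2_eq_square algebra_simps)
  finally have "\<delta> = 0" by (rule fps_eq_0_if_neg_dil)
  then have "phi ^ 2 = fps_dil 2 phi ^ 2 + 4 * fps_X * c ^ 2"
    unfolding \<delta>_def diff_diff_eq by (simp only: right_minus_eq)
  moreover have "fps_dil 2 (phi ^ 2) = fps_dil 2 phi ^ 2" "fps_dil 2 (fps_dil 2 psi ^ 2) = c ^ 2"
    by (simp_all add: fps_dil_power fps_dil_dil c_def)
  ultimately show ?thesis by (simp only:)
qed

lemma phi_minus_sq_split: "phi_minus ^ 2 = fps_dil 2 (phi ^ 2) - 4 * fps_X * fps_dil 2 (fps_dil 2 psi ^ 2)"
proof -
  define a where "a = fps_dil 4 phi"
  define b where "b = fps_dil 8 psi"
  have "fps_dil 4 (psi ^ 2) = fps_dil 4 (fps_dil 2 psi * phi)" by (simp only: psi_sq)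
  then have c2: "fps_dil 4 psi ^ 2 = b * a"
    by (simp add: fps_dil_power fps_dil_mult fps_dil_dil a_def b_def)
  have "phi = a + 2 * fps_X * b" "phi_minus = a - 2 * fps_X * b"
    using phi_split phi_minus_split by (simp_all only: a_def b_def)
  moreover have "(a - 2 * fps_X * b) ^ 2 = (a + 2 * fps_X * b) ^ 2 - 8 * fps_X * (b * a)"
    by (simp add: power2_eq_square algebra_simps)
  ultimately have "phi_minus ^ 2 = phi ^ 2 - 8 * fps_X * fps_dil 4 psi ^ 2"
    by (simp only: c2)
  moreover have "fps_dil 2 (fps_dil 2 psi ^ 2) = fps_dil 4 psi ^ 2"
    by (simp add: fps_dil_power fps_dil_dil)
  moreover have "P + 4 * fps_X * Q - 8 * fps_X * Q = P - 4 * fps_X * Q" for P Q :: "complex fps"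
    by (simp add: algebra_simps)
  ultimately show ?thesis using phi_sq_split by metis
qed

section \<open>Even and odd parts\<close>

definition fps_even :: "complex fps \<Rightarrow> complex fps" where
  "fps_even f = Abs_fps (\<lambda>n. f $ (2 * n))"

definition fps_odd :: "complex fps \<Rightarrow> complex fps" where
  "fps_odd f = Abs_fps (\<lambda>n. f $ (2 * n + 1))"

lemma fps_even_nth: "fps_even f $ n = f $ (2 * n)"
  and fps_odd_nth: "fps_odd f $ n = f $ (2 * n + 1)"
  by (simp_all add: fps_even_def fps_odd_def)

lemma fps_even_odd_unique:
  "fps_even (fps_dil 2 a + fps_X * fps_dil 2 b) = a" "fps_odd (fps_dil 2 a + fps_X * fps_dil 2 b) = b"
proof -
  have e: "(fps_X * fps_dil 2 b) $ (2 * n) = 0" for n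
  proof (cases n)
    case (Suc m)
    then have "2 * n = Suc (2 * m + 1)" by simp
    then show ?thesis by (simp only: fps_X_mult_nth) (simp add: fps_dil_nth)
  qed simp
  show "fps_even (fps_dil 2 a + fps_X * fps_dil 2 b) = a"
    unfolding fps_even_def by (rule fps_ext) (simp add: e, simp add: fps_dil_nth)
  show "fps_odd (fps_dil 2 a + fps_X * fps_dil 2 b) = b"
    unfolding fps_odd_def by (rule fps_ext) (simp add: fps_dil_nth)
qed

lemma fps_even_odd_split: "f = fps_dil 2 (fps_even f) + fps_X * fps_dil 2 (fps_odd f)"
proof (rule fps_ext)
  fix n
  show "f $ n = (fps_dil 2 (fps_even f) + fps_X * fps_dil 2 (fps_odd f)) $ n"
  proof (cases "even n")
    case True
    then obtain m where m: "n = 2 * m" by blast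
    have "(fps_dil 2 (fps_even f) + fps_X * fps_dil 2 (fps_odd f)) $ (2 * m)
        = fps_even (fps_dil 2 (fps_even f) + fps_X * fps_dil 2 (fps_odd f)) $ m"
      by (simp only: fps_even_nth)
    also have "\<dots> = fps_even f $ m" by (simp only: fps_even_odd_unique)
    finally show ?thesis by (simp add: m fps_even_def)
  next
    case False
    then obtain m where m: "n = 2 * m + 1" by (rule oddE)
    show ?thesis by (simp add: m fps_odd_def fps_dil_nth)
  qed
qed

lemma fps_even_mult: "fps_even (f * g) = fps_even f * fps_even g + fps_X * (fps_odd f * fps_odd g)"
  and fps_odd_mult: "fps_odd (f * g) = fps_even f * fps_odd g + fps_odd f * fps_even g"
proof -
  define a b c d where "a = fps_even f" and "b = fps_odd f" and "c = fps_even g" and "d = fps_odd g"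
  have "f * g = (fps_dil 2 a + fps_X * fps_dil 2 b) * (fps_dil 2 c + fps_X * fps_dil 2 d)"
    using fps_even_odd_split[of f] fps_even_odd_split[of g] by (simp only: a_def b_def c_def d_def)
  also have "\<dots> = fps_dil 2 (a * c + fps_X * (b * d)) + fps_X * fps_dil 2 (a * d + b * c)"
    by (simp add: fps_dil_add fps_dil_mult fps_dil_X power2_eq_square algebra_simps)
  finally have eq: "f * g = fps_dil 2 (a * c + fps_X * (b * d)) + fps_X * fps_dil 2 (a * d + b * c)" .
  show "fps_even (f * g) = fps_even f * fps_even g + fps_X * (fps_odd f * fps_odd g)"
    "fps_odd (f * g) = fps_even f * fps_odd g + fps_odd f * fps_even g"
    unfolding eq fps_even_odd_unique by (simp_all only: a_def b_def c_def d_def)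
qed

lemma fps_even_dil [simp]: "fps_even (fps_dil 2 g) = g" and fps_odd_dil [simp]: "fps_odd (fps_dil 2 g) = 0"
  using fps_even_odd_unique[of g 0] by simp_all

text \<open>The extraction rule behind all dissections below.\<close>

lemma fps_even_mult_dil: "fps_even (f * fps_dil 2 g) = fps_even f * g"
  and fps_odd_mult_dil: "fps_odd (f * fps_dil 2 g) = fps_odd f * g"
  by (simp_all add: fps_even_mult fps_odd_mult)

lemma fps_odd_add: "fps_odd (f + g) = fps_odd f + fps_odd g"
  and fps_odd_diff: "fps_odd (f - g) = fps_odd f - fps_odd g"
  and fps_even_diff: "fps_even (f - g) = fps_even f - fps_even g"
  and fps_odd_const_mult: "fps_odd (fps_const c * f) = fps_const c * fps_odd f"
  by (simp_all add: fps_even_def fps_odd_def fps_eq_iff)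

lemma fps_odd_numeral_mult: "fps_odd (numeral k * f) = numeral k * fps_odd f"
  unfolding numeral_fps_const by (rule fps_odd_const_mult)

lemma psi_2_sq: "fps_dil 2 psi ^ 2 = fps_dil 4 psi * fps_dil 2 phi"
proof -
  have "fps_dil 2 (psi ^ 2) = fps_dil 2 (fps_dil 2 psi * phi)" by (simp only: psi_sq)
  then show ?thesis by (simp add: fps_dil_power fps_dil_mult fps_dil_dil)
qed

lemma phi_sq_eq: "phi ^ 2 = fps_dil 2 phi ^ 2 + 4 * fps_X * fps_dil 4 psi ^ 2"
  and phi_minus_sq_eq: "phi_minus ^ 2 = fps_dil 2 phi ^ 2 - 4 * fps_X * fps_dil 4 psi ^ 2"
proof -
  have "fps_dil 2 (phi ^ 2) = fps_dil 2 phi ^ 2" "fps_dil 2 (fps_dil 2 psi ^ 2) = fps_dil 4 psi ^ 2"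
    by (simp_all add: fps_dil_power fps_dil_dil)
  then show "phi ^ 2 = fps_dil 2 phi ^ 2 + 4 * fps_X * fps_dil 4 psi ^ 2"
    "phi_minus ^ 2 = fps_dil 2 phi ^ 2 - 4 * fps_X * fps_dil 4 psi ^ 2"
    using phi_sq_split phi_minus_sq_split by simp_all
qed

lemma phi_even: "fps_even phi = fps_dil 2 phi" and phi_odd: "fps_odd phi = 2 * fps_dil 4 psi"
proof -
  have "phi = fps_dil 2 (fps_dil 2 phi) + fps_X * fps_dil 2 (2 * fps_dil 4 psi)"
    using phi_split by (simp add: fps_dil_dil fps_dil_mult mult_ac)
  then show "fps_even phi = fps_dil 2 phi" "fps_odd phi = 2 * fps_dil 4 psi"
    using fps_even_odd_unique[of "fps_dil 2 phi" "2 * fps_dil 4 psi"] by simp_all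
qed

lemma phi_sq_even: "fps_even (phi ^ 2) = phi ^ 2" and phi_sq_odd: "fps_odd (phi ^ 2) = 4 * fps_dil 2 psi ^ 2"
proof -
  have "phi ^ 2 = fps_dil 2 (phi ^ 2) + fps_X * fps_dil 2 (4 * fps_dil 2 psi ^ 2)"
    using phi_sq_split by (simp add: fps_dil_mult mult_ac)
  then show "fps_even (phi ^ 2) = phi ^ 2" "fps_odd (phi ^ 2) = 4 * fps_dil 2 psi ^ 2"
    using fps_even_odd_unique[of "phi ^ 2" "4 * fps_dil 2 psi ^ 2"] by simp_all
qed

lemma phi_cube_even: "fps_even (phi ^ 3) = phi ^ 2 * fps_dil 2 phi + 8 * fps_X * (fps_dil 2 psi ^ 2 * fps_dil 4 psi)"
  and phi_cube_odd: "fps_odd (phi ^ 3) = 2 * (phi ^ 2 * fps_dil 4 psi + 2 * (fps_dil 2 psi ^ 2 * fps_dil 2 phi))"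
proof -
  have "phi ^ 3 = phi ^ 2 * phi" by (simp add: eval_nat_numeral)
  then show "fps_even (phi ^ 3) = phi ^ 2 * fps_dil 2 phi + 8 * fps_X * (fps_dil 2 psi ^ 2 * fps_dil 4 psi)"
    "fps_odd (phi ^ 3) = 2 * (phi ^ 2 * fps_dil 4 psi + 2 * (fps_dil 2 psi ^ 2 * fps_dil 2 phi))"
    by (simp_all add: fps_even_mult fps_odd_mult phi_sq_even phi_sq_odd phi_even phi_odd algebra_simps)
qed

lemma phi_fourth_odd: "fps_odd (phi ^ 4) = 8 * (phi ^ 2 * fps_dil 2 psi ^ 2)"
proof -
  have "phi ^ 4 = phi ^ 2 * phi ^ 2" by (simp flip: power_add)
  then show ?thesis by (simp only: fps_odd_mult phi_sq_even phi_sq_odd) (simp add: algebra_simps)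
qed

section \<open>The series for n congruent to 1 and 3 modulo 4\<close>

definition series_A :: "complex fps" where "series_A = phi ^ 2 * (fps_dil 2 psi * inverse (J 1) ^ 2)"
definition series_B :: "complex fps" where "series_B = J 2 ^ 3 * inverse (J 1) ^ 2"
definition series_D :: "complex fps" where "series_D = fps_dil 2 psi ^ 3 * inverse (J 1) ^ 2"

text \<open>The origin of the three series: A and B are the even parts at t = 2 and t = -2, and D is
  a quarter of the odd part at t = 2.\<close>

lemma theta_even_2_even: "fps_even (theta_even 2) = series_A"
  and theta_even_2_odd: "fps_odd (theta_even 2) = 4 * series_D"
  unfolding theta_even_2 series_A_def series_D_def
  unfolding fps_even_mult_dil fps_odd_mult_dil phi_sq_even phi_sq_odd
  by (simp_all add: eval_nat_numeral mult_ac)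

lemma theta_even_minus_2_even: "fps_even (theta_even (-2)) = series_B"
  and theta_even_minus_2_odd: "fps_odd (theta_even (-2)) = 0"
  unfolding theta_even_minus_2 series_B_def by simp_all

lemma series_A_eq: "series_A = phi ^ 3 * fps_dil 2 (psi * \<kappa>)"
proof -
  have "phi ^ 3 = phi ^ 2 * phi" by (simp add: eval_nat_numeral)
  then show ?thesis unfolding series_A_def inverse_euler_sq fps_dil_mult[of 2 psi, OF zero_less_numeral] by (simp only: mult_ac)
qed

lemma series_B_eq: "series_B = phi * fps_dil 2 (J 1 ^ 3 * \<kappa>)"
proof -
  have "fps_dil 2 (J 1 ^ 3) = J 2 ^ 3" by (simp add: fps_dil_power fps_dil_euler_prod)
  then show ?thesis unfolding series_B_def inverse_euler_sq fps_dil_mult[of 2 "J 1 ^ 3", OF zero_less_numeral] by (simp only: mult_ac)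
qed

lemma series_D_eq: "series_D = phi * fps_dil 2 (psi ^ 3 * \<kappa>)"
proof -
  have "fps_dil 2 (psi ^ 3) = fps_dil 2 psi ^ 3" by (simp add: fps_dil_power)
  then show ?thesis unfolding series_D_def inverse_euler_sq fps_dil_mult[of 2 "psi ^ 3", OF zero_less_numeral] by (simp only: mult_ac)
qed

text \<open>phi(q)^2 and phi(-q)^2 share the part phi(q^2)^2, which cancels here; the q psi(q^4)^2
  parts add up to 4 + 8 + 4 = 16.\<close>

lemma series_diff_even: "fps_even (series_A - series_B) = 16 * (fps_X * fps_dil 4 psi ^ 2 * fps_dil 2 phi * (psi * \<kappa>))"
proof -
  define k where "k = psi * \<kappa>"
  define p2 where "p2 = fps_dil 2 phi"
  define s4 where "s4 = fps_dil 4 psi"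
  have "fps_even (series_A - series_B) = fps_even (phi ^ 3) * k - p2 * (k * phi_minus ^ 2)"
    unfolding fps_even_diff series_A_eq series_B_eq fps_even_mult_dil phi_even euler_cube_kappa k_def p2_def ..
  also have "\<dots> = ((p2 ^ 2 + 4 * fps_X * s4 ^ 2) * p2 + 8 * fps_X * (s4 * p2 * s4)) * k - p2 * (k * (p2 ^ 2 - 4 * fps_X * s4 ^ 2))"
    unfolding phi_cube_even phi_minus_sq_eq phi_sq_eq psi_2_sq p2_def s4_def ..
  also have "\<dots> = 16 * (fps_X * s4 ^ 2 * p2 * k)"
    by (simp add: power2_eq_square algebra_simps)
  finally show ?thesis by (simp only: k_def p2_def s4_def)
qed

text \<open>Here the terms with psi(q^4)^3 cancel, and the others add up to 2 + 4 + 2 = 8.\<close>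

lemma series_sum_odd: "fps_odd (series_A + series_B) = 8 * (fps_dil 4 psi * fps_dil 2 phi ^ 2 * (psi * \<kappa>))"
proof -
  define k where "k = psi * \<kappa>"
  define p2 where "p2 = fps_dil 2 phi"
  define s4 where "s4 = fps_dil 4 psi"
  have "fps_odd (series_A + series_B) = fps_odd (phi ^ 3) * k + 2 * s4 * (k * phi_minus ^ 2)"
    unfolding fps_odd_add series_A_eq series_B_eq fps_odd_mult_dil phi_odd euler_cube_kappa k_def s4_def ..
  also have "\<dots> = 2 * ((p2 ^ 2 + 4 * fps_X * s4 ^ 2) * s4 + 2 * (s4 * p2 * p2)) * k + 2 * s4 * (k * (p2 ^ 2 - 4 * fps_X * s4 ^ 2))"
    unfolding phi_cube_odd phi_minus_sq_eq phi_sq_eq psi_2_sq p2_def s4_def ..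
  also have "\<dots> = 8 * (s4 * p2 ^ 2 * k)"
    by (simp add: power2_eq_square algebra_simps)
  finally show ?thesis by (simp only: k_def p2_def s4_def)
qed

lemma series_sum_odd_odd: "fps_odd (fps_odd (series_A + series_B)) = 16 * (fps_dil 2 psi * phi ^ 2 *
    (phi ^ 2 * fps_dil 4 psi + 2 * (fps_dil 2 psi ^ 2 * fps_dil 2 phi)) * (J 2 ^ 6 * inverse (J 1) ^ 11))"
proof -
  have "fps_dil 4 psi * fps_dil 2 phi ^ 2 * (psi * \<kappa>) = (psi * \<kappa>) * fps_dil 2 (fps_dil 2 psi * phi ^ 2)"
    by (simp add: fps_dil_mult fps_dil_power fps_dil_dil)
  then have "fps_odd (fps_odd (series_A + series_B)) = 8 * (fps_odd (psi * \<kappa>) * (fps_dil 2 psi * phi ^ 2))"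
    unfolding series_sum_odd by (simp only: fps_odd_numeral_mult fps_odd_mult_dil)
  also have "fps_odd (psi * \<kappa>) = fps_odd (phi ^ 3) * (J 2 ^ 6 * inverse (J 1) ^ 11)"
    unfolding psi_kappa fps_odd_mult_dil ..
  finally show ?thesis unfolding phi_cube_odd by (simp add: mult_ac)
qed

text \<open>Gives access to A - B, as (A + B) - 2B, in the class 16n + 13.\<close>

lemma series_B_odd_odd: "fps_odd (fps_odd series_B) = 4 * (fps_dil 2 psi * fps_dil 4 psi * (J 1 ^ 2 * \<kappa>))"
proof -
  have "fps_odd series_B = 2 * ((J 1 ^ 3 * \<kappa>) * fps_dil 2 (fps_dil 2 psi))"
    unfolding series_B_eq fps_odd_mult_dil phi_odd by (simp add: fps_dil_dil mult_ac)
  then have "fps_odd (fps_odd series_B) = 2 * (fps_odd (J 1 ^ 3 * \<kappa>) * fps_dil 2 psi)"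
    by (simp only: fps_odd_numeral_mult fps_odd_mult_dil)
  also have "fps_odd (J 1 ^ 3 * \<kappa>) = 2 * fps_dil 4 psi * (J 1 ^ 2 * \<kappa>)"
    unfolding euler_cube_kappa' fps_odd_mult_dil phi_odd ..
  finally show ?thesis by (simp add: mult_ac)
qed

lemma psi_cube_kappa_odd: "fps_odd (psi ^ 3 * \<kappa>) = 8 * (phi ^ 2 * fps_dil 2 psi ^ 2 * (J 2 ^ 8 * inverse (J 1) ^ 12))"
  unfolding psi_cube_kappa fps_odd_mult_dil phi_fourth_odd by (simp add: mult_ac)

lemma series_D_odd: "fps_odd series_D = 2 * (fps_dil 4 psi * (psi ^ 3 * \<kappa>))"
  unfolding series_D_eq fps_odd_mult_dil phi_odd by (simp add: mult_ac)

lemma series_D_odd_even: "fps_odd (fps_even series_D) = 8 * (phi * (phi ^ 2 * fps_dil 2 psi ^ 2 * (J 2 ^ 8 * inverse (J 1) ^ 12)))"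
proof -
  have "fps_even series_D = (psi ^ 3 * \<kappa>) * fps_dil 2 phi"
    unfolding series_D_eq fps_even_mult_dil phi_even by (simp add: mult_ac)
  then show ?thesis by (simp only: fps_odd_mult_dil psi_cube_kappa_odd) (simp add: mult_ac)
qed

lemma series_D_odd_odd: "fps_odd (fps_odd series_D) = 16 * (fps_dil 2 psi * (phi ^ 2 * fps_dil 2 psi ^ 2 * (J 2 ^ 8 * inverse (J 1) ^ 12)))"
proof -
  have "fps_odd series_D = 2 * ((psi ^ 3 * \<kappa>) * fps_dil 2 (fps_dil 2 psi))"
    unfolding series_D_odd by (simp add: fps_dil_dil mult_ac)
  then show ?thesis by (simp only: fps_odd_numeral_mult fps_odd_mult_dil psi_cube_kappa_odd) (simp add: mult_ac)
qed

lemma theta_odd_2_odd_odd: "fps_odd (fps_odd (4 * theta_odd 2)) = 16 * (fps_dil 2 psi ^ 2 * (psi ^ 2 * \<kappa>))"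
proof -
  have "fps_odd (4 * theta_odd 2) = 4 * (phi ^ 2 * fps_dil 2 (psi ^ 2 * \<kappa>))"
    unfolding theta_odd_2 fps_odd_mult_dil phi_sq_odd inverse_euler_sq
    by (simp add: power2_eq_square fps_dil_mult mult_ac)
  then show ?thesis by (simp only: fps_odd_numeral_mult fps_odd_mult_dil phi_sq_odd) (simp add: mult_ac)
qed

text \<open>The Euler quotient is kept in closed form because it is \<open>J 1\<close> times the
  tenth power of J 2/J 1, and fifth powers reduce modulo 5 to series in q^5.\<close>

lemma theta_odd_2_odd_even: "fps_odd (fps_even (4 * theta_odd 2)) = 8 * (J 2 ^ 10 * inverse (J 1) ^ 9)"
proof -
  have "fps_even (4 * theta_odd 2) = phi ^ 4 * fps_dil 2 \<kappa>"
    unfolding theta_odd_2 fps_even_mult_dil phi_sq_even inverse_euler_sq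
    by (simp add: eval_nat_numeral mult_ac)
  then show ?thesis
    unfolding phi_psi_kappa[symmetric] by (simp only: fps_odd_mult_dil phi_fourth_odd) (simp only: mult_ac)
qed

section \<open>Integrality and coefficient extraction\<close>

definition int_fps :: "complex fps \<Rightarrow> bool" where
  "int_fps f \<longleftrightarrow> (\<forall>n. f $ n \<in> \<int>)"

lemma int_fps_add: "int_fps f \<Longrightarrow> int_fps g \<Longrightarrow> int_fps (f + g)"
  and int_fps_diff: "int_fps f \<Longrightarrow> int_fps g \<Longrightarrow> int_fps (f - g)"
  and int_fps_mult: "int_fps f \<Longrightarrow> int_fps g \<Longrightarrow> int_fps (f * g)"
  and int_fps_X: "int_fps fps_X"
  and int_fps_numeral: "int_fps (numeral k)"
  and int_fps_1: "int_fps 1"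
  by (auto simp: int_fps_def fps_mult_nth fps_numeral_nth intro!: Ints_sum)

lemma int_fps_power: "int_fps f \<Longrightarrow> int_fps (f ^ n)"
  by (induction n) (auto intro: int_fps_mult int_fps_1)

lemma int_fps_dil: "k > 0 \<Longrightarrow> int_fps f \<Longrightarrow> int_fps (fps_dil k f)"
  by (auto simp: int_fps_def fps_dil_nth)

lemma int_fps_prod: "(\<And>i. i \<in> A \<Longrightarrow> int_fps (f i)) \<Longrightarrow> int_fps (prod f A)"
  by (induction A rule: infinite_finite_induct) (auto intro: int_fps_mult int_fps_1)

lemma int_fps_inverse:
  assumes f: "int_fps f" "f $ 0 = 1"
  shows "int_fps (inverse f)"
  unfolding int_fps_def
proof
  fix n
  show "inverse f $ n \<in> \<int>"
  proof (induction n rule: less_induct)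
    case (less n)
    show ?case
    proof (cases "n = 0")
      case False
      have "f * inverse f = 1" using f by (intro inverse_mult_eq_1') simp
      then have "(f * inverse f) $ n = 0" using False by simp
      then have "f $ 0 * inverse f $ n + (\<Sum>i=1..n. f $ i * inverse f $ (n - i)) = 0"
        by (simp add: fps_mult_nth sum.atLeast_Suc_atMost)
      then have "inverse f $ n = - (\<Sum>i=1..n. f $ i * inverse f $ (n - i))"
        using f by (simp add: add_eq_0_iff)
      moreover have "(\<Sum>i=1..n. f $ i * inverse f $ (n - i)) \<in> \<int>"
        using f less False by (intro Ints_sum Ints_mult) (auto simp: int_fps_def)
      ultimately show ?thesis by simp
    qed (use f in simp)
  qed
qed

lemma int_fps_euler_prod:
  assumes "k > 0"
  shows "int_fps (J k)"
proof -
  have "(\<Prod>j\<le>n. 1 - fps_X ^ Suc j :: complex fps) $ n \<in> \<int>" for n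
  proof -
    have "int_fps (\<Prod>j\<le>n. 1 - fps_X ^ Suc j :: complex fps)"
      by (intro int_fps_prod int_fps_diff int_fps_1 int_fps_power int_fps_X)
    then show ?thesis by (simp only: int_fps_def)
  qed
  then have "int_fps (qpoch_inf fps_X)"
    unfolding int_fps_def qpoch_inf_def fps_iprod_def by simp
  then show ?thesis unfolding euler_prod_def by (rule int_fps_dil[OF assms])
qed

lemma int_fps_inverse_euler_prod: "k > 0 \<Longrightarrow> int_fps (inverse (J k))"
  by (intro int_fps_inverse int_fps_euler_prod) auto

lemma int_fps_phi: "int_fps phi"
  unfolding phi_eq_isum fps_isum_def int_fps_def
  by (auto simp: fps_sum_nth intro!: Ints_sum)

lemma int_fps_psi: "int_fps psi"
  unfolding psi_def fps_isum_def int_fps_def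
  by (auto simp: fps_sum_nth intro!: Ints_sum)

lemmas int_fps_intros = int_fps_add int_fps_mult int_fps_power int_fps_dil int_fps_X int_fps_numeral
  int_fps_euler_prod int_fps_inverse_euler_prod int_fps_phi int_fps_psi

lemma numeral_mult_nth: "(numeral k * f) $ n = numeral k * (f :: complex fps) $ n"
  unfolding numeral_fps_const by simp

text \<open>The generating functions live over the complex numbers; this carries a factorisation of
  a coefficient back to a congruence.\<close>

lemma cong_0_of_Ints:
  assumes "of_nat N = (numeral m :: complex) * x" "x \<in> \<int>"
  shows "[N = 0] (mod numeral m)"
proof -
  obtain k where "x = of_int k" using assms(2) by (auto elim: Ints_cases)
  then have "(of_int (int N) :: complex) = of_int (numeral m * k)" using assms(1) by simp
  then have "int N = numeral m * k" by (simp only: of_int_eq_iff)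
  then have "int (numeral m) dvd int N" by simp
  then have "numeral m dvd N" by (simp only: int_dvd_int_iff)
  then show ?thesis by (simp add: cong_0_iff)
qed

section \<open>Reduction modulo 5\<close>

lemma fps_cong_power: "fps_cong K f g \<Longrightarrow> fps_cong K (f ^ n) (g ^ n)"
  by (induction n) (auto intro: fps_cong_mult)

text \<open>Factor by factor (1 - y)^5 is 1 - y^5 modulo 5. The congruence is expressed by an
  integral correction, first for finite products.\<close>

lemma euler_prod_fifth_power: "\<exists>h. int_fps h \<and> J 1 ^ 5 = J 5 + 5 * h"
proof -
  have fin: "\<exists>h. int_fps h \<and> qpoch fps_X n ^ 5 = qpoch (fps_X ^ 5) n + 5 * h" for n
  proof (induction n)
    case 0
    have "int_fps (0 :: complex fps)" by (simp add: int_fps_def)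
    then show ?case by (intro exI[of _ 0]) simp
  next
    case (Suc n)
    then obtain h where h: "int_fps h" "qpoch fps_X n ^ 5 = qpoch (fps_X ^ 5) n + 5 * h" by blast
    define y where "y = (fps_X ^ Suc n :: complex fps)"
    define Q where "Q = qpoch (fps_X ^ 5 :: complex fps) n"
    define w where "w = 2 * y ^ 2 + y ^ 4 - (y + 2 * y ^ 3)"
    have y5: "(fps_X ^ 5) ^ Suc n = y ^ 5" unfolding y_def power_mult[symmetric] by (simp only: mult.commute)
    have "(1 - y) ^ 5 = 1 - y ^ 5 + 5 * w"
      by (simp add: w_def eval_nat_numeral algebra_simps)
    then have "qpoch fps_X (Suc n) ^ 5 = (Q + 5 * h) * (1 - y ^ 5 + 5 * w)"
      unfolding qpoch_Suc power_mult_distrib h(2) y_def[symmetric] Q_def by (simp only:)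
    also have "\<dots> = Q * (1 - y ^ 5) + 5 * (Q * w + h * (1 - y ^ 5 + 5 * w))"
      by (simp add: algebra_simps)
    finally have E: "qpoch fps_X (Suc n) ^ 5 = qpoch (fps_X ^ 5) (Suc n) + 5 * (Q * w + h * (1 - y ^ 5 + 5 * w))"
      unfolding qpoch_Suc y5 Q_def .
    have "int_fps y" unfolding y_def by (intro int_fps_intros)
    then have "int_fps w" unfolding w_def by (intro int_fps_diff int_fps_intros)
    moreover have "int_fps Q"
      unfolding Q_def qpoch_def by (intro int_fps_prod int_fps_diff int_fps_intros int_fps_1)
    ultimately have "int_fps (Q * w + h * (1 - y ^ 5 + 5 * w))"
      using h(1) \<open>int_fps y\<close> by (intro int_fps_intros int_fps_diff int_fps_1)
    with E show ?case by blast
  qed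
  then obtain h where h: "\<And>n. int_fps (h n)" "\<And>n. qpoch fps_X n ^ 5 = qpoch (fps_X ^ 5) n + 5 * h n" by metis
  \<comment> \<open>Diagonal of the finite corrections: with n + 1 factors coefficient n is already
    final.\<close>
  define g where "g = Abs_fps (\<lambda>n. h (Suc n) $ n)"
  have "J 1 ^ 5 = J 5 + 5 * g"
  proof (rule fps_ext)
    fix n
    have "fps_cong (Suc n) (J 1 ^ 5) (qpoch fps_X (Suc n) ^ 5)"
      unfolding euler_prod_1 by (intro fps_cong_power fps_cong_sym[OF qpoch_cong]) auto
    moreover have "fps_cong (Suc n) (J 5) (qpoch (fps_X ^ 5) (Suc n))"
      unfolding euler_prod_eq[OF zero_less_numeral] by (intro fps_cong_sym[OF qpoch_cong]) auto
    ultimately have "(J 1 ^ 5) $ n = (qpoch fps_X (Suc n) ^ 5) $ n" "J 5 $ n = qpoch (fps_X ^ 5) (Suc n) $ n"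
      by (simp_all add: fps_cong_def)
    then show "(J 1 ^ 5) $ n = (J 5 + 5 * g) $ n"
      unfolding h(2) by (simp add: g_def numeral_mult_nth)
  qed
  moreover have "int_fps g" using h(1) by (simp add: int_fps_def g_def)
  ultimately show ?thesis by blast
qed

text \<open>Modulo 5 the quotient equals J 1 times (J 10 / J 5)^2. The second factor is a series in
  q^5, and J 1 has no exponents 3 or 4 modulo 5.\<close>

lemma euler_quotient_mod_5:
  assumes n: "n mod 5 = 3 \<or> n mod 5 = 4"
  shows "\<exists>x\<in>\<int>. (J 2 ^ 10 * inverse (J 1) ^ 9) $ n = 5 * x"
proof -
  obtain h where h: "int_fps h" "J 1 ^ 5 = J 5 + 5 * h" using euler_prod_fifth_power by blast
  define i1 i5 where "i1 = inverse (J 1)" and "i5 = inverse (J 5)"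
  have j1: "J 1 * i1 = 1" "i1 * J 1 = 1" and j5: "J 5 * i5 = 1"
    unfolding i1_def i5_def by (auto intro!: inverse_mult_eq_1' inverse_mult_eq_1)
  have "i1 ^ 5 * J 1 ^ 5 = 1" unfolding power_mult_distrib[symmetric] j1 by simp
  then have "i5 = i1 ^ 5 * (J 5 + 5 * h) * i5" using h(2) by simp
  also have "\<dots> = i1 ^ 5 * (J 5 * i5) + 5 * (h * i1 ^ 5 * i5)" by (simp add: algebra_simps)
  finally have i: "i1 ^ 5 = i5 - 5 * (h * i1 ^ 5 * i5)" unfolding j5 by (simp add: eq_diff_eq)
  have "fps_dil 2 (J 1 ^ 5) = fps_dil 2 (J 5 + 5 * h)" by (simp only: h(2))
  then have j: "J 2 ^ 5 = J 10 + 5 * fps_dil 2 h"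
    by (simp add: fps_dil_power fps_dil_mult fps_dil_add fps_dil_euler_prod)
  define u where "u = fps_dil 2 h"
  define v where "v = - (h * i1 ^ 5 * i5)"
  have iv: "i1 ^ 5 = i5 + 5 * v" using i by (simp add: v_def)
  have "J 2 ^ 10 * i1 ^ 9 = J 2 ^ 10 * (i1 ^ 9 * (i1 * J 1))" using j1 by simp
  also have "\<dots> = J 1 * ((J 2 ^ 5) ^ 2 * (i1 ^ 5) ^ 2)" by (simp add: eval_nat_numeral mult_ac)
  also have "\<dots> = J 1 * ((J 10 + 5 * u) ^ 2 * (i5 + 5 * v) ^ 2)" unfolding j iv u_def ..
  also have "\<dots> = J 1 * (J 10 ^ 2 * i5 ^ 2) + 5 * (J 1 * ((2 * (J 10 * u) + 5 * u ^ 2) * (i5 + 5 * v) ^ 2 + J 10 ^ 2 * (2 * (i5 * v) + 5 * v ^ 2)))"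
    by (simp add: power2_eq_square algebra_simps)
  also have "J 10 ^ 2 * i5 ^ 2 = fps_dil 5 (J 2 ^ 2 * i1 ^ 2)"
    by (simp add: fps_dil_mult fps_dil_power fps_dil_inverse fps_dil_euler_prod i1_def i5_def)
  finally have eq: "J 2 ^ 10 * i1 ^ 9 = J 1 * fps_dil 5 (J 2 ^ 2 * i1 ^ 2) +
     5 * (J 1 * ((2 * (J 10 * u) + 5 * u ^ 2) * (i5 + 5 * v) ^ 2 + J 10 ^ 2 * (2 * (i5 * v) + 5 * v ^ 2)))" .
  have "int_fps u" unfolding u_def using h(1) by (intro int_fps_dil) auto
  moreover have "int_fps i1" "int_fps i5" unfolding i1_def i5_def by (intro int_fps_intros; simp)+
  moreover have "int_fps v"
  proof -
    have "int_fps (0 - h * i1 ^ 5 * i5)"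
      using h(1) \<open>int_fps i1\<close> \<open>int_fps i5\<close> by (intro int_fps_diff int_fps_intros) (simp add: int_fps_def)
    then show ?thesis by (simp add: v_def)
  qed
  ultimately have int: "int_fps (J 1 * ((2 * (J 10 * u) + 5 * u ^ 2) * (i5 + 5 * v) ^ 2 + J 10 ^ 2 * (2 * (i5 * v) + 5 * v ^ 2)))"
    by (intro int_fps_intros) auto
  have "(J 1 * fps_dil 5 (J 2 ^ 2 * i1 ^ 2)) $ n = (\<Sum>i=0..n. J 1 $ i * fps_dil 5 (J 2 ^ 2 * i1 ^ 2) $ (n - i))"
    by (rule fps_mult_nth)
  also have "\<dots> = 0"
  proof (intro sum.neutral ballI)
    fix i assume "i \<in> {0..n}"
    then have "i \<le> n" by simp
    show "J 1 $ i * fps_dil 5 (J 2 ^ 2 * i1 ^ 2) $ (n - i) = 0"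
    proof (cases "5 dvd (n - i)")
      case True
      then have "i mod 5 = 3 \<or> i mod 5 = 4" using n mod_eq_dvd_iff_nat[OF \<open>i \<le> n\<close>, of 5] by simp
      then show ?thesis by (simp only: qpoch_nth_mod_5 mult_zero_left)
    next
      case False
      then show ?thesis by (simp add: fps_dil_nth)
    qed
  qed
  finally show ?thesis
    using int unfolding i1_def[symmetric] eq by (simp add: numeral_mult_nth int_fps_def)
qed

section \<open>Vanishing and cancellation of the mock parts\<close>

lemma lambert_even_nth_even: "lambert_even t $ (2 * m) = theta_even t $ (2 * m)"
proof -
  obtain g where g: "\<And>t. fps_cong (Suc (2 * m)) (lambert_even t) (theta_even t -
     fps_X * fps_dil 2 (\<Sum>k<Suc (2 * m). fps_dil 2 (g k) * inverse (pf_den t (-1, 2 * k + 1))))"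
    using lambert_even_eq_theta by blast
  have "(fps_X * fps_dil 2 f) $ (2 * m) = 0" for f :: "complex fps"
  proof -
    have "fps_even (fps_X * fps_dil 2 f) = 0" using fps_even_odd_unique(1)[of 0 f] by simp
    then have "fps_even (fps_X * fps_dil 2 f) $ m = 0" by simp
    then show ?thesis by (simp only: fps_even_nth)
  qed
  then show ?thesis using g[of t] by (simp add: fps_cong_def)
qed

definition fps_neg :: "complex fps \<Rightarrow> complex fps" where
  "fps_neg f = f oo (- fps_X)"

lemma fps_neg_nth: "fps_neg f $ n = (-1) ^ n * f $ n"
proof -
  have "- fps_X = fps_const (-1 :: complex) * fps_X" by (simp flip: fps_const_neg)
  then show ?thesis unfolding fps_neg_def by (simp only: fps_nth_compose_linear)
qed

lemma fps_neg_mult: "fps_neg (f * g) = fps_neg f * fps_neg g"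
  by (simp add: fps_neg_def fps_compose_mult_distrib)

lemma fps_neg_inverse: "f $ 0 \<noteq> 0 \<Longrightarrow> fps_neg (inverse f) = inverse (fps_neg f)"
  by (simp add: fps_neg_def fps_inverse_compose)

lemma fps_neg_pf_den: "fps_neg (pf_den 2 (-1, 2 * k + 1)) = pf_den (-2) (-1, 2 * k + 1)"
proof -
  have "fps_X ^ (2 * k + 1) oo - fps_X = - (fps_X ^ (2 * k + 1) :: complex fps)"
    by (subst fps_X_power_compose) (simp_all add: power_minus_odd)
  then have "fps_neg (1 + fps_X ^ (2 * k + 1)) = 1 - fps_X ^ (2 * k + 1)"
    unfolding fps_neg_def fps_compose_add_distrib fps_compose_1 by (simp only: diff_conv_add_uminus)
  then show ?thesis unfolding pf_den_2 fps_neg_mult by (simp only:)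
qed

lemma fps_neg_dil: "fps_neg (fps_dil 2 f) = fps_dil 2 f"
proof (rule fps_ext)
  fix n
  show "fps_neg (fps_dil 2 f) $ n = fps_dil 2 f $ n"
    unfolding fps_neg_nth fps_dil_nth[OF zero_less_numeral] by (cases "even n") simp_all
qed

text \<open>At odd indices the mock part is a series \<open>F t\<close> in q^2. Its denominators 1 +
  tY + Y^2 have Y an odd power of the new variable and its other factors are even in it, so a sign
  change of the variable exchanges t = 2 and t = -2.\<close>

lemma lambert_even_nth_odd:
  "lambert_even 2 $ (2 * m + 1) - theta_even 2 $ (2 * m + 1) =
     (-1) ^ m * (lambert_even (-2) $ (2 * m + 1) - theta_even (-2) $ (2 * m + 1))"
proof -
  define K where "K = Suc (2 * m + 1)"
  obtain g where g: "\<And>t. fps_cong K (lambert_even t) (theta_even t -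
     fps_X * fps_dil 2 (\<Sum>k<K. fps_dil 2 (g k) * inverse (pf_den t (-1, 2 * k + 1))))"
    using lambert_even_eq_theta by blast
  define F where "F = (\<lambda>t. \<Sum>k<K. fps_dil 2 (g k) * inverse (pf_den t (-1, 2 * k + 1)))"
  have c: "lambert_even t $ (2 * m + 1) - theta_even t $ (2 * m + 1) = - F t $ m" for t
    using g[of t] by (simp add: fps_cong_def K_def F_def fps_dil_nth)
  have "fps_neg (F 2) = (\<Sum>k<K. fps_neg (fps_dil 2 (g k) * inverse (pf_den 2 (-1, 2 * k + 1))))"
    by (simp add: F_def fps_neg_def fps_compose_sum_distrib)
  also have "\<dots> = F (-2)"
    unfolding F_def
  proof (intro sum.cong refl)
    fix k
    have "pf_den (2 :: complex) (-1, 2 * k + 1) $ 0 \<noteq> 0" by (simp only: pf_den_odd_nth_0) simp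
    from fps_neg_inverse[OF this] show "fps_neg (fps_dil 2 (g k) * inverse (pf_den 2 (-1, 2 * k + 1))) =
        fps_dil 2 (g k) * inverse (pf_den (-2) (-1, 2 * k + 1))"
      by (simp only: fps_neg_mult fps_neg_dil fps_neg_pf_den)
  qed
  finally have "F (-2) $ m = (-1) ^ m * F 2 $ m" by (metis fps_neg_nth)
  then have "F 2 $ m = (-1) ^ m * F (-2) $ m" by (cases "even m") simp_all
  then show ?thesis unfolding c by simp
qed

text \<open>At t = 0 the mock part is q times a series in q^4, and \<open>theta_even 0\<close> is
  phi times a series in q^8 with phi supported on the exponents 0 and 1 modulo 4.\<close>

lemma lambert_even_0_nth:
  assumes n: "n mod 4 = 2 \<or> n mod 4 = 3"
  shows "lambert_even 0 $ n = 0"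
proof -
  obtain g where g: "\<And>t. fps_cong (Suc n) (lambert_even t) (theta_even t -
     fps_X * fps_dil 2 (\<Sum>k<Suc n. fps_dil 2 (g k) * inverse (pf_den t (-1, 2 * k + 1))))"
    using lambert_even_eq_theta by blast
  have "fps_dil 2 (g k) * inverse (pf_den 0 (-1, 2 * k + 1)) = fps_dil 2 (g k * inverse (1 + fps_X ^ (2 * k + 1)))" for k
    unfolding pf_den_2 fps_dil_mult[OF zero_less_numeral] fps_dil_inverse[OF zero_less_numeral] fps_dil_add fps_dil_1
      fps_dil_X_power[OF zero_less_numeral] ..
  then have "fps_dil 2 (\<Sum>k<Suc n. fps_dil 2 (g k) * inverse (pf_den 0 (-1, 2 * k + 1)))
      = fps_dil 4 (\<Sum>k<Suc n. g k * inverse (1 + fps_X ^ (2 * k + 1)))"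
    unfolding fps_dil_sum by (simp add: fps_dil_dil)
  moreover have "(fps_X * fps_dil 4 f) $ n = 0" for f :: "complex fps"
  proof -
    have "\<not> 4 dvd (n - 1)" "n > 0" using n by presburger+
    then show ?thesis by (simp add: fps_dil_nth)
  qed
  ultimately have 1: "lambert_even 0 $ n = theta_even 0 $ n"
    using g[of 0] by (simp add: fps_cong_def)
  define w where "w = J 2 * inverse (J 1)"
  have "theta_even 0 = (fps_dil 4 phi + 2 * fps_X * fps_dil 8 psi) * fps_dil 8 w"
    unfolding theta_even_0 w_def by (simp only: phi_split[symmetric])
  also have "\<dots> = fps_dil 4 (phi * fps_dil 2 w) + fps_X * fps_dil 4 (2 * fps_dil 2 (psi * w))"
    by (simp add: fps_dil_mult fps_dil_dil algebra_simps)
  finally have "theta_even 0 $ n = fps_dil 4 (phi * fps_dil 2 w) $ n + (fps_X * fps_dil 4 (2 * fps_dil 2 (psi * w))) $ n"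
    by simp
  also have "fps_dil 4 (phi * fps_dil 2 w) $ n = 0" using n by (auto simp: fps_dil_nth)
  finally show ?thesis using 1 \<open>\<And>f. (fps_X * fps_dil 4 f) $ n = 0\<close> by simp
qed

lemma lambert_odd_2_nth:
  assumes "\<not> 4 dvd n"
  shows "lambert_odd 2 $ n = theta_odd 2 $ n"
proof -
  have "(2 :: complex) \<noteq> -2" by simp
  then obtain g where "fps_cong (Suc n) (lambert_odd 2) (theta_odd 2 - fps_dil 4 g)"
    using lambert_odd_eq_theta by blast
  then show ?thesis using assms by (simp add: fps_cong_def fps_dil_nth)
qed

section \<open>Congruences\<close>

lemma even_sum_list_odd: "\<forall>x\<in>set xs. odd x \<Longrightarrow> even (sum_list xs) \<longleftrightarrow> even (length xs)"
  for xs :: "nat list"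
  by (induction xs) auto

text \<open>All entries are odd and 2D^2 + 2D is even, so n - 1 has the parity of the number of
  entries, which is that of the rank.\<close>

lemma odd_rank_parity:
  assumes "S \<in> odd_durfee_symbols n"
  shows "even (odd_rank S) \<longleftrightarrow> odd n"
proof -
  obtain D xs ys where S: "S = (D, xs, ys)" "odd_durfee_row D xs" "odd_durfee_row D ys"
    and n: "n = sum_list xs + sum_list ys + 2 * D ^ 2 + 2 * D + 1"
    using assms by (auto simp: odd_durfee_symbols_def)
  have "even (sum_list xs) \<longleftrightarrow> even (length xs)" "even (sum_list ys) \<longleftrightarrow> even (length ys)"
    using S(2,3) even_sum_list_odd[of xs] even_sum_list_odd[of ys] unfolding odd_durfee_row_def by simp_all
  moreover have "even (odd_rank S) \<longleftrightarrow> (even (length xs) \<longleftrightarrow> even (length ys))"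
    unfolding S(1) by simp
  moreover have "odd n \<longleftrightarrow> (even (sum_list xs) \<longleftrightarrow> even (sum_list ys))"
    unfolding n by simp
  ultimately show ?thesis by (simp only:)
qed

section \<open>Rank classes and roots of unity\<close>

lemma N0_eq_sum: "of_nat (N0 a M n) = (\<Sum>S\<in>odd_durfee_symbols n. if [odd_rank S = a] (mod int M) then 1 else (0 :: 'a::semiring_1))"
proof -
  have "(\<Sum>S\<in>odd_durfee_symbols n. if [odd_rank S = a] (mod int M) then 1 else (0 :: 'a)) =
      (\<Sum>S\<in>{S \<in> odd_durfee_symbols n. [odd_rank S = a] (mod int M)}. 1)"
    by (intro sum.mono_neutral_cong_right) (auto simp: finite_odd_durfee_symbols)
  then show ?thesis by (simp add: N0_def)
qed

fun swap_rows :: "durfee_symbol \<Rightarrow> durfee_symbol" where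
  "swap_rows (D, xs, ys) = (D, ys, xs)"

lemma swap_rows_swap [simp]: "swap_rows (swap_rows S) = S"
  by (cases S) auto

lemma odd_rank_swap [simp]: "odd_rank (swap_rows S) = - odd_rank S"
  by (cases S) auto

lemma swap_rows_in [simp]: "swap_rows S \<in> odd_durfee_symbols n \<longleftrightarrow> S \<in> odd_durfee_symbols n"
  by (cases S) (auto simp: odd_durfee_symbols_def)

lemma card_swap:
  "card {S \<in> odd_durfee_symbols n. P (odd_rank S)} = card {S \<in> odd_durfee_symbols n. P (- odd_rank S)}"
  by (rule bij_betw_same_card[of swap_rows], rule bij_betwI[of _ _ _ swap_rows]) auto

lemma N0_uminus: "N0 (- a) M n = N0 a M n"
proof -
  have "[r = - a] (mod int M) \<longleftrightarrow> [- r = a] (mod int M)" for r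
    using cong_minus_minus_iff[of r "- a" "int M"] by simp
  then show ?thesis unfolding N0_def by (subst card_swap) simp
qed

lemma N0_cong: "[a = b] (mod int M) \<Longrightarrow> N0 a M n = N0 b M n"
  unfolding N0_def by (metis (no_types, opaque_lifting) cong_sym cong_trans)

text \<open>Since -k and k agree modulo 2k, exchanging the rows acts on this class; it contains no
  symbol of rank 0, so positive and negative ranks are equally many.\<close>

lemma N0_half_period_even:
  assumes "0 < k"
  shows "[N0 (int k) (2 * k) n = 0] (mod 2)"
proof -
  define A where "A = {S \<in> odd_durfee_symbols n. [odd_rank S = int k] (mod int (2 * k))}"
  define P where "P = {S \<in> odd_durfee_symbols n. [odd_rank S = int k] (mod int (2 * k)) \<and> odd_rank S > 0}"
  define Q where "Q = {S \<in> odd_durfee_symbols n. [odd_rank S = int k] (mod int (2 * k)) \<and> - odd_rank S > 0}"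
  have fin: "finite P" "finite Q" by (auto simp: P_def Q_def finite_odd_durfee_symbols)
  have sym: "[- r = int k] (mod int (2 * k)) \<longleftrightarrow> [r = int k] (mod int (2 * k))" for r
  proof -
    have "[- r = int k] (mod int (2 * k)) \<longleftrightarrow> [r = - int k] (mod int (2 * k))"
      using cong_minus_minus_iff[of r "- int k" "int (2 * k)"] by simp
    also have "\<dots> \<longleftrightarrow> [r = int k] (mod int (2 * k))"
    proof -
      have "[- int k = int k] (mod int (2 * k))" by (simp add: cong_iff_dvd_diff)
      then show ?thesis by (metis cong_sym cong_trans)
    qed
    finally show ?thesis .
  qed
  have "\<not> [0 = int k] (mod int (2 * k))"
  proof
    assume "[0 = int k] (mod int (2 * k))"
    then have "int (2 * k) dvd int k" by (simp add: cong_iff_dvd_diff)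
    then have "2 * k dvd k" by (simp only: int_dvd_int_iff)
    then show False using assms dvd_imp_le by fastforce
  qed
  then have "odd_rank S \<noteq> 0" if "S \<in> A" for S using that unfolding A_def by auto
  then have "A = P \<union> Q" unfolding A_def P_def Q_def by force
  moreover have "P \<inter> Q = {}" unfolding P_def Q_def by auto
  ultimately have "card A = card P + card Q" using fin by (simp add: card_Un_disjoint)
  moreover have "card P = card Q"
    unfolding P_def Q_def using card_swap[of n "\<lambda>r. [r = int k] (mod int (2 * k)) \<and> r > 0"] sym by simp
  ultimately show ?thesis unfolding N0_def A_def[symmetric] by (simp add: cong_0_iff)
qed

lemma N0_double:
  assumes "M > 0"
  shows "N0 a M n = N0 a (2 * M) n + N0 (a + int M) (2 * M) n"
proof -
  have pt: "(if [r = a] (mod int M) then 1 else (0 :: int)) =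
      (if [r = a] (mod int (2 * M)) then 1 else 0) + (if [r = a + int M] (mod int (2 * M)) then 1 else 0)" for r
  proof -
    have a: "[r = a] (mod int M) \<longleftrightarrow> int M dvd (r - a)" by (simp add: cong_iff_dvd_diff)
    have b: "[r = a] (mod int (2 * M)) \<longleftrightarrow> 2 * int M dvd (r - a)" by (simp add: cong_iff_dvd_diff)
    have c: "[r = a + int M] (mod int (2 * M)) \<longleftrightarrow> 2 * int M dvd (r - a - int M)"
      by (simp add: cong_iff_dvd_diff diff_diff_eq)
    show ?thesis
    proof (cases "int M dvd (r - a)")
      case True
      then obtain q where q: "r - a = int M * q" by blast
      have ev: "2 * int M dvd int M * x \<longleftrightarrow> even x" for x
        using assms dvd_mult_cancel_left[of "int M" 2 x] by (simp add: mult.commute)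
      have q2: "r - a - int M = int M * (q - 1)" using q by (simp add: algebra_simps)
      show ?thesis unfolding a b c q2 unfolding q ev by simp
    next
      case False
      then have "\<not> 2 * int M dvd (r - a)" using dvd_mult_right by blast
      moreover have "\<not> 2 * int M dvd (r - a - int M)"
      proof
        assume "2 * int M dvd (r - a - int M)"
        then have "int M dvd (r - a - int M)" using dvd_mult_right by blast
        then have "int M dvd (r - a - int M) + int M" by (intro dvd_add) auto
        then show False using False by simp
      qed
      ultimately show ?thesis unfolding a b c using False by simp
    qed
  qed
  have "int (N0 a M n) = int (N0 a (2 * M) n + N0 (a + int M) (2 * M) n)"
    unfolding of_nat_add N0_eq_sum sum.distrib[symmetric] by (intro sum.cong refl pt)
  then show ?thesis by (simp only: of_nat_eq_iff)
qed

text \<open>Exchanging the rows pairs the classes 2 and 6 modulo 8. Hence results for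
  \<open>N0 2 8\<close> are halves of results for \<open>N0 2 4\<close>.\<close>

lemma N0_2_4: "N0 2 4 n = 2 * N0 2 8 n"
proof -
  have "N0 6 8 n = N0 (- 2) 8 n" by (rule N0_cong) (simp add: cong_iff_dvd_diff)
  then show ?thesis using N0_double[of 4 2 n] N0_uminus[of 2 8 n] by simp
qed

lemma rank_gf_1_nth: "rank_gf 1 $ n = of_nat (N0 r 2 n) + of_nat (N0 (r + 1) 2 n)"
proof -
  have "(1 :: complex) powi odd_rank S = (if [odd_rank S = r] (mod int 2) then 1 else 0) + (if [odd_rank S = r + 1] (mod int 2) then 1 else 0)" for S
    unfolding cong_iff_dvd_diff by simp
  then show ?thesis unfolding rank_gf_def N0_eq_sum sum.distrib[symmetric] by simp
qed

lemma N0_parity_0: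
  assumes "odd n \<longleftrightarrow> odd a"
  shows "N0 a 2 n = 0"
proof -
  have "\<not> [odd_rank S = a] (mod int 2)" if "S \<in> odd_durfee_symbols n" for S
    using odd_rank_parity[OF that] assms unfolding cong_iff_dvd_diff by simp
  then have "{S \<in> odd_durfee_symbols n. [odd_rank S = a] (mod int 2)} = {}" by blast
  then show ?thesis unfolding N0_def by (simp only: card.empty)
qed

lemma N0_total_odd: "odd n \<Longrightarrow> rank_gf 1 $ n = of_nat (N0 0 4 n) + of_nat (N0 2 4 n)"
  using rank_gf_1_nth[of n 0] N0_parity_0[of n 1] N0_double[of 2 0 n] by simp

lemma N0_total_even:
  assumes "even n"
  shows "rank_gf 1 $ n = 2 * of_nat (N0 1 4 n)"
proof -
  have "N0 3 4 n = N0 (- 1) 4 n" by (rule N0_cong) (simp add: cong_iff_dvd_diff)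
  then show ?thesis
    using rank_gf_1_nth[of n 0] N0_parity_0[of n 0] N0_double[of 2 1 n] N0_uminus[of 1 4 n] assms by simp
qed

lemma ii_powi_even: "\<i> powi (2 * k) = (if even k then 1 else -1)"
  by (auto simp: power_int_mult power_int_minus_left)

lemma N0_diff_odd:
  assumes "odd n"
  shows "rank_gf \<i> $ n = of_nat (N0 0 4 n) - of_nat (N0 2 4 n)"
proof -
  have "\<i> powi odd_rank S = (if [odd_rank S = 0] (mod int 4) then 1 else 0) - (if [odd_rank S = 2] (mod int 4) then 1 else 0)"
    if S: "S \<in> odd_durfee_symbols n" for S
  proof -
    obtain k where k: "odd_rank S = 2 * k" using odd_rank_parity[OF S] assms by auto
    have c0: "[2 * k = 0] (mod int 4) \<longleftrightarrow> even k" and c2: "[2 * k = 2] (mod int 4) \<longleftrightarrow> odd k"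
      unfolding cong_iff_dvd_diff by presburger+
    show ?thesis unfolding k ii_powi_even c0 c2 by simp
  qed
  then show ?thesis unfolding rank_gf_def N0_eq_sum sum_subtractf[symmetric] by simp
qed

text \<open>For odd n the rank is some 2k, and w^(2k) = i^k; taking real parts discards the ranks 2
  and 6 modulo 8.\<close>

lemma N0_diff_8:
  assumes "odd n" "w\<^sup>2 = \<i>"
  shows "Re (rank_gf w $ n) = of_nat (N0 0 8 n) - of_nat (N0 4 8 n)"
proof -
  have "Re (w powi odd_rank S) = (if [odd_rank S = 0] (mod int 8) then 1 else 0) - (if [odd_rank S = 4] (mod int 8) then 1 else 0)"
    if S: "S \<in> odd_durfee_symbols n" for S
  proof -
    obtain k where k: "odd_rank S = 2 * k" using odd_rank_parity[OF S] assms(1) by auto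
    have wk: "w powi (2 * k) = \<i> powi k" unfolding power_int_mult using assms(2) by simp
    show ?thesis
    proof (cases "even k")
      case True
      then obtain l where l: "k = 2 * l" by blast
      have c0: "[2 * (2 * l) = 0] (mod int 8) \<longleftrightarrow> even l" and c4: "[2 * (2 * l) = 4] (mod int 8) \<longleftrightarrow> odd l"
        unfolding cong_iff_dvd_diff by presburger+
      show ?thesis unfolding k wk unfolding l ii_powi_even c0 c4 by simp
    next
      case False
      then obtain l where l: "k = 2 * l + 1" by (rule oddE)
      have c0: "\<not> [2 * (2 * l + 1) = 0] (mod int 8)" and c4: "\<not> [2 * (2 * l + 1) = 4] (mod int 8)"
        unfolding cong_iff_dvd_diff by presburger+
      have "\<i> powi (2 * l + 1) = \<i> powi (2 * l) * \<i>" by (simp add: power_int_add)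
      then have "Re (\<i> powi (2 * l + 1)) = 0" unfolding ii_powi_even by simp
      then show ?thesis unfolding k wk unfolding l using c0 c4 by simp
    qed
  qed
  then show ?thesis unfolding rank_gf_def N0_eq_sum sum_subtractf[symmetric] by simp
qed

lemma rank_gf_nth_odd:
  assumes "z \<noteq> 0" "t = (z + inverse z)\<^sup>2 - 2"
  shows "rank_gf z $ (2 * m + 1) = lambert_even t $ m"
  unfolding rank_gf_split[OF assms] by (simp add: fps_dil_nth)

lemma rank_gf_nth_even:
  assumes "z \<noteq> 0" "t = (z + inverse z)\<^sup>2 - 2"
  shows "rank_gf z $ (2 * m) = (z + inverse z) * lambert_odd t $ m"
proof -
  have "fps_even (fps_X * fps_dil 2 (lambert_even t)) = 0"
    using fps_even_odd_unique(1)[of 0 "lambert_even t"] by simp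
  then have "fps_even (fps_X * fps_dil 2 (lambert_even t)) $ m = 0" by simp
  then have "(fps_X * fps_dil 2 (lambert_even t)) $ (2 * m) = 0" by (simp only: fps_even_nth)
  then show ?thesis unfolding rank_gf_split[OF assms] fps_add_nth by (simp add: fps_dil_nth)
qed

section \<open>Counting functions as coefficients of theta quotients\<close>

lemma N0_4_sum: "of_nat (N0 0 4 (2 * m + 1)) + of_nat (N0 2 4 (2 * m + 1)) = lambert_even 2 $ m"
proof -
  have "rank_gf 1 $ (2 * m + 1) = lambert_even 2 $ m" by (rule rank_gf_nth_odd) simp_all
  then show ?thesis using N0_total_odd[of "2 * m + 1"] by simp
qed

lemma N0_4_diff: "of_nat (N0 0 4 (2 * m + 1)) - of_nat (N0 2 4 (2 * m + 1)) = lambert_even (-2) $ m"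
proof -
  have "rank_gf \<i> $ (2 * m + 1) = lambert_even (-2) $ m" by (rule rank_gf_nth_odd) simp_all
  then show ?thesis using N0_diff_odd[of "2 * m + 1"] by simp
qed

text \<open>These n correspond to even indices of \<open>lambert_even\<close>, where the mock part
  is absent at t = 2 and t = -2 alike.\<close>

lemma N0_4_series:
  "2 * of_nat (N0 0 4 (4 * m + 1)) = (series_A + series_B) $ m"
  "2 * of_nat (N0 2 4 (4 * m + 1)) = (series_A - series_B) $ m"
proof -
  have e: "2 * (2 * m) + 1 = 4 * m + 1" by simp
  have "series_A $ m = lambert_even 2 $ (2 * m)" "series_B $ m = lambert_even (-2) $ (2 * m)"
    unfolding lambert_even_nth_even theta_even_2_even[symmetric] theta_even_minus_2_even[symmetric] fps_even_nth by simp_all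
  then have "series_A $ m = of_nat (N0 0 4 (4 * m + 1)) + of_nat (N0 2 4 (4 * m + 1))"
    "series_B $ m = of_nat (N0 0 4 (4 * m + 1)) - of_nat (N0 2 4 (4 * m + 1))"
    using N0_4_sum[of "2 * m"] N0_4_diff[of "2 * m"] unfolding e by simp_all
  then show "2 * of_nat (N0 0 4 (4 * m + 1)) = (series_A + series_B) $ m"
    "2 * of_nat (N0 2 4 (4 * m + 1)) = (series_A - series_B) $ m"
    by simp_all
qed

text \<open>With counts a, b for the ranks 0, 2 and d the coefficient of \<open>series_D\<close>,
  the sign relation between the mock parts reads a + b - 4d = (-1)^m (a - b), as the theta part at t
  = -2 has no odd coefficients. It determines b for even m and a for odd m: rank 2 for 8n+3, rank 0
  for 8n+7.\<close>

lemma N0_4_series_D: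
  "even m \<Longrightarrow> of_nat (N0 2 4 (4 * m + 3)) = 2 * series_D $ m"
  "odd m \<Longrightarrow> of_nat (N0 0 4 (4 * m + 3)) = 2 * series_D $ m"
proof -
  have e: "2 * (2 * m + 1) + 1 = 4 * m + 3" by simp
  define a b :: complex where "a = of_nat (N0 0 4 (4 * m + 3))" and "b = of_nat (N0 2 4 (4 * m + 3))"
  have "a + b = lambert_even 2 $ (2 * m + 1)" "a - b = lambert_even (-2) $ (2 * m + 1)"
    using N0_4_sum[of "2 * m + 1"] N0_4_diff[of "2 * m + 1"] unfolding e a_def b_def by simp_all
  moreover have "theta_even 2 $ (2 * m + 1) = 4 * series_D $ m" "theta_even (-2) $ (2 * m + 1) = 0"
    unfolding fps_odd_nth[symmetric] theta_even_2_odd theta_even_minus_2_odd numeral_mult_nth by simp_all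
  ultimately have "a + b - 4 * series_D $ m = (-1) ^ m * (a - b)"
    using lambert_even_nth_odd[of m] by simp
  then show "even m \<Longrightarrow> of_nat (N0 2 4 (4 * m + 3)) = 2 * series_D $ m"
    "odd m \<Longrightarrow> of_nat (N0 0 4 (4 * m + 3)) = 2 * series_D $ m"
    unfolding a_def[symmetric] b_def[symmetric] by (auto simp: algebra_simps; algebra)+
qed

text \<open>A primitive eighth root of unity has t = i + 1/i = 0, where these coefficients vanish;
  so the ranks 0 and 4 modulo 8 are equally many.\<close>

lemma N0_0_4_eq_double:
  assumes "m mod 4 = 2 \<or> m mod 4 = 3"
  shows "N0 0 4 (2 * m + 1) = 2 * N0 0 8 (2 * m + 1)"
proof -
  define w where "w = csqrt \<i>"
  have w2: "w\<^sup>2 = \<i>" unfolding w_def by (rule power2_csqrt)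
  have w0: "w \<noteq> 0" using w2 by auto
  have "(w + inverse w)\<^sup>2 - 2 = w\<^sup>2 + inverse (w\<^sup>2)" using w0 by (simp add: power2_eq_square field_simps)
  then have "0 = (w + inverse w)\<^sup>2 - 2" unfolding w2 by simp
  from rank_gf_nth_odd[OF w0 this, of m] have "rank_gf w $ (2 * m + 1) = 0"
    by (simp only: lambert_even_0_nth[OF assms])
  then have "real (N0 0 8 (2 * m + 1)) = real (N0 4 8 (2 * m + 1))"
    using N0_diff_8[OF _ w2, of "2 * m + 1"] by simp
  then show ?thesis using N0_double[of 4 0 "2 * m + 1"] by simp
qed

text \<open>The total at z = 1 is twice the count, because the ranks 1 and 3 modulo 4 are equally
  many; this 2 cancels against z + 1/z = 2.\<close>

lemma N0_1_4_series:
  assumes "\<not> 4 dvd m"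
  shows "4 * of_nat (N0 1 4 (2 * m)) = (4 * theta_odd 2) $ m"
proof -
  have "rank_gf 1 $ (2 * m) = (1 + inverse 1) * lambert_odd 2 $ m" by (rule rank_gf_nth_even) simp_all
  then show ?thesis
    using N0_total_even[of "2 * m"] lambert_odd_2_nth[OF assms] by (simp add: numeral_mult_nth)
qed

section \<open>Divisibility in the single residue classes\<close>

lemma Ints_nth: "int_fps f \<Longrightarrow> f $ n \<in> \<int>"
  by (simp add: int_fps_def)

text \<open>Here and below, each even or odd part adds a binary digit to the class: 8n+5 is the odd
  part of the series for 4m+1.\<close>

lemma N0_0_4_mod_8_5: "[N0 0 4 (8 * n + 5) = 0] (mod 4)"
proof -
  define f where "f = fps_dil 4 psi * fps_dil 2 phi ^ 2 * (psi * \<kappa>)"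
  have e: "4 * (2 * n + 1) + 1 = 8 * n + 5" by simp
  have "2 * of_nat (N0 0 4 (8 * n + 5)) = 8 * f $ n"
    using N0_4_series(1)[of "2 * n + 1"] series_sum_odd
    unfolding e fps_odd_nth[symmetric] by (simp add: f_def numeral_mult_nth)
  then have "of_nat (N0 0 4 (8 * n + 5)) = 4 * f $ n" by simp
  moreover have "int_fps f" unfolding f_def by (intro int_fps_intros; simp)
  ultimately show ?thesis by (intro cong_0_of_Ints[OF _ Ints_nth])
qed

lemma N0_0_4_mod_16_13: "[N0 0 4 (16 * n + 13) = 0] (mod 8)"
proof -
  define f where "f = fps_dil 2 psi * phi ^ 2 *
    (phi ^ 2 * fps_dil 4 psi + 2 * (fps_dil 2 psi ^ 2 * fps_dil 2 phi)) * (J 2 ^ 6 * inverse (J 1) ^ 11)"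
  have e: "4 * (2 * (2 * n + 1) + 1) + 1 = 16 * n + 13" by simp
  have "2 * of_nat (N0 0 4 (16 * n + 13)) = 16 * f $ n"
    using N0_4_series(1)[of "2 * (2 * n + 1) + 1"] series_sum_odd_odd
    unfolding e fps_odd_nth[symmetric] by (simp add: f_def numeral_mult_nth)
  then have "of_nat (N0 0 4 (16 * n + 13)) = 8 * f $ n" by simp
  moreover have "int_fps f" unfolding f_def by (intro int_fps_intros; simp)
  ultimately show ?thesis by (intro cong_0_of_Ints[OF _ Ints_nth])
qed

lemma N0_0_4_mod_8_7: "[N0 0 4 (8 * n + 7) = 0] (mod 4)"
proof -
  define f where "f = fps_dil 4 psi * (psi ^ 3 * \<kappa>)"
  have e: "4 * (2 * n + 1) + 3 = 8 * n + 7" by simp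
  have "of_nat (N0 0 4 (8 * n + 7)) = 2 * (2 * f $ n)"
    using N0_4_series_D(2)[of "2 * n + 1"] series_D_odd
    unfolding e fps_odd_nth[symmetric] by (simp add: f_def numeral_mult_nth)
  then have "of_nat (N0 0 4 (8 * n + 7)) = 4 * f $ n" by simp
  moreover have "int_fps f" unfolding f_def by (intro int_fps_intros; simp)
  ultimately show ?thesis by (intro cong_0_of_Ints[OF _ Ints_nth])
qed

text \<open>The modulus 32 is what remains to be halved for the modulus 16 at rank 0 modulo
  8.\<close>

lemma N0_0_4_mod_16_15: "[N0 0 4 (16 * n + 15) = 0] (mod 32)"
proof -
  define f where "f = fps_dil 2 psi * (phi ^ 2 * fps_dil 2 psi ^ 2 * (J 2 ^ 8 * inverse (J 1) ^ 12))"
  have e: "4 * (2 * (2 * n + 1) + 1) + 3 = 16 * n + 15" by simp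
  have "of_nat (N0 0 4 (16 * n + 15)) = 2 * (16 * f $ n)"
    using N0_4_series_D(2)[of "2 * (2 * n + 1) + 1"] series_D_odd_odd
    unfolding e fps_odd_nth[symmetric] by (simp add: f_def numeral_mult_nth)
  then have "of_nat (N0 0 4 (16 * n + 15)) = 32 * f $ n" by simp
  moreover have "int_fps f" unfolding f_def by (intro int_fps_intros; simp)
  ultimately show ?thesis by (intro cong_0_of_Ints[OF _ Ints_nth])
qed

lemma N0_1_4_mod_8_4_eq: "of_nat (N0 1 4 (8 * n + 4)) = 2 * (J 2 ^ 10 * inverse (J 1) ^ 9) $ n"
proof -
  have e: "2 * (2 * (2 * n + 1)) = 8 * n + 4" by simp
  have "\<not> 4 dvd 2 * (2 * n + 1)" by presburger
  from N0_1_4_series[OF this] show ?thesis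
    using theta_odd_2_odd_even
    unfolding e fps_even_nth[symmetric] fps_odd_nth[symmetric] by (simp only: numeral_mult_nth) simp
qed

lemma N0_1_4_mod_8_4: "[N0 1 4 (8 * n + 4) = 0] (mod 2)"
proof -
  have "int_fps (J 2 ^ 10 * inverse (J 1) ^ 9)" by (intro int_fps_intros; simp)
  then show ?thesis by (intro cong_0_of_Ints[OF N0_1_4_mod_8_4_eq Ints_nth])
qed

lemma N0_1_4_mod_5:
  assumes "n mod 5 = 3 \<or> n mod 5 = 4"
  shows "[N0 1 4 (8 * n + 4) = 0] (mod 5)"
proof -
  obtain x where x: "x \<in> \<int>" "(J 2 ^ 10 * inverse (J 1) ^ 9) $ n = 5 * x"
    using euler_quotient_mod_5[OF assms] by blast
  have "of_nat (N0 1 4 (8 * n + 4)) = 5 * (2 * x)" unfolding N0_1_4_mod_8_4_eq x(2) by simp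
  then show ?thesis by (rule cong_0_of_Ints) (use x(1) in auto)
qed

lemma N0_1_4_mod_8_6: "[N0 1 4 (8 * n + 6) = 0] (mod 4)"
proof -
  define f where "f = fps_dil 2 psi ^ 2 * (psi ^ 2 * \<kappa>)"
  have e: "2 * (2 * (2 * n + 1) + 1) = 8 * n + 6" by simp
  have "\<not> 4 dvd 2 * (2 * n + 1) + 1" by presburger
  from N0_1_4_series[OF this] have "4 * of_nat (N0 1 4 (8 * n + 6)) = 16 * f $ n"
    using theta_odd_2_odd_odd
    unfolding e fps_odd_nth[symmetric] f_def by (simp only: numeral_mult_nth)
  then have "of_nat (N0 1 4 (8 * n + 6)) = 4 * f $ n" by simp
  moreover have "int_fps f" unfolding f_def by (intro int_fps_intros; simp)
  ultimately show ?thesis by (intro cong_0_of_Ints[OF _ Ints_nth])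
qed

text \<open>Twice the count is 16 f - 8 g, and the term from \<open>series_B\<close> guarantees only
  the factor 8; hence 4 here against 8 for rank 0 in the same class.\<close>

lemma N0_2_4_mod_16_13: "[N0 2 4 (16 * n + 13) = 0] (mod 4)"
proof -
  define f where "f = fps_dil 2 psi * phi ^ 2 *
    (phi ^ 2 * fps_dil 4 psi + 2 * (fps_dil 2 psi ^ 2 * fps_dil 2 phi)) * (J 2 ^ 6 * inverse (J 1) ^ 11)"
  define g where "g = fps_dil 2 psi * fps_dil 4 psi * (J 1 ^ 2 * \<kappa>)"
  have e: "4 * (2 * (2 * n + 1) + 1) + 1 = 16 * n + 13" by simp
  have "series_A - series_B = (series_A + series_B) - 2 * series_B" by simp
  then have "fps_odd (fps_odd (series_A - series_B)) = 16 * f - 2 * (4 * g)"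
    by (simp only: fps_odd_diff fps_odd_numeral_mult series_sum_odd_odd series_B_odd_odd f_def g_def)
  then have "2 * of_nat (N0 2 4 (16 * n + 13)) = 16 * f $ n - 2 * (4 * g $ n)"
    using N0_4_series(2)[of "2 * (2 * n + 1) + 1"]
    unfolding e fps_odd_nth[symmetric] by (simp only: fps_sub_nth numeral_mult_nth)
  then have "2 * of_nat (N0 2 4 (16 * n + 13)) = 2 * (4 * (2 * f $ n - g $ n))" by (simp add: algebra_simps)
  then have "of_nat (N0 2 4 (16 * n + 13)) = 4 * (2 * f $ n - g $ n)" by (simp only: mult_cancel_left) simp
  moreover have "int_fps f" "int_fps g" unfolding f_def g_def by (intro int_fps_intros; simp)+
  then have "2 * f $ n - g $ n \<in> \<int>" using Ints_nth by auto
  ultimately show ?thesis by (rule cong_0_of_Ints)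
qed

lemma N0_2_4_mod_8_1: "[N0 2 4 (8 * n + 1) = 0] (mod 8)"
proof -
  define f where "f = fps_X * fps_dil 4 psi ^ 2 * fps_dil 2 phi * (psi * \<kappa>)"
  have e: "4 * (2 * n) + 1 = 8 * n + 1" by simp
  have "2 * of_nat (N0 2 4 (8 * n + 1)) = 16 * f $ n"
    using N0_4_series(2)[of "2 * n"] series_diff_even
    unfolding e fps_even_nth[symmetric] f_def by (simp only: numeral_mult_nth)
  then have "of_nat (N0 2 4 (8 * n + 1)) = 8 * f $ n" by simp
  moreover have "int_fps f" unfolding f_def by (intro int_fps_intros; simp)
  ultimately show ?thesis by (intro cong_0_of_Ints[OF _ Ints_nth])
qed

lemma N0_2_4_mod_16_11: "[N0 2 4 (16 * n + 11) = 0] (mod 16)"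
proof -
  define f where "f = phi * (phi ^ 2 * fps_dil 2 psi ^ 2 * (J 2 ^ 8 * inverse (J 1) ^ 12))"
  have e: "4 * (2 * (2 * n + 1)) + 3 = 16 * n + 11" by simp
  have "of_nat (N0 2 4 (16 * n + 11)) = 2 * (8 * f $ n)"
    using N0_4_series_D(1)[of "2 * (2 * n + 1)"] series_D_odd_even
    unfolding e fps_odd_nth[symmetric] fps_even_nth[symmetric] by (simp add: f_def numeral_mult_nth)
  then have "of_nat (N0 2 4 (16 * n + 11)) = 16 * f $ n" by simp
  moreover have "int_fps f" unfolding f_def by (intro int_fps_intros; simp)
  ultimately show ?thesis by (intro cong_0_of_Ints[OF _ Ints_nth])
qed

theorem theorem1p12:
  fixes k n :: nat
  assumes "0 < k"
  shows "[N0 (int k) (2 * k) n = 0] (mod 2)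
    \<and> (\<forall>r \<in> {5, 7}. [N0 0 4 (8 * n + r) = 0] (mod 4))
    \<and> [N0 0 4 (16 * n + 13) = 0] (mod 8)
    \<and> [N0 1 4 (8 * n + 4) = 0] (mod 2)
    \<and> [N0 1 4 (8 * n + 6) = 0] (mod 4)
    \<and> (\<forall>r \<in> {28, 36}. [N0 1 4 (40 * n + r) = 0] (mod 5))
    \<and> [N0 2 4 (16 * n + 13) = 0] (mod 4)
    \<and> (\<forall>r \<in> {5, 7}. [N0 0 8 (8 * n + r) = 0] (mod 2))
    \<and> [N0 0 8 (16 * n + 13) = 0] (mod 4)
    \<and> [N0 0 8 (16 * n + 15) = 0] (mod 16)
    \<and> [N0 2 8 (8 * n + 1) = 0] (mod 4)
    \<and> [N0 2 8 (16 * n + 11) = 0] (mod 8)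
    \<and> [N0 2 8 (16 * n + 13) = 0] (mod 2)"
proof -
  have double: "N0 0 4 (8 * j + 5) = 2 * N0 0 8 (8 * j + 5)" "N0 0 4 (8 * j + 7) = 2 * N0 0 8 (8 * j + 7)" for j
  proof -
    have e: "2 * (4 * j + 2) + 1 = 8 * j + 5" "2 * (4 * j + 3) + 1 = 8 * j + 7" by simp_all
    have "(4 * j + 2) mod 4 = 2" "(4 * j + 3) mod 4 = 3" by presburger+
    then show "N0 0 4 (8 * j + 5) = 2 * N0 0 8 (8 * j + 5)" "N0 0 4 (8 * j + 7) = 2 * N0 0 8 (8 * j + 7)"
      using N0_0_4_eq_double[of "4 * j + 2"] N0_0_4_eq_double[of "4 * j + 3"] e by (simp_all only: simp_thms)
  qed
  \<comment> \<open>Places both classes among 8j+5 and 8j+7, where the ranks 0 and 4 modulo 8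
    balance.\<close>
  have e: "16 * n + 13 = 8 * (2 * n + 1) + 5" "16 * n + 15 = 8 * (2 * n + 1) + 7" by simp_all
  have "[N0 0 8 (8 * n + 5) = 0] (mod 2)" "[N0 0 8 (8 * n + 7) = 0] (mod 2)"
    using N0_0_4_mod_8_5[of n] N0_0_4_mod_8_7[of n] unfolding double cong_0_iff by presburger+
  moreover have "[N0 0 8 (16 * n + 13) = 0] (mod 4)"
    using N0_0_4_mod_16_13[of n] unfolding e double cong_0_iff by presburger
  moreover have "[N0 0 8 (16 * n + 15) = 0] (mod 16)"
    using N0_0_4_mod_16_15[of n] unfolding e double cong_0_iff by presburger
  moreover have "[N0 2 8 (8 * n + 1) = 0] (mod 4)"
    using N0_2_4_mod_8_1[of n] unfolding N0_2_4 cong_0_iff by presburger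
  moreover have "[N0 2 8 (16 * n + 11) = 0] (mod 8)"
    using N0_2_4_mod_16_11[of n] unfolding N0_2_4 cong_0_iff by presburger
  moreover have "[N0 2 8 (16 * n + 13) = 0] (mod 2)"
    using N0_2_4_mod_16_13[of n] unfolding N0_2_4 cong_0_iff by presburger
  moreover have "[N0 1 4 (40 * n + 28) = 0] (mod 5)" "[N0 1 4 (40 * n + 36) = 0] (mod 5)"
  proof -
    have "(5 * n + 3) mod 5 = 3" "(5 * n + 4) mod 5 = 4" by presburger+
    moreover have "8 * (5 * n + 3) + 4 = 40 * n + 28" "8 * (5 * n + 4) + 4 = 40 * n + 36" by simp_all
    ultimately show "[N0 1 4 (40 * n + 28) = 0] (mod 5)" "[N0 1 4 (40 * n + 36) = 0] (mod 5)"
      using N0_1_4_mod_5[of "5 * n + 3"] N0_1_4_mod_5[of "5 * n + 4"] by (simp_all only: simp_thms)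
  qed
  ultimately show ?thesis
    using N0_half_period_even[OF assms] N0_0_4_mod_8_5 N0_0_4_mod_8_7 N0_0_4_mod_16_13
      N0_1_4_mod_8_4 N0_1_4_mod_8_6 N0_2_4_mod_16_13
    by blast
qed

end
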